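(* Let $L$ be a finite distributive lattice and $P$ its poset of join-irreducible elements. Suppose $L$ is level. Then $$\operatorname{height}(x)+\operatorname{depth}(y)\le\operatorname{rank}\hat P+1$$ for all $x,y\in P$ with $x\gtrdot y$.
   Context: $\alpha\in L$ is join-irreducible if $\alpha\ne\min L$ and $\alpha=\beta\vee\gamma$ implies $\alpha=\beta$ or $\alpha=\gamma$; $L$ is isomorphic to the lattice of poset ideals (down-sets) of $P$. For a field $K$, the Hibi ring $K[L]$ is the $K$-algebra generated by the elements $\alpha\in L$ with defining relations $\alpha\beta=(\alpha\wedge\beta)(\alpha\vee\beta)$; it is a standard graded Cohen–Macaulay domain. A Cohen–Macaulay standard graded $K$-algebra $R$ is level if its canonical module $\omega_R$ is generated in a single degree. $L$ is called level if $K[L]$ is (independent of $K$). $\hat P=P\cup\{-\infty,\infty\}$ with $-\infty<x<\infty$ for all $x\in P$. The length of a chain $C$ is $|C|-1$; $\operatorname{rank}\hat P$ is the maximal length of a chain in $\hat P$; $\operatorname{height}(x)$ (resp. $\operatorname{depth}(x)$) is the maximal length of a chain in $\hat P$ descending (resp. ascending) from $x$. $x\gtrdot y$ means that $x$ covers $y$: $x>y$ and there is no $z\in P$ with $x>z>y$. Known combinatorial description: let $\mathcal S(\hat P)$ be the set of maps $v:\hat P\to\mathbb Z_{\ge0}$ with $v(\infty)=0$ and $v(x)\le v(y)$ whenever $x\ge y$, and $\mathcal T(\hat P)$ the set of maps $v:\hat P\to\mathbb Z_{\ge0}$ with $v(\infty)=0$ and $v(x)<v(y)$ whenever $x>y$.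 The monomials $s^{v(-\infty)}\prod_{x\in P}t_x^{v(x)}$, of degree $v(-\infty)$, with $v\in\mathcal S(\hat P)$ form a $K$-basis of $K[L]$, those with $v\in\mathcal T(\hat P)$ form a $K$-basis of $\omega_{K[L]}$, and $\min\{v(-\infty):v\in\mathcal T(\hat P)\}=\operatorname{rank}\hat P$. Hence $L$ is level if and only if for every $v\in\mathcal T(\hat P)$ there is $v'\in\mathcal T(\hat P)$ with $v'(-\infty)=\operatorname{rank}\hat P$ and $v-v'\in\mathcal S(\hat P)$. *)

theory Defs
  imports Complex_Main "HOL-Library.Poly_Mapping" "HOL-Library.Extended" "HOL-Library.Countable"
begin

section \<open>The poset of join-irreducible elements and its extension\<close>

definition join_irreducible :: "'a::{finite,distrib_lattice} \<Rightarrow> bool" where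
  "join_irreducible \<alpha> \<longleftrightarrow>
     \<alpha> \<noteq> Inf_fin UNIV \<and> (\<forall>\<beta> \<gamma>. \<alpha> = sup \<beta> \<gamma> \<longrightarrow> \<alpha> = \<beta> \<or> \<alpha> = \<gamma>)"

definition covers_in :: "'a::order set \<Rightarrow> 'a \<Rightarrow> 'a \<Rightarrow> bool" where
  "covers_in P x y \<longleftrightarrow> x \<in> P \<and> y \<in> P \<and> x > y \<and> (\<nexists>z. z \<in> P \<and> x > z \<and> z > y)"

definition hat :: "'a set \<Rightarrow> 'a extended set" where
  "hat P = {Minf, Pinf} \<union> Fin ` P"

definition hat_chain :: "'a::order set \<Rightarrow> 'a extended set \<Rightarrow> bool" where
  "hat_chain P C \<longleftrightarrow> C \<subseteq> hat P \<and> Complete_Partial_Order.chain (\<le>) C"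

definition rank_hat :: "'a::order set \<Rightarrow> nat" where
  "rank_hat P = Max {card C - 1 | C. hat_chain P C}"

definition height_hat :: "'a::order set \<Rightarrow> 'a extended \<Rightarrow> nat" where
  "height_hat P x = Max {card C - 1 | C. hat_chain P C \<and> x \<in> C \<and> (\<forall>c\<in>C. c \<le> x)}"

definition depth_hat :: "'a::order set \<Rightarrow> 'a extended \<Rightarrow> nat" where
  "depth_hat P x = Max {card C - 1 | C. hat_chain P C \<and> x \<in> C \<and> (\<forall>c\<in>C. x \<le> c)}"


section \<open>Standard graded algebras\<close>

text \<open>A standard graded \<open>K\<close>-algebra is given as \<open>R = S/I\<close> with \<open>S = K[x\<^sub>a : a \<in> X]\<close>, \<open>X\<close> the
  (finite) type of variables, and \<open>I\<close> a homogeneous ideal of \<open>S\<close>. Elements of \<open>R\<close> are represented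
  by polynomials and equality in \<open>R\<close> is congruence modulo \<open>I\<close>. Ideals of a commutative ring are
  its submodules as a module over itself, \<open>module.subspace (*)\<close> and \<open>module.span (*)\<close>.\<close>

type_synonym ('x, 'k) mpol = "('x \<Rightarrow>\<^sub>0 nat) \<Rightarrow>\<^sub>0 'k"

definition Var :: "'x \<Rightarrow> ('x, 'k::field) mpol" where
  "Var a = Poly_Mapping.single (Poly_Mapping.single a 1) 1"

definition Const :: "'k::field \<Rightarrow> ('x, 'k) mpol" where
  "Const c = Poly_Mapping.single 0 c"

definition homogeneous :: "int \<Rightarrow> ('x::finite, 'k::field) mpol \<Rightarrow> bool" where
  "homogeneous n p \<longleftrightarrow>
     (\<forall>m \<in> Poly_Mapping.keys p. int (\<Sum>a\<in>UNIV. Poly_Mapping.lookup m a) = n)"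

definition prime_ideal :: "'r::comm_ring_1 set \<Rightarrow> bool" where
  "prime_ideal p \<longleftrightarrow>
     module.subspace (*) p \<and> 1 \<notin> p \<and> (\<forall>a b. a * b \<in> p \<longrightarrow> a \<in> p \<or> b \<in> p)"

text \<open>Krull dimension of the quotient by \<open>I\<close>. For a proper ideal of a polynomial ring over a field
  in finitely many variables the set below is nonempty and bounded, so that \<open>Sup\<close> is a maximum.\<close>

definition quotient_dim :: "'r::comm_ring_1 set \<Rightarrow> nat" where
  "quotient_dim I = Sup {n. \<exists>p. (\<forall>i\<le>n. prime_ideal (p i) \<and> I \<subseteq> p i) \<and> (\<forall>i<n. p i \<subset> p (Suc i))}"


section \<open>Local cohomology, canonical module, level algebras\<close>

text \<open>The local cohomology of \<open>R = S/I\<close> at the graded maximal ideal is the cohomology of the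
  Cech complex \<open>C\<^sup>i = \<Oplus>\<^bsub>|F| = i\<^esub> R\<^bsub>x\<^sub>F\<^esub>\<close>, where \<open>F\<close> ranges over sets of variables and
  \<open>x\<^sub>F = \<Prod>\<^bsub>a\<in>F\<^esub> x\<^sub>a\<close>. The pair \<open>(k, f)\<close> stands for the cochain \<open>F \<mapsto> f F / x\<^sub>F\<^sup>k\<close>. For fixed \<open>k\<close>
  these pairs form the Koszul cochain complex of \<open>(x\<^sub>a\<^sup>k)\<close> with coefficients in \<open>R\<close>, the Cech
  complex is the direct limit of these along \<open>(k, f) \<mapsto> (k + 1, x\<^sub>F f)\<close>, and
  hence \<open>H\<^sup>i\<^sub>\<mm>(R)\<close> is the direct limit of the Koszul cohomology groups. The values of a cochain on
  sets of cardinality other than \<open>i\<close> are irrelevant. The enumeration \<open>to_nat\<close> of the variables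
  only fixes signs.\<close>

definition koszul_diff ::
    "nat \<Rightarrow> ('x::finite set \<Rightarrow> ('x, 'k::field) mpol) \<Rightarrow> 'x set \<Rightarrow> ('x, 'k) mpol" where
  "koszul_diff k f G =
     (\<Sum>a\<in>G. (- 1) ^ card {b \<in> G. to_nat b < to_nat a} * Var a ^ k * f (G - {a}))"

text \<open>Cocycles \<open>(k, f)\<close> of cohomological degree \<open>i\<close> and internal degree \<open>n\<close>; as \<open>f F\<close> is the numerator
  of a fraction with denominator \<open>x\<^sub>F\<^sup>k\<close>, its degree is \<open>n + i k\<close>.\<close>

definition cocycles ::
    "('x::finite, 'k::field) mpol set \<Rightarrow> nat \<Rightarrow> nat \<Rightarrow> int \<Rightarrow> ('x set \<Rightarrow> ('x, 'k) mpol) set" where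
  "cocycles I i k n =
     {f. (\<forall>F. card F = i \<longrightarrow> homogeneous (n + int (i * k)) (f F)) \<and>
         (\<forall>G. card G = Suc i \<longrightarrow> koszul_diff k f G \<in> I)}"

definition coboundaries ::
    "('x::finite, 'k::field) mpol set \<Rightarrow> nat \<Rightarrow> nat \<Rightarrow> ('x set \<Rightarrow> ('x, 'k) mpol) set" where
  "coboundaries I i k = {f. \<exists>g. \<forall>F. card F = i \<longrightarrow> f F - koszul_diff k g F \<in> I}"

text \<open>The degree \<open>j\<close> component \<open>Hom\<^sub>K(H\<^sup>i\<^sub>\<mm>(R)\<^bsub>-j\<^esub>, K)\<close> of the graded \<open>K\<close>-dual of \<open>H\<^sup>i\<^sub>\<mm>(R)\<close>. A linear
  form on the direct limit is a compatible family of linear forms \<open>\<phi> k\<close> on the Koszul cohomology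
  groups. Two families represent the same form iff they agree on \<open>cocycles I i k (- j)\<close> for all \<open>k\<close>.\<close>

definition local_cohomology_dual ::
    "('x::finite, 'k::field) mpol set \<Rightarrow> nat \<Rightarrow> int \<Rightarrow>
     (nat \<Rightarrow> ('x set \<Rightarrow> ('x, 'k) mpol) \<Rightarrow> 'k) set" where
  "local_cohomology_dual I i j =
     {\<phi>. \<forall>k. \<forall>f \<in> cocycles I i k (- j).
        (\<forall>g \<in> cocycles I i k (- j). \<phi> k (\<lambda>F. f F + g F) = \<phi> k f + \<phi> k g) \<and>
        (\<forall>c. \<phi> k (\<lambda>F. Const c * f F) = c * \<phi> k f) \<and>
        (f \<in> coboundaries I i k \<longrightarrow> \<phi> k f = 0) \<and>
        \<phi> (Suc k) (\<lambda>F. (\<Prod>a\<in>F. Var a) * f F) = \<phi> k f}"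

text \<open>For \<open>R = S/I\<close> Cohen-Macaulay of Krull dimension \<open>d\<close>, the graded canonical module \<open>\<omega>\<^sub>R\<close> is the
  graded \<open>K\<close>-dual of \<open>H\<^sup>d\<^sub>\<mm>(R)\<close>; this is its degree \<open>j\<close> component. An element \<open>r\<close> of \<open>R\<close> acts on it by
  \<open>(r \<phi>) k f = \<phi> k (r f)\<close>.\<close>

definition canonical_module ::
    "('x::finite, 'k::field) mpol set \<Rightarrow> int \<Rightarrow>
     (nat \<Rightarrow> ('x set \<Rightarrow> ('x, 'k) mpol) \<Rightarrow> 'k) set" where
  "canonical_module I j = local_cohomology_dual I (quotient_dim I) j"

text \<open>Levelness of a Cohen-Macaulay algebra \<open>R = S/I\<close>: there is a degree \<open>e\<close> such that every
  homogeneous element \<open>\<phi>\<close> of \<open>\<omega>\<^sub>R\<close>, of any degree \<open>j\<close>, is a linear combination of elements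
  of degree \<open>e\<close> with coefficients in \<open>R\<^bsub>j - e\<^esub>\<close>. Cohen-Macaulayness is not repeated in the
  definition as Hibi rings always have this property.\<close>

definition level_algebra :: "('x::finite, 'k::field) mpol set \<Rightarrow> bool" where
  "level_algebra I \<longleftrightarrow>
     (\<exists>e. \<forall>j. \<forall>\<phi> \<in> canonical_module I j.
        \<exists>(n::nat) r \<psi>.
          (\<forall>l<n. homogeneous (j - e) (r l) \<and> \<psi> l \<in> canonical_module I e) \<and>
          (\<forall>k. \<forall>f \<in> cocycles I (quotient_dim I) k (- j).
             \<phi> k f = (\<Sum>l<n. \<psi> l k (\<lambda>F. r l * f F))))"


section \<open>Hibi rings\<close>

text \<open>The defining ideal of the Hibi ring \<open>K[L]\<close>, where \<open>L\<close> is the type \<^typ>\<open>'a\<close>.\<close>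

definition hibi_ideal :: "('a::{finite,distrib_lattice}, 'k::field) mpol set" where
  "hibi_ideal =
     module.span (*) {Var \<alpha> * Var \<beta> - Var (inf \<alpha> \<beta>) * Var (sup \<alpha> \<beta>) | \<alpha> \<beta>. True}"

end

(*
  Write hat P for P with -oo and oo adjoined.  A strictly decreasing v on hat P with v(oo) = 0 defines
  a linear form on the top local cohomology of K[L] in multidegree -v: the signed sum over the maximal
  chains C of L of the coefficients of the expected multidegree on C.  It kills coboundaries because
  two maximal chains differing in one element cancel and the remaining codimension one chains lie in
  facets of the cone of multidegrees.  Levelness with generating degree e therefore produces, from any
  cocycle on which the form does not vanish, a monomial m of degree v(-oo) - e whose product with the
  cocycle is not a coboundary.

  Number hat P along a linear extension and label each ideal by its first missing element.  The
  cocycle supported on the sets on which the labels are all distinct is detected by exactly one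
  maximal chain.  Suppose that b < p and that every other element below p precedes b.  A set that
  carries all labels but that of p then meets every facet complement except the one of the pair
  b < p, so m times the cocycle is a coboundary as soon as u = v - mdeg m satisfies u(b) <= u(p).
  Hence u(b) > u(p) for all such pairs.

  If height x + depth y > rank + 1, some linear extension makes all steps of a longest chain below x
  and of a longest chain above y such pairs.  Choosing v with v(y) = v(x) + 1 gives
  e = u(-oo) >= height x + u(x) >= height x + depth y - 1 > rank, whereas v = depth gives e <= rank.
*)

theory Submission
  imports Defs "HOL-Library.FuncSet"
begin

text \<open>The canonical module enters only as the dual of local cohomology, and no basis of it is
  computed. The elements of degree e that levelness provides are unknown forms: they are linear,
  kill coboundaries and are compatible with raising the exponent k, and nothing else is known of
  them. Hence one explicit form is evaluated on one explicit cocycle, and its nonvanishing is handed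
  on to an unknown form. Both objects live in cohomological degree \<open>quotient_dim\<close>, so
  the Krull dimension |P| + 1 has to be computed from chains of primes. Since m depends on the
  numbering, one numbering must serve the chain below x and the chain above y at once; the
  assumption that height x + depth y exceeds rank + 1 is what keeps the two chains from interfering.
  The 1 in the bound comes from the step from y to x: for a cover, v(y) - v(x) can be pressed down
  to 1, and subtracting the order-reversing \<open>mdeg m\<close> cannot enlarge this
  difference.\<close>

lemma module_times: "module ((*) :: 'r::comm_ring_1 \<Rightarrow> 'r \<Rightarrow> 'r)"
  by unfold_locales (simp_all add: algebra_simps)

interpretation ring_module: module "(*) :: 'r::comm_ring_1 \<Rightarrow> 'r \<Rightarrow> 'r"
  by (rule module_times)

section \<open>The ideal representation of a finite distributive lattice\<close>

abbreviation bottom :: "'a::{finite,distrib_lattice}" where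
  "bottom \<equiv> Inf_fin UNIV"

lemma bottom_le [simp]: "bottom \<le> (a::'a::{finite,distrib_lattice})"
  by (simp add: Inf_fin.coboundedI)

lemma join_irreducible_not_le_bottom:
  "join_irreducible (z::'a::{finite,distrib_lattice}) \<Longrightarrow> \<not> z \<le> bottom"
  using bottom_le[of z] by (auto simp: join_irreducible_def dest: order.antisym)

text \<open>By distributivity \<open>z\<close> is the join of \<open>inf z a\<close> and
  \<open>inf z b\<close>, so join-irreducible elements are join-prime. This turns joins of lattice
  elements into unions of ideals.\<close>

lemma join_irreducible_le_sup_iff:
  assumes "join_irreducible (z::'a::{finite,distrib_lattice})"
  shows "z \<le> sup a b \<longleftrightarrow> z \<le> a \<or> z \<le> b"
proof
  assume "z \<le> sup a b"
  then have "z = sup (inf z a) (inf z b)"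
    by (metis inf.absorb_iff1 inf_sup_distrib1)
  then have "z = inf z a \<or> z = inf z b"
    using assms unfolding join_irreducible_def by blast
  then show "z \<le> a \<or> z \<le> b" by (metis inf.absorb_iff1)
qed (auto intro: le_supI1 le_supI2)

text \<open>Induction on the number of smaller elements: an element that is not join-irreducible is
  \<open>bottom\<close> or the join of two smaller ones.\<close>

lemma le_if_join_irreducibles_le:
  fixes a :: "'a::{finite,distrib_lattice}"
  assumes "\<And>z. join_irreducible z \<Longrightarrow> z \<le> a \<Longrightarrow> z \<le> b"
  shows "a \<le> b"
  using assms
proof (induction "card {c. c < a}" arbitrary: a rule: less_induct)
  case less
  have smaller: "c \<le> b" if "c < a" for c
  proof (rule less.hyps)
    have "{d. d < c} \<subset> {d. d < a}" using that by (auto dest: order.strict_trans)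
    then show "card {d. d < c} < card {d. d < a}" by (intro psubset_card_mono) auto
    show "\<And>z. join_irreducible z \<Longrightarrow> z \<le> c \<Longrightarrow> z \<le> b"
      using less.prems that by (meson order.strict_implies_order order.trans)
  qed
  show ?case
  proof (cases "join_irreducible a")
    case True then show ?thesis using less.prems by simp
  next
    case False
    then consider "a = bottom" | c d where "a = sup c d" "a \<noteq> c" "a \<noteq> d"
      by (auto simp: join_irreducible_def)
    then show ?thesis
    proof cases
      case 2
      then have "c < a" "d < a" by (auto simp: less_le)
      then show ?thesis using smaller 2 by simp
    qed simp
  qed
qed

lemma eq_if_join_irreducibles_eq:
  fixes a :: "'a::{finite,distrib_lattice}"
  assumes "\<And>z. join_irreducible z \<Longrightarrow> z \<le> a \<longleftrightarrow> z \<le> b"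
  shows "a = b"
proof (rule order.antisym)
  show "a \<le> b" by (rule le_if_join_irreducibles_le) (simp add: assms)
  show "b \<le> a" by (rule le_if_join_irreducibles_le) (simp add: assms)
qed

text \<open>Inserting \<open>bottom\<close> gives the empty join a value and adds no
  join-irreducible element.\<close>

definition join_set :: "'a::{finite,distrib_lattice} set \<Rightarrow> 'a" where
  "join_set J = Sup_fin (insert bottom J)"

lemma join_irreducible_le_Sup_fin:
  fixes z :: "'a::{finite,distrib_lattice}"
  assumes "join_irreducible z" "A \<noteq> {}"
  shows "z \<le> Sup_fin A \<longleftrightarrow> (\<exists>a\<in>A. z \<le> a)"
proof -
  have "finite A" by simp
  then show ?thesis using assms(2)
  proof (induction A rule: finite_ne_induct)
    case (insert a A)
    then show ?case by (simp add: join_irreducible_le_sup_iff[OF assms(1)])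
  qed simp
qed

lemma join_irreducible_le_join_set:
  fixes z :: "'a::{finite,distrib_lattice}"
  assumes "join_irreducible z"
  shows "z \<le> join_set J \<longleftrightarrow> (\<exists>a\<in>J. z \<le> a)"
  unfolding join_set_def join_irreducible_le_Sup_fin[OF assms insert_not_empty]
  using join_irreducible_not_le_bottom[OF assms] by auto

section \<open>Multidegrees\<close>

text \<open>The exponents of the monomial in s and the t_z that represents the variable of
  \<open>a\<close>. The value at -oo is the exponent of s, that is, the standard degree.\<close>

definition ind :: "'a::{finite,distrib_lattice} extended \<Rightarrow> 'a \<Rightarrow> int" where
  "ind z a = (case z of -\<infinity> \<Rightarrow> 1 | Fin p \<Rightarrow> of_bool (join_irreducible p \<and> p \<le> a) | \<infinity> \<Rightarrow> 0)"

lemma ind_simps [simp]: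
  "ind (-\<infinity>) a = 1" "ind \<infinity> a = 0"
  "ind (Fin p) a = of_bool (join_irreducible p \<and> p \<le> a)"
  by (simp_all add: ind_def)

lemma ind_nonneg [simp]: "ind z a \<ge> 0" by (cases z) auto
lemma ind_le_1: "ind z a \<le> 1" by (cases z) auto

lemma ind_inf_sup: "ind z (inf a b) + ind z (sup a b) = ind z a + ind z b"
  by (cases z) (auto simp: join_irreducible_le_sup_iff of_bool_def)

text \<open>Multidegrees take values in \<open>int\<close> because the canonical module is the dual of local cohomology,
  which lives in negative multidegrees.\<close>

definition mdeg :: "('a::{finite,distrib_lattice} \<Rightarrow>\<^sub>0 nat) \<Rightarrow> 'a extended \<Rightarrow> int" where
  "mdeg m z = (\<Sum>a\<in>UNIV. int (Poly_Mapping.lookup m a) * ind z a)"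

lemma mdeg_zero [simp]: "mdeg 0 z = 0" by (simp add: mdeg_def)

lemma mdeg_add [simp]: "mdeg (m + m') z = mdeg m z + mdeg m' z"
  by (simp add: mdeg_def lookup_add algebra_simps sum.distrib)

lemma mdeg_single [simp]: "mdeg (Poly_Mapping.single a k) z = int k * ind z a"
proof -
  have "mdeg (Poly_Mapping.single a k) z = (\<Sum>b\<in>UNIV. if a = b then int k * ind z a else 0)"
    unfolding mdeg_def by (intro sum.cong) (auto simp: lookup_single when_def)
  then show ?thesis by simp
qed

lemma mdeg_Minf: "mdeg m (-\<infinity>) = int (\<Sum>a\<in>UNIV. Poly_Mapping.lookup m a)"
  by (simp add: mdeg_def)

lemma mdeg_Minf_eq_0_iff: "mdeg m (-\<infinity>) = 0 \<longleftrightarrow> m = 0"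
  by (auto simp: mdeg_Minf intro!: poly_mapping_eqI simp del: of_nat_sum)

lemma mdeg_Pinf [simp]: "mdeg m \<infinity> = 0" by (simp add: mdeg_def)

lemma mdeg_nonneg [simp]: "mdeg m z \<ge> 0" by (simp add: mdeg_def sum_nonneg)

lemma mdeg_antimono: "mdeg m z' \<le> mdeg m z" if "z \<le> z'" "z \<in> hat {a. join_irreducible a}"
proof -
  have "ind z' a \<le> ind z a" for a
    using that by (cases z; cases z') (auto simp: hat_def intro: order.trans)
  then show ?thesis unfolding mdeg_def by (intro sum_mono mult_left_mono) auto
qed

lemma mdeg_outside [simp]: "\<not> join_irreducible p \<Longrightarrow> mdeg m (Fin p) = 0"
  by (simp add: mdeg_def)

text \<open>The coefficient at \<open>w\<close> of the image of \<open>p\<close> in the monoid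
  algebra of multidegrees. The function \<open>mcoeff p\<close> stands for the class of
  \<open>p\<close> in K[L], which \<open>hibi_ideal_iff\<close> justifies.\<close>

definition mcoeff :: "('a::{finite,distrib_lattice}, 'k::field) mpol \<Rightarrow> ('a extended \<Rightarrow> int) \<Rightarrow> 'k" where
  "mcoeff p w = (\<Sum>m\<in>Poly_Mapping.keys p. if mdeg m = w then Poly_Mapping.lookup p m else 0)"

lemma mcoeff_superset:
  assumes "finite A" "Poly_Mapping.keys p \<subseteq> A"
  shows "mcoeff p w = (\<Sum>m\<in>A. if mdeg m = w then Poly_Mapping.lookup p m else 0)"
  unfolding mcoeff_def using assms
  by (intro sum.mono_neutral_left) (auto simp: in_keys_iff)

lemma mcoeff_zero [simp]: "mcoeff 0 w = 0" by (simp add: mcoeff_def)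

lemma mcoeff_add [simp]: "mcoeff (p + q) w = mcoeff p w + mcoeff q w"
proof -
  let ?A = "Poly_Mapping.keys p \<union> Poly_Mapping.keys q"
  have "mcoeff (p + q) w = (\<Sum>m\<in>?A. if mdeg m = w then Poly_Mapping.lookup (p + q) m else 0)"
    by (rule mcoeff_superset) (simp_all add: keys_add)
  also have "\<dots> = (\<Sum>m\<in>?A. if mdeg m = w then Poly_Mapping.lookup p m else 0)
      + (\<Sum>m\<in>?A. if mdeg m = w then Poly_Mapping.lookup q m else 0)"
    unfolding sum.distrib[symmetric] by (intro sum.cong) (auto simp: lookup_add)
  also have "\<dots> = mcoeff p w + mcoeff q w"
    by (subst (1 2) mcoeff_superset[of ?A]) auto
  finally show ?thesis .
qed

lemma mcoeff_uminus [simp]: "mcoeff (- p) w = - mcoeff p w"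
  using mcoeff_add[of p "- p" w] by (simp add: eq_neg_iff_add_eq_0 add.commute)

lemma mcoeff_diff [simp]: "mcoeff (p - q) w = mcoeff p w - mcoeff q w"
  using mcoeff_add[of p "- q" w] by simp

lemma mcoeff_sum [simp]: "mcoeff (\<Sum>x\<in>X. p x) w = (\<Sum>x\<in>X. mcoeff (p x) w)"
  by (induction X rule: infinite_finite_induct) auto

lemma mcoeff_single: "mcoeff (Poly_Mapping.single m c) w = (if mdeg m = w then c else 0)"
  by (simp add: mcoeff_def)

lemma single_sum: "Poly_Mapping.single m (\<Sum>x\<in>X. c x) = (\<Sum>x\<in>X. Poly_Mapping.single m (c x))"
  by (induction X rule: infinite_finite_induct) (simp_all add: single_add)

lemma sum_monomials: "(\<Sum>m\<in>Poly_Mapping.keys p. Poly_Mapping.single m (Poly_Mapping.lookup p m)) = p"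
proof (rule poly_mapping_eqI)
  fix k
  show "Poly_Mapping.lookup (\<Sum>m\<in>Poly_Mapping.keys p. Poly_Mapping.single m (Poly_Mapping.lookup p m)) k
      = Poly_Mapping.lookup p k"
    by (auto simp: lookup_sum lookup_single when_def in_keys_iff
        intro!: trans[OF sum.delta'])
qed

lemma poly_mapping_sum_induct [case_names zero single add]:
  fixes P :: "('a \<Rightarrow>\<^sub>0 'b::comm_monoid_add) \<Rightarrow> bool"
  assumes "P 0" "\<And>m c. P (Poly_Mapping.single m c)" "\<And>p q. P p \<Longrightarrow> P q \<Longrightarrow> P (p + q)"
  shows "P p"
proof -
  have "P (\<Sum>m\<in>A. Poly_Mapping.single m (Poly_Mapping.lookup p m))" for A
    using assms by (induction A rule: infinite_finite_induct) auto
  from this[of "Poly_Mapping.keys p"] show ?thesis by (simp only: sum_monomials)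
qed

lemma mcoeff_single_mult:
  "mcoeff (Poly_Mapping.single m c * p) w = c * mcoeff p (\<lambda>z. w z - mdeg m z)"
proof (induction p rule: poly_mapping_sum_induct)
  case (single m' c')
  have "mdeg (m + m') = w \<longleftrightarrow> mdeg m' = (\<lambda>z. w z - mdeg m z)"
    by (auto simp: fun_eq_iff algebra_simps)
  then show ?case by (simp add: mult_single mcoeff_single)
qed (simp_all add: algebra_simps)

lemma Var_power: "Var a ^ k = Poly_Mapping.single (Poly_Mapping.single a k) 1"
  by (induction k) (simp_all add: Var_def mult_single single_add[symmetric])

lemma mcoeff_Var_power_mult: "mcoeff (Var a ^ k * p) w = mcoeff p (\<lambda>z. w z - int k * ind z a)"
  by (simp add: Var_power mcoeff_single_mult)

lemma mcoeff_Const_mult: "mcoeff (Const c * p) w = c * mcoeff p w"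
  by (simp add: Const_def mcoeff_single_mult)

lemma prod_Var: "finite F \<Longrightarrow> (\<Prod>a\<in>F. Var a) = Poly_Mapping.single (\<Sum>a\<in>F. Poly_Mapping.single a 1) 1"
  by (induction F rule: finite_induct) (simp_all add: Var_def mult_single)

lemma mdeg_sum [simp]: "mdeg (\<Sum>x\<in>X. m x) z = (\<Sum>x\<in>X. mdeg (m x) z)"
  by (induction X rule: infinite_finite_induct) auto

lemma mcoeff_mult_eq_0:
  assumes "\<And>w. mcoeff p w = 0" shows "mcoeff (q * p) w = 0"
  by (induction q rule: poly_mapping_sum_induct)
    (simp_all add: mcoeff_single_mult assms distrib_right)

lemma mcoeff_hibi_ideal:
  assumes "p \<in> (hibi_ideal :: ('a::{finite,distrib_lattice}, 'k::field) mpol set)"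
  shows "mcoeff p w = 0"
proof -
  have "ring_module.subspace {p :: ('a, 'k) mpol. \<forall>w. mcoeff p w = 0}"
    by (intro ring_module.subspaceI) (auto intro: mcoeff_mult_eq_0)
  moreover have "mcoeff (Var a * Var b - Var (inf a b) * Var (sup a b) :: ('a, 'k) mpol) w = 0"
    for a b :: 'a and w
    by (simp add: Var_def mult_single mcoeff_single fun_eq_iff ind_inf_sup)
  ultimately have "hibi_ideal \<subseteq> {p :: ('a, 'k) mpol. \<forall>w. mcoeff p w = 0}"
    unfolding hibi_ideal_def by (intro ring_module.span_minimal) auto
  then show ?thesis using assms by blast
qed

section \<open>Straightening\<close>

lemma hibi_ideal_subspace: "ring_module.subspace (hibi_ideal :: ('a::{finite,distrib_lattice}, 'k::field) mpol set)"
  unfolding hibi_ideal_def by (rule ring_module.subspace_span)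

lemmas hibi_ideal_add = ring_module.subspace_add[OF hibi_ideal_subspace]
  and hibi_ideal_diff = ring_module.subspace_diff[OF hibi_ideal_subspace]
  and hibi_ideal_mult = ring_module.subspace_scale[OF hibi_ideal_subspace]
  and hibi_ideal_0 = ring_module.subspace_0[OF hibi_ideal_subspace]
  and hibi_ideal_sum = ring_module.subspace_sum[OF hibi_ideal_subspace]

text \<open>The type token fixes the coefficient field, which the two monomials do not
  mention.\<close>

definition mcong :: "('a::{finite,distrib_lattice} \<Rightarrow>\<^sub>0 nat) \<Rightarrow> ('a \<Rightarrow>\<^sub>0 nat) \<Rightarrow> 'k::field itself \<Rightarrow> bool" where
  "mcong m m' _ \<longleftrightarrow> (Poly_Mapping.single m 1 - Poly_Mapping.single m' 1 :: ('a, 'k) mpol) \<in> hibi_ideal"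

lemma mcong_refl [simp]: "mcong m m K" by (simp add: mcong_def hibi_ideal_0)

lemma mcong_sym: "mcong m m' K \<Longrightarrow> mcong m' m K"
  unfolding mcong_def using hibi_ideal_diff[OF hibi_ideal_0] by fastforce

lemma mcong_trans: "mcong m m' K \<Longrightarrow> mcong m' m'' K \<Longrightarrow> mcong m m'' K"
  unfolding mcong_def using hibi_ideal_add by fastforce

lemma mcong_add: "mcong m m' (K :: 'k::field itself) \<Longrightarrow> mcong (n + m) (n + m') K"
  unfolding mcong_def
  using hibi_ideal_mult[of "Poly_Mapping.single m 1 - Poly_Mapping.single m' 1" "Poly_Mapping.single n 1 :: ('a, 'k) mpol"]
  by (simp add: right_diff_distrib mult_single)

lemma mcong_straighten:
  "mcong (Poly_Mapping.single a 1 + Poly_Mapping.single b 1)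
    (Poly_Mapping.single (sup a b) 1 + Poly_Mapping.single (inf a b) 1) K"
  unfolding mcong_def hibi_ideal_def
  by (rule ring_module.span_base, rule CollectI, rule exI[of _ a], rule exI[of _ b])
    (simp add: Var_def mult_single add.commute)

lemma mcong_mdeg: "mcong m m' (K :: 'k::field itself) \<Longrightarrow> mdeg m = mdeg m'"
  using mcoeff_hibi_ideal[of "Poly_Mapping.single m 1 - Poly_Mapping.single m' 1 :: ('a, 'k) mpol" "mdeg m"]
  by (auto simp: mcong_def mcoeff_single split: if_splits)

lemma monomial_remove:
  fixes m :: "'a::finite \<Rightarrow>\<^sub>0 nat"
  assumes "Poly_Mapping.lookup m a > 0"
  shows "m = Poly_Mapping.single a 1 + (m - Poly_Mapping.single a 1)"
  using assms by (intro poly_mapping_eqI) (auto simp: lookup_add lookup_minus lookup_single when_def)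

lemma mdeg_remove:
  assumes "Poly_Mapping.lookup m a > 0"
  shows "mdeg (m - Poly_Mapping.single a 1) z = mdeg m z - ind z a"
  by (subst (2) monomial_remove[OF assms]) simp

text \<open>Every nonconstant monomial is congruent to a multiple of the variable indexed by the join of
  its support, and this join is determined by the multidegree.\<close>

lemma mcong_extract_join:
  assumes "(\<Sum>a\<in>UNIV. Poly_Mapping.lookup m a) = Suc k"
  shows "\<exists>a m'. mcong m (Poly_Mapping.single a 1 + m') K \<and>
    (\<forall>p. join_irreducible p \<longrightarrow> p \<le> a \<longleftrightarrow> mdeg m (Fin p) > 0)"
  using assms
proof (induction k arbitrary: m)
  case (0 m)
  then obtain a where a: "Poly_Mapping.lookup m a > 0"
    by (metis (no_types, lifting) gr0I sum.neutral zero_neq_one One_nat_def)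
  let ?n = "m - Poly_Mapping.single a 1"
  note m = monomial_remove[OF a]
  have "mdeg ?n (-\<infinity>) = 0"
    using 0 by (simp only: mdeg_remove[OF a] mdeg_Minf[of m]) simp
  then have "?n = 0" by (simp only: mdeg_Minf_eq_0_iff)
  then have m: "m = Poly_Mapping.single a 1" using m by simp
  show ?case by (rule exI[of _ a], rule exI[of _ 0]) (simp add: m)
next
  case (Suc k m)
  then obtain b where b: "Poly_Mapping.lookup m b > 0"
    by (metis (no_types, lifting) gr0I sum.neutral nat.distinct(1))
  let ?n = "m - Poly_Mapping.single b 1"
  note m = monomial_remove[OF b]
  have "mdeg ?n (-\<infinity>) = int (Suc k)"
    using Suc.prems by (simp only: mdeg_remove[OF b] mdeg_Minf[of m]) simp
  then have "(\<Sum>a\<in>UNIV. Poly_Mapping.lookup ?n a) = Suc k" by (simp only: mdeg_Minf of_nat_eq_iff)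
  from Suc.IH[OF this] obtain a m' where
    am': "mcong ?n (Poly_Mapping.single a 1 + m') K"
      "\<And>p. join_irreducible p \<Longrightarrow> p \<le> a \<longleftrightarrow> mdeg ?n (Fin p) > 0"
    by blast
  have "mcong m (Poly_Mapping.single b 1 + (Poly_Mapping.single a 1 + m')) K"
    using mcong_add[OF am'(1), of "Poly_Mapping.single b 1"] m by simp
  moreover have "mcong (Poly_Mapping.single b 1 + (Poly_Mapping.single a 1 + m'))
      (Poly_Mapping.single (sup b a) 1 + (Poly_Mapping.single (inf b a) 1 + m')) K"
    using mcong_add[OF mcong_straighten[of b a], of m'] by (simp add: ac_simps)
  ultimately have "mcong m (Poly_Mapping.single (sup b a) 1 + (Poly_Mapping.single (inf b a) 1 + m')) K"
    by (rule mcong_trans)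
  moreover have "p \<le> sup b a \<longleftrightarrow> mdeg m (Fin p) > 0" if "join_irreducible p" for p
    by (subst m) (auto simp: am'(2)[OF that] that join_irreducible_le_sup_iff[OF that] add_pos_nonneg)
  ultimately show ?case by blast
qed

text \<open>Induction on the degree. Equal multidegrees give the same join of the support, hence the
  same extracted variable, and the two cofactors again have equal multidegrees.\<close>

lemma mcong_iff_mdeg: "mcong m m' K \<longleftrightarrow> mdeg m = mdeg m'"
proof
  assume "mdeg m = mdeg m'"
  then show "mcong m m' K"
  proof (induction "\<Sum>a\<in>UNIV. Poly_Mapping.lookup m a" arbitrary: m m')
    case 0
    then have "mdeg m (-\<infinity>) = 0" "mdeg m' (-\<infinity>) = 0" by (metis mdeg_Minf of_nat_0)+
    then have "m = 0" "m' = 0" by (simp_all add: mdeg_Minf_eq_0_iff)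
    then show ?case by simp
  next
    case (Suc k)
    have "(\<Sum>a\<in>UNIV. Poly_Mapping.lookup m' a) = Suc k"
      using Suc mdeg_Minf[of m] mdeg_Minf[of m'] by (metis of_nat_eq_iff)
    then obtain a n b n' where
      an: "mcong m (Poly_Mapping.single a 1 + n) K"
        "\<And>p. join_irreducible p \<Longrightarrow> p \<le> a \<longleftrightarrow> mdeg m (Fin p) > 0" and
      bn': "mcong m' (Poly_Mapping.single b 1 + n') K"
        "\<And>p. join_irreducible p \<Longrightarrow> p \<le> b \<longleftrightarrow> mdeg m' (Fin p) > 0"
      using mcong_extract_join[OF Suc(2)[symmetric], of K] mcong_extract_join[of m' k K] by blast
    have "a = b"
      by (rule eq_if_join_irreducibles_eq) (simp add: an(2) bn'(2) Suc.prems)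
    have eq: "mdeg (Poly_Mapping.single a 1 + n) = mdeg (Poly_Mapping.single a 1 + n')"
      using mcong_mdeg[OF an(1)] mcong_mdeg[OF bn'(1)] Suc.prems \<open>a = b\<close> by simp
    have nn': "mdeg n = mdeg n'"
      by (rule ext) (use fun_cong[OF eq] in simp)
    have "mdeg m (-\<infinity>) = 1 + mdeg n (-\<infinity>)"
      using fun_cong[OF mcong_mdeg[OF an(1)], of "-\<infinity>"] by simp
    then have "k = (\<Sum>a\<in>UNIV. Poly_Mapping.lookup n a)"
      using Suc(2) by (simp add: mdeg_Minf flip: of_nat_sum)
    from Suc.hyps(1)[OF this nn'] have "mcong (Poly_Mapping.single a 1 + n) (Poly_Mapping.single b 1 + n') K"
      using \<open>a = b\<close> by (simp add: mcong_add)
    then show ?case using an(1) bn'(1) mcong_trans mcong_sym by blast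
  qed
qed (rule mcong_mdeg)

text \<open>Replacing every monomial by a fixed representative of its multidegree changes
  \<open>p\<close> only by an element of the ideal and collects the coefficients into the numbers
  \<open>mcoeff p w\<close>.\<close>

lemma hibi_ideal_iff:
  "p \<in> (hibi_ideal :: ('a::{finite,distrib_lattice}, 'k::field) mpol set) \<longleftrightarrow> (\<forall>w. mcoeff p w = 0)"
proof
  assume *: "\<forall>w. mcoeff p w = 0"
  define std where "std = (\<lambda>w :: 'a extended \<Rightarrow> int. SOME m :: 'a \<Rightarrow>\<^sub>0 nat. mdeg m = w)"
  have std: "mdeg (std (mdeg m)) = mdeg m" for m
    unfolding std_def by (rule someI[of "\<lambda>m'. mdeg m' = mdeg m" m]) simp
  let ?A = "Poly_Mapping.keys p" and ?l = "Poly_Mapping.lookup p"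
  have "(\<Sum>m\<in>?A. Poly_Mapping.single (std (mdeg m)) (?l m))
      = (\<Sum>w\<in>mdeg ` ?A. \<Sum>m | m \<in> ?A \<and> mdeg m = w. Poly_Mapping.single (std (mdeg m)) (?l m))"
    by (rule sum.image_gen) simp
  also have "\<dots> = (\<Sum>w\<in>mdeg ` ?A. Poly_Mapping.single (std w) (mcoeff p w))"
  proof (intro sum.cong refl)
    fix w
    have "(\<Sum>m | m \<in> ?A \<and> mdeg m = w. Poly_Mapping.single (std (mdeg m)) (?l m))
        = (\<Sum>m | m \<in> ?A \<and> mdeg m = w. Poly_Mapping.single (std w) (?l m))"
      by (intro sum.cong) auto
    also have "\<dots> = Poly_Mapping.single (std w) (\<Sum>m | m \<in> ?A \<and> mdeg m = w. ?l m)"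
      by (rule single_sum[symmetric])
    also have "(\<Sum>m | m \<in> ?A \<and> mdeg m = w. ?l m) = mcoeff p w"
      unfolding mcoeff_def by (simp add: sum.inter_filter)
    finally show "(\<Sum>m | m \<in> ?A \<and> mdeg m = w. Poly_Mapping.single (std (mdeg m)) (?l m))
      = Poly_Mapping.single (std w) (mcoeff p w)" .
  qed
  also have "\<dots> = 0" using * by simp
  finally have "p = (\<Sum>m\<in>?A. Poly_Mapping.single m (?l m) - Poly_Mapping.single (std (mdeg m)) (?l m))"
    by (simp add: sum_subtractf sum_monomials)
  also have "\<dots> \<in> hibi_ideal"
  proof (intro hibi_ideal_sum)
    fix m
    have "Poly_Mapping.single m 1 - Poly_Mapping.single (std (mdeg m)) 1 \<in> (hibi_ideal :: ('a, 'k) mpol set)"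
      using mcong_iff_mdeg[of m "std (mdeg m)" "TYPE('k)"] std by (simp add: mcong_def)
    from hibi_ideal_mult[OF this, of "Const (?l m)"]
    show "Poly_Mapping.single m (?l m) - Poly_Mapping.single (std (mdeg m)) (?l m) \<in> hibi_ideal"
      by (simp add: Const_def right_diff_distrib mult_single)
  qed
  finally show "p \<in> hibi_ideal" .
qed (auto intro: mcoeff_hibi_ideal)

text \<open>Layer decomposition: the positive support of \<open>w\<close> is an ideal of the poset,
  hence a lattice element \<open>a\<close>; subtracting its indicator keeps \<open>w\<close>
  order-reversing and lowers the value at -oo by one. With \<open>mdeg_antimono\<close> this
  identifies the multidegrees with S(hat P).\<close>

lemma exists_monomial_mdeg:
  fixes w :: "'a::{finite,distrib_lattice} extended \<Rightarrow> int"
  assumes "w \<infinity> = 0" "\<And>p. \<not> join_irreducible p \<Longrightarrow> w (Fin p) = 0"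
    and "\<And>z z'. z \<in> hat {a. join_irreducible a} \<Longrightarrow> z' \<in> hat {a. join_irreducible a} \<Longrightarrow> z < z' \<Longrightarrow> w z' \<le> w z"
  shows "\<exists>m. mdeg m = w"
  using assms
proof (induction "nat (w (-\<infinity>))" arbitrary: w)
  case 0
  have "w z = 0" for z
  proof (cases z)
    case (Fin p)
    have "0 \<le> w (Fin p)" "w (Fin p) \<le> w (-\<infinity>)" if "join_irreducible p"
      using 0(4)[of "Fin p" \<infinity>] 0(4)[of "-\<infinity>" "Fin p"] 0(2) that by (auto simp: hat_def)
    then show ?thesis using 0(1,3) Fin by force
  next
    case Minf
    then show ?thesis using 0(1,2) 0(4)[of "-\<infinity>" \<infinity>] by (auto simp: hat_def)
  qed (use 0 in auto)
  then show ?case by (intro exI[of _ 0] ext) simp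
next
  case (Suc k)
  define a where "a = join_set {p. join_irreducible p \<and> w (Fin p) > 0}"
  have a: "p \<le> a \<longleftrightarrow> w (Fin p) > 0" if "join_irreducible p" for p
  proof -
    have "w (Fin p) > 0" if "join_irreducible q" "w (Fin q) > 0" "p \<le> q" for q
      using Suc.prems(3)[of "Fin p" "Fin q"] that \<open>join_irreducible p\<close>
      by (cases "p = q") (auto simp: hat_def less_le)
    then show ?thesis using that unfolding a_def join_irreducible_le_join_set[OF that] by blast
  qed
  have "\<exists>m. mdeg m = (\<lambda>z. w z - ind z a)"
  proof (rule Suc.hyps)
    show "k = nat (w (-\<infinity>) - ind (-\<infinity>) a)" using Suc(2) by simp
    show "w \<infinity> - ind \<infinity> a = 0" using Suc by simp
    show "w (Fin p) - ind (Fin p) a = 0" if "\<not> join_irreducible p" for p using Suc that by simp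
    fix z z' :: "'a extended" assume z: "z \<in> hat {a. join_irreducible a}" "z' \<in> hat {a. join_irreducible a}" "z < z'"
    have "w z' \<le> w z" using Suc.prems(3) z by blast
    \<comment> \<open>If the indicator drops between \<open>z\<close> and \<open>z'\<close>, then
      \<open>w\<close> drops there from a positive value to 0, so the order survives the
      subtraction.\<close>
    moreover have "ind z'' a = of_bool (w z'' > 0)" if "z'' \<in> hat {a. join_irreducible a}" for z''
      using that a Suc.prems(1) Suc(2) by (cases z'') (auto simp: hat_def)
    moreover have "0 \<le> w z'"
      using Suc.prems(1) Suc.prems(3)[of z' \<infinity>] z by (cases z') (auto simp: hat_def)
    ultimately show "w z' - ind z' a \<le> w z - ind z a" using z by auto
  qed
  then obtain m where "mdeg m = (\<lambda>z. w z - ind z a)" by blast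
  then have "mdeg (Poly_Mapping.single a 1 + m) = w" by (auto simp: fun_eq_iff)
  then show ?case by blast
qed

section \<open>Krull dimension\<close>

lemma prime_ideal_power:
  "prime_ideal p \<Longrightarrow> x \<notin> p \<Longrightarrow> x ^ k \<notin> p"
  by (induction k) (auto simp: prime_ideal_def)

definition exponents :: "nat \<Rightarrow> nat \<Rightarrow> nat list set" where
  "exponents N k = {ms. length ms = k \<and> set ms \<subseteq> {..<N}}"

lemma exponents_0: "exponents N 0 = {[]}" by (auto simp: exponents_def)

lemma exponents_Suc: "exponents N (Suc k) = (\<lambda>(e, ms). e # ms) ` ({..<N} \<times> exponents N k)"
proof (intro equalityI subsetI)
  fix ms assume "ms \<in> exponents N (Suc k)"
  then show "ms \<in> (\<lambda>(e, ms). e # ms) ` ({..<N} \<times> exponents N k)"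
    by (cases ms) (force simp: exponents_def)+
qed (auto simp: exponents_def)

lemma finite_exponents [simp]: "finite (exponents N k)"
  by (induction k) (auto simp: exponents_0 exponents_Suc)

lemma card_exponents: "card (exponents N k) = N ^ k"
proof (induction k)
  case (Suc k)
  then show ?case
    unfolding exponents_Suc by (subst card_image) (auto simp: inj_on_def card_cartesian_product)
qed (simp add: exponents_0)

text \<open>Dividing by the powers of the \<open>x i\<close> and passing to the next prime shows that the
  lexicographically lowest nonzero coefficient would lie in \<open>p k\<close>.\<close>

lemma prime_chain_independent:
  fixes p :: "nat \<Rightarrow> 'r::comm_ring_1 set"
  assumes "\<And>i. i \<le> k \<Longrightarrow> prime_ideal (p i)" "\<And>i. i < k \<Longrightarrow> p i \<subseteq> p (Suc i)"
    and "\<And>i. i < k \<Longrightarrow> x i \<in> p (Suc i) - p i"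
    and "(\<Sum>ms\<in>exponents N k. c ms * (\<Prod>i<k. x i ^ (ms ! i))) \<in> p 0"
    and "\<And>ms. ms \<in> exponents N k \<Longrightarrow> c ms = 0 \<or> c ms \<notin> p k"
  shows "\<forall>ms\<in>exponents N k. c ms = 0"
  using assms
proof (induction k arbitrary: p x c)
  case 0
  then show ?case by (simp add: exponents_0)
next
  case (Suc k)
  define Q where "Q e = (\<Sum>ms\<in>exponents N k. c (e # ms) * (\<Prod>i<k. x (Suc i) ^ (ms ! i)))" for e
  have sum: "(\<Sum>ms\<in>exponents N (Suc k). c ms * (\<Prod>i<Suc k. x i ^ (ms ! i))) = (\<Sum>e<N. x 0 ^ e * Q e)"
  proof -
    have "(\<Sum>ms\<in>exponents N (Suc k). c ms * (\<Prod>i<Suc k. x i ^ (ms ! i)))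
      = (\<Sum>(e, ms)\<in>{..<N} \<times> exponents N k. c (e # ms) * (\<Prod>i<Suc k. x i ^ ((e # ms) ! i)))"
      unfolding exponents_Suc by (subst sum.reindex) (auto simp: inj_on_def case_prod_beta)
    also have "\<dots> = (\<Sum>e<N. \<Sum>ms\<in>exponents N k. c (e # ms) * (\<Prod>i<Suc k. x i ^ ((e # ms) ! i)))"
      by (rule sum.cartesian_product[symmetric])
    also have "\<dots> = (\<Sum>e<N. x 0 ^ e * Q e)"
    proof (rule sum.cong[OF refl])
      fix e
      have "c (e # ms) * (\<Prod>i<Suc k. x i ^ ((e # ms) ! i))
          = x 0 ^ e * (c (e # ms) * (\<Prod>i<k. x (Suc i) ^ (ms ! i)))" for ms
        unfolding prod.lessThan_Suc_shift by (simp add: mult.left_commute)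
      then show "(\<Sum>ms\<in>exponents N k. c (e # ms) * (\<Prod>i<Suc k. x i ^ ((e # ms) ! i))) = x 0 ^ e * Q e"
        unfolding Q_def sum_distrib_left by simp
    qed
    finally show ?thesis .
  qed
  show ?case
  proof (rule ccontr)
    assume "\<not> (\<forall>ms\<in>exponents N (Suc k). c ms = 0)"
    then have ex: "\<exists>e. e < N \<and> (\<exists>ms\<in>exponents N k. c (e # ms) \<noteq> 0)"
      unfolding exponents_Suc by auto
    define e where "e = (LEAST e. e < N \<and> (\<exists>ms\<in>exponents N k. c (e # ms) \<noteq> 0))"
    have e: "e < N" "\<exists>ms\<in>exponents N k. c (e # ms) \<noteq> 0"
      using LeastI_ex[OF ex] unfolding e_def by auto
    have Q0: "Q e' = 0" if "e' < e" for e'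
    proof -
      have "c (e' # ms) = 0" if "ms \<in> exponents N k" for ms
        using not_less_Least[OF \<open>e' < e\<close>[unfolded e_def]] that \<open>e' < e\<close> e(1) by auto
      then show ?thesis unfolding Q_def by simp
    qed
    define R where "R = (\<Sum>e'\<in>{Suc e..<N}. x 0 ^ (e' - Suc e) * Q e')"
    have "(\<Sum>e<N. x 0 ^ e * Q e) = (\<Sum>e'\<in>{e..<N}. x 0 ^ e' * Q e')"
      using Q0 e(1) by (intro sum.mono_neutral_right) auto
    also have "\<dots> = x 0 ^ e * Q e + (\<Sum>e'\<in>{Suc e..<N}. x 0 ^ e' * Q e')"
      using e(1) by (simp add: sum.atLeast_Suc_lessThan)
    also have "(\<Sum>e'\<in>{Suc e..<N}. x 0 ^ e' * Q e') = x 0 ^ e * (x 0 * R)"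
      unfolding R_def sum_distrib_left
    proof (rule sum.cong[OF refl])
      fix e' assume "e' \<in> {Suc e..<N}"
      then have "e' = e + Suc (e' - Suc e)" by simp
      then have "x 0 ^ e' = x 0 ^ e * (x 0 * x 0 ^ (e' - Suc e))" by (metis power_add power_Suc)
      then show "x 0 ^ e' * Q e' = x 0 ^ e * (x 0 * (x 0 ^ (e' - Suc e) * Q e'))" by (simp only: mult.assoc)
    qed
    finally have "x 0 ^ e * (Q e + x 0 * R) \<in> p 0"
      using Suc.prems(4) sum by (simp add: distrib_left)
    moreover have "x 0 ^ e \<notin> p 0"
      using Suc.prems(1)[of 0] Suc.prems(3)[of 0] prime_ideal_power by auto
    ultimately have "Q e + x 0 * R \<in> p 1"
      using Suc.prems(1)[of 0] Suc.prems(2)[of 0] by (auto simp: prime_ideal_def)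
    moreover have sub: "ring_module.subspace (p 1)"
      using Suc.prems(1)[of 1] by (auto simp: prime_ideal_def)
    moreover have "x 0 * R \<in> p 1"
      using ring_module.subspace_scale[OF sub, of "x 0" R] Suc.prems(3)[of 0] by (simp add: mult.commute)
    ultimately have "Q e \<in> p 1"
      using ring_module.subspace_diff[OF sub] by fastforce
    then have "\<forall>ms\<in>exponents N k. c (e # ms) = 0"
    proof (intro Suc.IH[where p = "\<lambda>i. p (Suc i)" and x = "\<lambda>i. x (Suc i)"])
      show "c (e # ms) = 0 \<or> c (e # ms) \<notin> p (Suc k)" if "ms \<in> exponents N k" for ms
        using Suc.prems(5)[of "e # ms"] that e(1) by (force simp: exponents_Suc)
    qed (use Suc.prems in \<open>auto simp: Q_def\<close>)
    then show False using e(2) by blast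
  qed
qed

section \<open>Upper bound for the Krull dimension by counting multidegrees\<close>

lemma exists_linear_relation:
  fixes c :: "'b \<Rightarrow> 'c \<Rightarrow> 'k::field"
  assumes "finite W" "finite A" "card W < card A"
  shows "\<exists>l. (\<exists>a\<in>A. l a \<noteq> 0) \<and> (\<forall>w\<in>W. (\<Sum>a\<in>A. l a * c a w) = 0)"
  using assms
proof (induction W arbitrary: A c rule: finite_induct)
  case empty
  then have "A \<noteq> {}" by auto
  then show ?case by (intro exI[of _ "\<lambda>_. 1"]) auto
next
  case (insert w W)
  show ?case
  proof (cases "\<forall>a\<in>A. c a w = 0")
    case True
    then show ?thesis using insert.IH[of A c] insert.prems insert.hyps by auto
  next
    case False
    \<comment> \<open>Gaussian elimination with pivot \<open>b\<close>: the equation of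
      \<open>w\<close> is solved for the unknown of \<open>b\<close>, which is substituted into the
      other equations.\<close>
    then obtain b where b: "b \<in> A" "c b w \<noteq> 0" by blast
    define c' where "c' a v = c a v - c a w / c b w * c b v" for a v
    obtain l where l: "\<exists>a\<in>A - {b}. l a \<noteq> 0" "\<forall>v\<in>W. (\<Sum>a\<in>A - {b}. l a * c' a v) = 0"
      using insert.IH[of "A - {b}" c'] insert.prems insert.hyps b by fastforce
    define s where "s = (\<Sum>a\<in>A - {b}. l a * (c a w / c b w))"
    define l' where "l' = l(b := - s)"
    have split: "(\<Sum>a\<in>A. l' a * c a v) = (\<Sum>a\<in>A - {b}. l a * c a v) - s * c b v" for v
    proof -
      have "(\<Sum>a\<in>A. l' a * c a v) = l' b * c b v + (\<Sum>a\<in>A - {b}. l' a * c a v)"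
        using insert.prems b by (simp add: sum.remove)
      also have "(\<Sum>a\<in>A - {b}. l' a * c a v) = (\<Sum>a\<in>A - {b}. l a * c a v)"
        by (intro sum.cong) (auto simp: l'_def)
      finally show ?thesis by (simp add: l'_def)
    qed
    have "(\<Sum>a\<in>A. l' a * c a v) = (\<Sum>a\<in>A - {b}. l a * c' a v)" for v
    proof -
      have "l a * c' a v = l a * c a v - l a * (c a w / c b w) * c b v" for a
        by (simp only: c'_def right_diff_distrib mult.assoc)
      then show ?thesis
        by (simp only: split s_def sum_distrib_right sum_subtractf)
    qed
    moreover have "(\<Sum>a\<in>A - {b}. l a * c' a w) = 0"
      using b by (simp add: c'_def)
    ultimately have "\<forall>v\<in>insert w W. (\<Sum>a\<in>A. l' a * c a v) = 0" using l(2) by simp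
    moreover have "\<exists>a\<in>A. l' a \<noteq> 0" using l(1) by (auto simp: l'_def)
    ultimately show ?thesis by blast
  qed
qed

abbreviation degree_le :: "int \<Rightarrow> ('a::{finite,distrib_lattice}, 'k::field) mpol \<Rightarrow> bool" where
  "degree_le d p \<equiv> \<forall>m\<in>Poly_Mapping.keys p. mdeg m (-\<infinity>) \<le> d"

lemma degree_le_mult: "degree_le d p \<Longrightarrow> degree_le d' q \<Longrightarrow> degree_le (d + d') (p * q)"
  using keys_mult[of p q] by (fastforce intro: add_mono)

lemma degree_le_power: "degree_le d p \<Longrightarrow> degree_le (int k * d) (p ^ k)"
proof (induction k)
  case (Suc k)
  then show ?case using degree_le_mult[of p d "p ^ k" "int k * d"] by (simp add: distrib_right)
qed simp

lemma degree_le_prod: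
  "finite A \<Longrightarrow> (\<And>i. i \<in> A \<Longrightarrow> degree_le (d i) (p i)) \<Longrightarrow> degree_le (\<Sum>i\<in>A. d i) (\<Prod>i\<in>A. p i)"
proof (induction A rule: finite_induct)
  case (insert i A)
  then show ?case using degree_le_mult[of "p i" "d i" "prod p A" "sum d A"] by auto
qed simp

lemma mcoeff_neq_0: "mcoeff p w \<noteq> 0 \<Longrightarrow> \<exists>m\<in>Poly_Mapping.keys p. mdeg m = w"
  unfolding mcoeff_def by (rule ccontr) simp

text \<open>The exponent counts the coordinates that can be nonzero, -oo and the join-irreducible
  elements; each is bounded by the value at -oo.\<close>

lemma multidegrees_bounded:
  fixes M :: nat
  defines "W \<equiv> {w. \<exists>m :: 'a::{finite,distrib_lattice} \<Rightarrow>\<^sub>0 nat. mdeg m = w \<and> w (-\<infinity>) \<le> int M}"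
  shows "finite W" "card W \<le> (M + 1) ^ Suc (card {a :: 'a. join_irreducible a})"
proof -
  let ?Z = "insert (-\<infinity>) (Fin ` {a :: 'a. join_irreducible a})"
  let ?T = "PiE ?Z (\<lambda>_. {0..int M})"
  have "restrict w ?Z \<in> ?T" if w: "w \<in> W" for w
  proof -
    obtain m where m: "mdeg m = w" "w (-\<infinity>) \<le> int M" using w unfolding W_def by blast
    have "0 \<le> w z \<and> w z \<le> int M" for z
      using mdeg_antimono[of "-\<infinity>" z m] m mdeg_nonneg[of m z] by (auto simp: hat_def)
    then show ?thesis by auto
  qed
  then have sub: "(\<lambda>w. restrict w ?Z) ` W \<subseteq> ?T" by blast
  have inj: "inj_on (\<lambda>w. restrict w ?Z) W"
  proof (rule inj_onI)
    fix w w' assume w: "w \<in> W" "w' \<in> W" and "restrict w ?Z = restrict w' ?Z"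
    then have eq: "w z = w' z" if "z \<in> ?Z" for z using that by (metis restrict_apply')
    show "w = w'"
    proof
      fix z
      obtain m m' where m: "mdeg m = w" "mdeg m' = w'" using w unfolding W_def by blast
      show "w z = w' z"
      proof (cases "z \<in> ?Z")
        case False
        then have "mdeg m z = 0" for m :: "'a \<Rightarrow>\<^sub>0 nat"
          by (cases z) (auto intro!: mdeg_outside)
        then show ?thesis using m by metis
      qed (rule eq)
    qed
  qed
  have fin: "finite ?T" by (intro finite_PiE) auto
  show "finite W" using finite_imageD[OF finite_subset[OF sub fin] inj] .
  have "card W \<le> card ?T" using card_inj_on_le[OF inj sub fin] .
  also have "card ?T = (M + 1) ^ card ?Z" by (simp add: card_PiE nat_add_distrib)
  also have "card ?Z = Suc (card {a :: 'a. join_irreducible a})"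
    by (subst card_insert_disjoint) (auto simp: card_image inj_on_def)
  finally show "card W \<le> (M + 1) ^ Suc (card {a :: 'a. join_irreducible a})" .
qed

lemma Const_mult: "Const a * Const b = Const (a * b)"
  and Const_1: "Const 1 = 1" and Const_0: "Const 0 = 0"
  by (simp_all add: Const_def mult_single)

lemma Const_eq_0_iff [simp]: "Const c = 0 \<longleftrightarrow> c = 0"
  by (metis Const_def Const_0 lookup_single_eq lookup_zero)

lemma Const_notin_prime_ideal:
  assumes "prime_ideal p" "c \<noteq> 0" shows "Const c \<notin> p"
proof
  assume "Const c \<in> p"
  then have "Const (inverse c) * Const c \<in> p"
    using assms(1) ring_module.subspace_scale by (auto simp: prime_ideal_def)
  then show False using assms by (simp add: Const_mult Const_1 prime_ideal_def)
qed

text \<open>A longer chain would yield d + 1 elements \<open>x i\<close>, where d = |P| + 1. Their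
  monomials with exponents below N number N^(d+1) but live in O(N^d) multidegrees, so for large N a
  nontrivial linear combination lies in the ideal, against
  \<open>prime_chain_independent\<close>.\<close>

lemma prime_chain_length_le:
  fixes p :: "nat \<Rightarrow> ('a::{finite,distrib_lattice}, 'k::field) mpol set"
  assumes prime: "\<And>i. i \<le> l \<Longrightarrow> prime_ideal (p i) \<and> hibi_ideal \<subseteq> p i"
    and strict: "\<And>i. i < l \<Longrightarrow> p i \<subset> p (Suc i)"
  shows "l \<le> Suc (card {a :: 'a. join_irreducible a})"
proof (rule ccontr)
  define d where "d = Suc (card {a :: 'a. join_irreducible a})"
  define k where "k = Suc d"
  assume "\<not> l \<le> Suc (card {a :: 'a. join_irreducible a})"
  then have kl: "k \<le> l" by (simp add: k_def d_def)
  have "\<forall>i. \<exists>x. i < l \<longrightarrow> x \<in> p (Suc i) - p i" using strict by blast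
  then obtain x where x: "\<And>i. i < l \<Longrightarrow> x i \<in> p (Suc i) - p i" by metis
  define D where "D = Suc (nat (Max (insert 0 (\<Union>i<k. (\<lambda>m. mdeg m (-\<infinity>)) ` Poly_Mapping.keys (x i)))))"
  have D: "degree_le (int D) (x i)" if "i < k" for i
  proof
    fix m assume "m \<in> Poly_Mapping.keys (x i)"
    then have "mdeg m (-\<infinity>) \<le> Max (insert 0 (\<Union>i<k. (\<lambda>m. mdeg m (-\<infinity>)) ` Poly_Mapping.keys (x i)))"
      using that by (intro Max_ge) auto
    then show "mdeg m (-\<infinity>) \<le> int D" unfolding D_def by linarith
  qed
  \<comment> \<open>N exceeds (k D + 1)^d, the constant that appears when the bound (k D + 1) N is
    raised to the power d.\<close>
  define N where "N = Suc ((k * D + 1) ^ d)"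
  define M where "M = k * N * D"
  define W where "W = {w. \<exists>m :: 'a \<Rightarrow>\<^sub>0 nat. mdeg m = w \<and> w (-\<infinity>) \<le> int M}"
  define X where "X ms = (\<Prod>i<k. x i ^ (ms ! i))" for ms
  note W = multidegrees_bounded[of M, where 'a = 'a, folded W_def d_def]
  have X: "mcoeff (X ms) w = 0" if "w \<notin> W" "ms \<in> exponents N k" for ms w
  proof (rule ccontr)
    assume "mcoeff (X ms) w \<noteq> 0"
    then obtain m where m: "m \<in> Poly_Mapping.keys (X ms)" "mdeg m = w" using mcoeff_neq_0 by blast
    have "degree_le (\<Sum>i<k. int (ms ! i) * int D) (X ms)"
      unfolding X_def by (intro degree_le_prod degree_le_power D) auto
    then have "w (-\<infinity>) \<le> (\<Sum>i<k. int (ms ! i) * int D)" using m by auto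
    also have "\<dots> \<le> (\<Sum>i<k. int N * int D)"
    proof (intro sum_mono mult_right_mono)
      fix i assume "i \<in> {..<k}"
      then have "ms ! i \<in> set ms" using that(2) by (simp add: exponents_def)
      then show "int (ms ! i) \<le> int N" using that(2) by (auto simp: exponents_def)
    qed simp
    also have "\<dots> = int M" by (simp add: M_def)
    finally show False using that(1) m(2) by (auto simp: W_def)
  qed
  have "M + 1 \<le> (k * D + 1) * N" unfolding M_def N_def by (simp add: algebra_simps)
  then have "card W \<le> ((k * D + 1) * N) ^ d"
    using W(2) power_mono[of "M + 1" "(k * D + 1) * N" d] by (meson le_trans zero_le)
  also have "\<dots> = (k * D + 1) ^ d * N ^ d" by (simp only: power_mult_distrib)
  also have "\<dots> < N * N ^ d" by (simp add: N_def)
  also have "\<dots> = card (exponents N k)" by (simp add: card_exponents k_def)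
  finally obtain c where c: "\<exists>ms\<in>exponents N k. c ms \<noteq> 0"
      "\<forall>w\<in>W. (\<Sum>ms\<in>exponents N k. c ms * mcoeff (X ms) w) = 0"
    using exists_linear_relation[OF W(1) finite_exponents, of N k "\<lambda>ms. mcoeff (X ms)"] by blast
  have "(\<Sum>ms\<in>exponents N k. Const (c ms) * X ms) \<in> hibi_ideal"
    unfolding hibi_ideal_iff
  proof
    fix w show "mcoeff (\<Sum>ms\<in>exponents N k. Const (c ms) * X ms) w = 0"
      using c(2) X by (cases "w \<in> W") (simp_all add: mcoeff_Const_mult)
  qed
  then have "(\<Sum>ms\<in>exponents N k. Const (c ms) * X ms) \<in> p 0" using prime[of 0] by auto
  then have "\<forall>ms\<in>exponents N k. Const (c ms) = (0 :: ('a, 'k) mpol)"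
    unfolding X_def
  proof (rule prime_chain_independent[of k p x, rotated 3])
    show "Const (c ms) = 0 \<or> Const (c ms) \<notin> p k" for ms
      using Const_notin_prime_ideal[of "p k" "c ms"] prime[OF kl] by (cases "c ms = 0") (auto simp: Const_0)
    show "p i \<subseteq> p (Suc i)" if "i < k" for i using strict[of i] that kl by auto
  qed (use kl prime x in auto)
  then show False using c(1) by simp
qed

section \<open>Prime ideals from faces of the monoid of multidegrees\<close>

lemma prime_ideal_kernel:
  fixes h :: "'r::comm_ring_1 \<Rightarrow> 's::idom"
  assumes "\<And>p q. h (p + q) = h p + h q" "\<And>p q. h (p * q) = h p * h q" "h 1 = 1"
  shows "prime_ideal {p. h p = 0}"
proof -
  have "h 0 = 0" using assms(1)[of 0 0] by (metis add_cancel_right_right)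
  then have "ring_module.subspace {p. h p = 0}"
    by (intro ring_module.subspaceI) (auto simp: assms)
  then show ?thesis by (auto simp: prime_ideal_def assms)
qed

text \<open>A copy of the multidegree in a linearly ordered monoid, so that the polynomials graded by
  it form a domain.\<close>

definition code_hat :: "'a::{finite,distrib_lattice} extended \<Rightarrow> nat" where
  "code_hat z = (case z of Fin p \<Rightarrow> Suc (to_nat p) | _ \<Rightarrow> 0)"

text \<open>The sum leaves out \<open>\<infinity>\<close>, where multidegrees vanish, so it does no
  harm that \<open>code_hat\<close> gives \<open>\<infinity>\<close> the code of -oo.\<close>

definition linear_mdeg :: "('a::{finite,distrib_lattice} \<Rightarrow>\<^sub>0 nat) \<Rightarrow> nat \<Rightarrow>\<^sub>0 nat" where
  "linear_mdeg m = (\<Sum>z\<in>insert (-\<infinity>) (range Fin). Poly_Mapping.single (code_hat z) (nat (mdeg m z)))"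

lemma linear_mdeg_add: "linear_mdeg (m + m') = linear_mdeg m + linear_mdeg m'"
  by (simp add: linear_mdeg_def nat_add_distrib single_add sum.distrib)

lemma linear_mdeg_zero: "linear_mdeg 0 = 0"
  by (simp add: linear_mdeg_def)

lemma lookup_linear_mdeg:
  assumes "z \<noteq> \<infinity>"
  shows "Poly_Mapping.lookup (linear_mdeg m) (code_hat z) = nat (mdeg m z)"
proof -
  have z: "z \<in> insert (-\<infinity>) (range Fin)" using assms by (cases z) auto
  have "Poly_Mapping.lookup (linear_mdeg m) (code_hat z)
      = (\<Sum>z'\<in>insert (-\<infinity>) (range Fin). if z = z' then nat (mdeg m z') else 0)"
    unfolding linear_mdeg_def lookup_sum using assms
    by (intro sum.cong) (auto simp: lookup_single when_def code_hat_def split: extended.splits)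
  then show ?thesis using z by (subst (asm) sum.delta') auto
qed

lemma linear_mdeg_eq_iff: "linear_mdeg m = linear_mdeg m' \<longleftrightarrow> mdeg m = mdeg m'"
proof
  assume eq: "linear_mdeg m = linear_mdeg m'"
  show "mdeg m = mdeg m'"
  proof
    fix z show "mdeg m z = mdeg m' z"
      using lookup_linear_mdeg[of z m] lookup_linear_mdeg[of z m'] eq
      by (cases "z = \<infinity>") (simp_all add: eq_nat_nat_iff)
  qed
qed (simp add: linear_mdeg_def)

text \<open>The projection to the multidegrees in \<open>X\<close>. Its target is a domain, so its
  kernel is prime as soon as it is a ring homomorphism.\<close>

definition face_hom :: "(('a extended \<Rightarrow> int) \<Rightarrow> bool) \<Rightarrow> ('a::{finite,distrib_lattice}, 'k::field) mpol
    \<Rightarrow> (nat \<Rightarrow>\<^sub>0 nat) \<Rightarrow>\<^sub>0 'k" where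
  "face_hom X p = (\<Sum>m\<in>Poly_Mapping.keys p.
     Poly_Mapping.single (linear_mdeg m) (if X (mdeg m) then Poly_Mapping.lookup p m else 0))"

lemma face_hom_superset:
  assumes "finite A" "Poly_Mapping.keys p \<subseteq> A"
  shows "face_hom X p = (\<Sum>m\<in>A. Poly_Mapping.single (linear_mdeg m) (if X (mdeg m) then Poly_Mapping.lookup p m else 0))"
  unfolding face_hom_def using assms
  by (intro sum.mono_neutral_left) (auto simp: in_keys_iff)

lemma face_hom_zero: "face_hom X 0 = 0" by (simp add: face_hom_def)

lemma face_hom_single:
  "face_hom X (Poly_Mapping.single m c) = Poly_Mapping.single (linear_mdeg m) (if X (mdeg m) then c else 0)"
  by (simp add: face_hom_def)

lemma face_hom_add: "face_hom X (p + q) = face_hom X p + face_hom X q"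
proof -
  let ?A = "Poly_Mapping.keys p \<union> Poly_Mapping.keys q"
  have A: "finite ?A" "Poly_Mapping.keys (p + q) \<subseteq> ?A" by (simp_all add: keys_add)
  show ?thesis
    unfolding face_hom_superset[OF A]
    by (subst (1 2) face_hom_superset[of ?A])
      (auto simp: lookup_add single_add sum.distrib[symmetric] intro!: sum.cong)
qed

text \<open>Faces in the sense of monoids: the condition makes \<open>face_hom X\<close>
  multiplicative and unital.\<close>

definition is_face :: "(('a::{finite,distrib_lattice} extended \<Rightarrow> int) \<Rightarrow> bool) \<Rightarrow> bool" where
  "is_face X \<longleftrightarrow> X (mdeg 0) \<and> (\<forall>m m'. X (mdeg (m + m')) \<longleftrightarrow> X (mdeg m) \<and> X (mdeg m'))"

lemma face_hom_mult:
  assumes "is_face X"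
  shows "face_hom X (p * q) = face_hom X p * face_hom X q"
proof (induction p rule: poly_mapping_sum_induct)
  case (single m c)
  show ?case
  proof (induction q rule: poly_mapping_sum_induct)
    case (single m' c')
    then show ?case using assms
      by (simp add: mult_single face_hom_single linear_mdeg_add is_face_def)
  qed (simp_all add: face_hom_add face_hom_zero algebra_simps)
qed (simp_all add: face_hom_add face_hom_zero algebra_simps)

lemma face_hom_one: "is_face X \<Longrightarrow> face_hom X 1 = 1"
  unfolding single_one[symmetric] face_hom_single
  by (simp add: is_face_def linear_mdeg_zero)

lemma face_hom_eq_0_iff:
  fixes p :: "('a::{finite,distrib_lattice}, 'k::field) mpol"
  shows "face_hom X p = 0 \<longleftrightarrow> (\<forall>w. X w \<longrightarrow> mcoeff p w = 0)"
proof -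
  have lookup: "Poly_Mapping.lookup (face_hom X p) (linear_mdeg m) = (if X (mdeg m) then mcoeff p (mdeg m) else 0)" for m
    unfolding face_hom_def lookup_sum mcoeff_def
    by (auto simp: lookup_single when_def linear_mdeg_eq_iff intro!: sum.cong sum.neutral)
  show ?thesis
  proof
    assume 0: "face_hom X p = 0"
    show "\<forall>w. X w \<longrightarrow> mcoeff p w = 0"
    proof (intro allI impI, rule ccontr)
      fix w assume "X w" "mcoeff p w \<noteq> 0"
      moreover from this obtain m where "mdeg m = w" using mcoeff_neq_0[of p w] by blast
      ultimately show False using lookup[of m] 0 by simp
    qed
  next
    assume *: "\<forall>w. X w \<longrightarrow> mcoeff p w = 0"
    show "face_hom X p = 0"
    proof (rule poly_mapping_eqI)
      fix W show "Poly_Mapping.lookup (face_hom X p) W = Poly_Mapping.lookup 0 W"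
      proof (cases "W \<in> range (linear_mdeg :: ('a \<Rightarrow>\<^sub>0 nat) \<Rightarrow> _)")
        case True then show ?thesis using * lookup by auto
      next
        case False
        then show ?thesis unfolding face_hom_def lookup_sum
          by (auto simp: lookup_single when_def intro!: sum.neutral)
      qed
    qed
  qed
qed

definition face_ideal :: "(('a::{finite,distrib_lattice} extended \<Rightarrow> int) \<Rightarrow> bool) \<Rightarrow> ('a, 'k::field) mpol set" where
  "face_ideal X = {p. \<forall>w. X w \<longrightarrow> mcoeff p w = 0}"

lemma prime_face_ideal: "is_face X \<Longrightarrow> prime_ideal (face_ideal X :: ('a::{finite,distrib_lattice}, 'k::field) mpol set)"
  using prime_ideal_kernel[of "face_hom X :: ('a, 'k) mpol \<Rightarrow> _"]
  by (simp add: face_hom_add face_hom_mult face_hom_one face_hom_eq_0_iff face_ideal_def)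

lemma hibi_ideal_subset_face_ideal: "hibi_ideal \<subseteq> face_ideal X"
  by (auto simp: face_ideal_def hibi_ideal_iff)

lemma is_face_vanishing: "is_face (\<lambda>w. \<forall>z\<in>Z. w z = 0)"
  unfolding is_face_def by (auto simp: add_nonneg_eq_0_iff)

section \<open>Linear extensions of P and maximal chains of L\<close>

definition linear_extension :: "'a::{finite,distrib_lattice} list \<Rightarrow> bool" where
  "linear_extension ps \<longleftrightarrow> distinct ps \<and> set ps = {a. join_irreducible a} \<and>
     (\<forall>i<length ps. \<forall>j<length ps. ps ! i < ps ! j \<longrightarrow> i < j)"

definition segment :: "'a::{finite,distrib_lattice} list \<Rightarrow> nat \<Rightarrow> 'a" where
  "segment ps i = join_set (set (take i ps))"

lemma length_linear_extension:
  "linear_extension (ps :: 'a::{finite,distrib_lattice} list) \<Longrightarrow> length ps = card {a :: 'a. join_irreducible a}"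
  unfolding linear_extension_def using distinct_card[of ps] by auto

lemma in_set_take: "z \<in> set (take i ps) \<longleftrightarrow> (\<exists>j<length ps. j < i \<and> z = ps ! j)"
  by (auto simp: in_set_conv_nth)

text \<open>Prefixes of a linear extension are closed downwards, so the join of a prefix acquires no
  further join-irreducible element.\<close>

lemma le_segment:
  assumes "linear_extension ps" "join_irreducible z"
  shows "z \<le> segment ps i \<longleftrightarrow> z \<in> set (take i ps)"
proof
  assume "z \<le> segment ps i"
  then obtain a where "a \<in> set (take i ps)" and za: "z \<le> a"
    using assms(2) by (auto simp: segment_def join_irreducible_le_join_set)
  then obtain j where j: "j < length ps" "j < i" "a = ps ! j" by (auto simp: in_set_take)
  obtain l where l: "l < length ps" "z = ps ! l"
    using assms by (force simp: linear_extension_def in_set_conv_nth)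
  have "l \<le> j"
  proof (rule ccontr)
    assume "\<not> l \<le> j"
    moreover from this have "z < a"
      using assms(1) za j l by (auto simp: order.order_iff_strict linear_extension_def nth_eq_iff_index_eq)
    moreover from this have "l < j"
      using assms(1) j l unfolding linear_extension_def by blast
    ultimately show False by simp
  qed
  then show "z \<in> set (take i ps)" using j l unfolding in_set_take by (intro exI[of _ l]) simp
qed (use assms in \<open>auto simp: segment_def join_irreducible_le_join_set\<close>)

lemma nth_linear_extension: "linear_extension ps \<Longrightarrow> i < length ps \<Longrightarrow> join_irreducible (ps ! i)"
  using nth_mem[of i ps] by (auto simp: linear_extension_def)

lemma nth_le_segment:
  assumes "linear_extension ps" "j < length ps"
  shows "ps ! j \<le> segment ps i \<longleftrightarrow> j < i"
  using assms le_segment[OF assms(1) nth_linear_extension[OF assms], of i]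
  by (auto simp: in_set_take linear_extension_def nth_eq_iff_index_eq)

lemma segment_le_iff:
  assumes "linear_extension ps" "i \<le> length ps" "j \<le> length ps"
  shows "segment ps i \<le> segment ps j \<longleftrightarrow> i \<le> j"
proof
  assume le: "segment ps i \<le> segment ps j"
  show "i \<le> j"
  proof (rule ccontr)
    assume "\<not> i \<le> j"
    then have "ps ! j \<le> segment ps i" using nth_le_segment[OF assms(1), of j i] assms by auto
    then have "ps ! j \<le> segment ps j" using le by (rule order.trans)
    then show False using nth_le_segment[OF assms(1), of j j] \<open>\<not> i \<le> j\<close> assms by auto
  qed
next
  assume "i \<le> j"
  show "segment ps i \<le> segment ps j"
  proof (rule le_if_join_irreducibles_le)
    fix z :: 'a assume "join_irreducible z" "z \<le> segment ps i"
    then show "z \<le> segment ps j"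
      using \<open>i \<le> j\<close> set_take_subset_set_take[of i j ps] by (auto simp: le_segment[OF assms(1)])
  qed
qed

lemma exists_injective_refinement:
  fixes \<kappa> :: "'a::finite extended \<Rightarrow> nat"
  shows "\<exists>key :: 'a extended \<Rightarrow> nat. inj key \<and> (\<forall>a b. \<kappa> a < \<kappa> b \<longrightarrow> key a < key b)"
proof -
  define e :: "'a extended \<Rightarrow> nat" where
    "e z = (case z of -\<infinity> \<Rightarrow> 0 | \<infinity> \<Rightarrow> 1 | Fin p \<Rightarrow> to_nat p + 2)" for z
  have "(UNIV :: 'a extended set) = {-\<infinity>, \<infinity>} \<union> range Fin"
    by (auto intro: extended.exhaust)
  then have fin: "finite (range e)" by (metis finite_Un finite_imageI finite.emptyI finite.insertI finite_UNIV)
  define M where "M = Suc (Max (range e))"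
  have e: "e z < M" for z using fin unfolding M_def by (simp add: le_imp_less_Suc)
  have "inj e" by (auto simp: inj_def e_def split: extended.splits)
  define key where "key z = \<kappa> z * M + e z" for z
  have "key a < key b" if "\<kappa> a < \<kappa> b" for a b
  proof -
    have "key a < Suc (\<kappa> a) * M" using e[of a] by (simp add: key_def)
    also have "\<dots> \<le> \<kappa> b * M" using that by (intro mult_le_mono1) simp
    also have "\<dots> \<le> key b" by (simp add: key_def)
    finally show ?thesis .
  qed
  moreover have "inj key"
  proof (rule injI)
    fix a b assume "key a = key b"
    then have "e a = e b" using e[of a] e[of b]
      by (metis key_def mod_less mod_mult_self3)
    then show "a = b" using \<open>inj e\<close> by (simp add: inj_def)
  qed
  ultimately show ?thesis by blast
qed

lemma exists_sorted_linear_extension: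
  fixes key :: "'a::{finite,distrib_lattice} \<Rightarrow> nat"
  assumes "inj_on key {a. join_irreducible a}"
    and "\<And>a b. join_irreducible a \<Longrightarrow> join_irreducible b \<Longrightarrow> a < b \<Longrightarrow> key a < key b"
  shows "\<exists>ps. linear_extension ps \<and> sorted (map key ps)"
proof -
  let ?P = "{a :: 'a. join_irreducible a}"
  define ps where "ps = map (inv_into ?P key) (sorted_list_of_set (key ` ?P))"
  have map: "map key ps = sorted_list_of_set (key ` ?P)"
    unfolding ps_def map_map by (rule map_idI) (simp add: f_inv_into_f)
  have dist: "distinct ps"
    using distinct_sorted_list_of_set[of "key ` ?P"] unfolding map[symmetric] by (simp add: distinct_map)
  have set: "set ps = ?P"
    unfolding ps_def using inv_into_image_cancel[OF assms(1) order_refl] by simp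
  have sorted: "sorted (map key ps)" unfolding map by simp
  have "i < j" if "i < length ps" "j < length ps" "ps ! i < ps ! j" for i j
  proof (rule ccontr)
    assume "\<not> i < j"
    then have "key (ps ! j) \<le> key (ps ! i)"
      using sorted_nth_mono[OF sorted, of j i] that by simp
    moreover have "key (ps ! i) < key (ps ! j)"
      using that nth_mem[of i ps] nth_mem[of j ps] set by (intro assms(2)) auto
    ultimately show False by simp
  qed
  then show ?thesis using dist set sorted unfolding linear_extension_def by blast
qed

lemma exists_linear_extension: "\<exists>ps :: 'a::{finite,distrib_lattice} list. linear_extension ps"
proof -
  define \<kappa> where "\<kappa> z = (case z of Fin (p :: 'a) \<Rightarrow> card {q. q < p} | _ \<Rightarrow> 0)" for z
  obtain key :: "'a extended \<Rightarrow> nat" where key: "inj key" "\<And>a b. \<kappa> a < \<kappa> b \<Longrightarrow> key a < key b"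
    using exists_injective_refinement[of \<kappa>] by blast
  have "key (Fin a) < key (Fin b)" if "a < b" for a b
  proof -
    have "{q. q < a} \<subset> {q. q < b}" using that by (auto dest: order.strict_trans)
    then show ?thesis by (intro key(2)) (auto simp: \<kappa>_def intro: psubset_card_mono)
  qed
  moreover have "inj_on (\<lambda>a. key (Fin a)) {a. join_irreducible a}"
    using key(1) by (auto simp: inj_on_def)
  ultimately show ?thesis
    using exists_sorted_linear_extension[of "\<lambda>a. key (Fin a)"] by blast
qed

text \<open>The upper bound is \<open>prime_chain_length_le\<close>. A chain attaining it comes from
  a flag of faces: multidegrees supported on ever shorter segments of a linear extension, and
  finally the zero multidegree alone.\<close>

lemma quotient_dim_hibi_ideal:
  "quotient_dim (hibi_ideal :: ('a::{finite,distrib_lattice}, 'k::field) mpol set)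
    = Suc (card {a :: 'a. join_irreducible a})"
  unfolding quotient_dim_def
proof (rule cSup_eq_maximum)
  obtain ps :: "'a list" where ps: "linear_extension ps" using exists_linear_extension by blast
  define n where "n = length ps"
  define Z where "Z i = (if i \<le> n then {Fin p |p. \<not> p \<le> segment ps (n - i)} else {-\<infinity>} \<union> range Fin)" for i
  define I where "I i = (face_ideal (\<lambda>w. \<forall>z\<in>Z i. w z = 0) :: ('a, 'k) mpol set)" for i
  have "I i \<subset> I (Suc i)" if "i < Suc n" for i
  proof
    have "Z i \<subseteq> Z (Suc i)"
    proof (cases "Suc i \<le> n")
      case True
      then have "segment ps (n - Suc i) \<le> segment ps (n - i)"
        by (subst segment_le_iff[OF ps]) (auto simp: n_def)
      then show ?thesis using True unfolding Z_def by (auto dest: order.trans)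
    qed (auto simp: Z_def)
    then show "I i \<subseteq> I (Suc i)" by (auto simp: I_def face_ideal_def)
    define a where "a = segment ps (n - i)"
    have "(\<forall>z\<in>Z i. mdeg (Poly_Mapping.single a 1) z = 0)"
      using that by (auto simp: Z_def a_def)
    then have "Var a \<notin> I i"
      by (auto simp: I_def face_ideal_def Var_def mcoeff_single
          intro!: exI[of _ "mdeg (Poly_Mapping.single a 1)"])
    moreover have "Var a \<in> I (Suc i)"
    proof (cases "i = n")
      case True
      then show ?thesis by (auto simp: I_def face_ideal_def Var_def mcoeff_single Z_def)
    next
      case False
      then have i: "i < n" using that by simp
      let ?p = "ps ! (n - Suc i)"
      have p: "join_irreducible ?p" "?p \<le> a" "\<not> ?p \<le> segment ps (n - Suc i)"
        using i nth_linear_extension[OF ps] nth_le_segment[OF ps] by (auto simp: n_def a_def)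
      then have "Fin ?p \<in> Z (Suc i)" using i by (auto simp: Z_def)
      moreover have "mdeg (Poly_Mapping.single a 1) (Fin ?p) = 1" using p by simp
      ultimately have "\<exists>z\<in>Z (Suc i). mdeg (Poly_Mapping.single a 1) z \<noteq> 0"
        by (intro bexI[of _ "Fin ?p"]) simp_all
      then show ?thesis
        by (auto simp: I_def face_ideal_def Var_def mcoeff_single simp del: mdeg_single)
    qed
    ultimately show "I i \<noteq> I (Suc i)" by blast
  qed
  moreover have "prime_ideal (I i) \<and> hibi_ideal \<subseteq> I i" for i
    unfolding I_def by (intro conjI prime_face_ideal is_face_vanishing hibi_ideal_subset_face_ideal)
  ultimately show "Suc (card {a :: 'a. join_irreducible a}) \<in> {l. \<exists>p :: nat \<Rightarrow> ('a, 'k) mpol set.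
      (\<forall>i\<le>l. prime_ideal (p i) \<and> hibi_ideal \<subseteq> p i) \<and> (\<forall>i<l. p i \<subset> p (Suc i))}"
    unfolding length_linear_extension[OF ps, symmetric] n_def[symmetric]
    by (intro CollectI exI[of _ I]) blast
qed (use prime_chain_length_le in blast)

section \<open>Signs\<close>

text \<open>Sorting by \<open>key\<close>, with ties broken by \<open>to_nat\<close>, instead of by \<open>to_nat\<close>, turns the signs of
  the Koszul differential into the parities of the new positions.\<close>

definition reorder_sign :: "('x::finite \<Rightarrow> nat) \<Rightarrow> 'x set \<Rightarrow> 'k::field" where
  "reorder_sign key F = (- 1) ^ card {(a, b). a \<in> F \<and> b \<in> F \<and> key a < key b \<and> to_nat b < to_nat a}"

definition position :: "('x::finite \<Rightarrow> nat) \<Rightarrow> 'x set \<Rightarrow> 'x \<Rightarrow> nat" where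
  "position key F a = card {b \<in> F. key b < key a \<or> key b = key a \<and> to_nat b < to_nat a}"

definition koszul_sign :: "'x::finite set \<Rightarrow> 'x \<Rightarrow> 'k::field" where
  "koszul_sign F a = (- 1) ^ card {b \<in> F. to_nat b < to_nat a}"

text \<open>The inversions involving \<open>a\<close> are counted by X and Y, the Koszul sign by X
  and Z, the position by Y and Z. Over both sides together each of these sets, and each inversion
  avoiding \<open>a\<close>, is counted twice.\<close>

lemma reorder_sign_remove:
  assumes "a \<in> F"
  shows "koszul_sign F a * reorder_sign key (F - {a}) = reorder_sign key F * ((- 1) ^ position key F a :: 'k::field)"
proof -
  let ?I = "\<lambda>F. {(a, b). a \<in> F \<and> b \<in> F \<and> key a < key b \<and> to_nat b < to_nat a}"
  let ?X = "{b \<in> F. key a < key b \<and> to_nat b < to_nat a}"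
  let ?Y = "{b \<in> F. key b < key a \<and> to_nat a < to_nat b}"
  let ?Z = "{b \<in> F. (key b < key a \<or> key b = key a) \<and> to_nat b < to_nat a}"
  have neq: "to_nat b \<noteq> to_nat a" if "b \<noteq> a" for b :: 'a using that by simp
  have "?I F = ?I (F - {a}) \<union> (Pair a ` ?X \<union> (\<lambda>b. (b, a)) ` ?Y)"
    using assms by auto
  then have "card (?I F) = card (?I (F - {a}) \<union> (Pair a ` ?X \<union> (\<lambda>b. (b, a)) ` ?Y))"
    by (rule arg_cong)
  also have "\<dots> = card (?I (F - {a})) + card (Pair a ` ?X \<union> (\<lambda>b. (b, a)) ` ?Y)"
    by (rule card_Un_disjoint) auto
  also have "card (Pair a ` ?X \<union> (\<lambda>b. (b, a)) ` ?Y) = card (Pair a ` ?X) + card ((\<lambda>b. (b, a)) ` ?Y)"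
    by (rule card_Un_disjoint) auto
  also have "\<dots> = card ?X + card ?Y"
    by (simp add: card_image inj_on_def)
  finally have 1: "card (?I F) = card (?I (F - {a})) + (card ?X + card ?Y)" .
  have "{b \<in> F. to_nat b < to_nat a} = ?X \<union> ?Z" by auto
  moreover have "card (?X \<union> ?Z) = card ?X + card ?Z" by (rule card_Un_disjoint) auto
  ultimately have 2: "card {b \<in> F. to_nat b < to_nat a} = card ?X + card ?Z" by metis
  have "{b \<in> F. key b < key a \<or> key b = key a \<and> to_nat b < to_nat a} = ?Y \<union> ?Z"
  proof (rule set_eqI)
    fix x
    have "x = a \<or> to_nat x < to_nat a \<or> to_nat a < to_nat x" using neq[of x] by linarith
    then show "x \<in> {b \<in> F. key b < key a \<or> key b = key a \<and> to_nat b < to_nat a} \<longleftrightarrow> x \<in> ?Y \<union> ?Z"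
      by auto
  qed
  moreover have "card (?Y \<union> ?Z) = card ?Y + card ?Z" by (rule card_Un_disjoint) auto
  ultimately have 3: "position key F a = card ?Y + card ?Z" unfolding position_def by metis
  have "even (card {b \<in> F. to_nat b < to_nat a} + card (?I (F - {a})))
      \<longleftrightarrow> even (card (?I F) + position key F a)"
    unfolding 1 2 3 by auto
  then show ?thesis
    unfolding koszul_sign_def reorder_sign_def power_add[symmetric] by (simp add: uminus_power_if)
qed

lemma reorder_sign_cases: "reorder_sign key F = (1 :: 'k::field) \<or> reorder_sign key F = (- 1 :: 'k)"
  by (simp add: reorder_sign_def uminus_power_if)

lemma koszul_sign_cases: "koszul_sign F a = (1 :: 'k::field) \<or> koszul_sign F a = (- 1 :: 'k)"
  by (simp add: koszul_sign_def uminus_power_if)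

lemma reorder_sign_remove':
  assumes "a \<in> F"
  shows "reorder_sign key F * koszul_sign F a = reorder_sign key (F - {a}) * ((- 1) ^ position key F a :: 'k::field)"
proof -
  have "(- 1 :: 'k) ^ position key F a = 1 \<or> (- 1 :: 'k) ^ position key F a = - 1"
    by (simp add: uminus_power_if)
  then show ?thesis
    using reorder_sign_remove[OF assms, of key, where 'k = 'k] koszul_sign_cases[of F a, where 'k = 'k]
    by (elim disjE) (simp_all, metis minus_minus)
qed

section \<open>Simplicial coboundaries of cochains pulled back along a labelling\<close>

definition scalar_diff :: "('x::finite set \<Rightarrow> 'k::field) \<Rightarrow> 'x set \<Rightarrow> 'k" where
  "scalar_diff c G = (\<Sum>a\<in>G. koszul_sign G a * c (G - {a}))"

text \<open>The pullback along \<open>key\<close> of the top cochain of the simplex with vertex set \<open>J\<close>.\<close>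

definition label_cochain :: "('x::finite \<Rightarrow> nat) \<Rightarrow> nat set \<Rightarrow> 'x set \<Rightarrow> 'k::field" where
  "label_cochain key J F = reorder_sign key F * of_bool (key ` F = J)"

text \<open>A set with one element more than \<open>J\<close> that maps onto \<open>J\<close> has
  exactly one repeated label. Only the deletions of the two elements sharing it survive, and these
  cancel because their positions are consecutive.\<close>

lemma scalar_diff_label_cochain_eq_0:
  fixes key :: "'x::finite \<Rightarrow> nat"
  assumes "finite J" "card G = Suc (card J)" "key ` G \<subseteq> J"
  shows "scalar_diff (label_cochain key J) G = (0 :: 'k::field)"
proof (cases "key ` G = J")
  case False
  then have "key ` (G - {a}) \<noteq> J" for a using assms(3) by blast
  then show ?thesis by (simp add: scalar_diff_def label_cochain_def)
next
  case True
  then have "\<not> inj_on key G" using assms(2) card_image by force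
  then obtain a b where ab: "a \<in> G" "b \<in> G" "key a = key b" "to_nat a < to_nat b"
    unfolding inj_on_def by (metis linorder_neqE_nat to_nat_split from_nat_to_nat)
  have inj: "inj_on key (G - {x})" if "x \<in> G" "key ` (G - {x}) = J" for x
    using that assms by (intro eq_card_imp_inj_on) auto
  have img: "key ` (G - {a}) = J" "key ` (G - {b}) = J"
  proof -
    have "key ` (G - {x}) = J" if "x \<in> G" "y \<in> G" "y \<noteq> x" "key x = key y" for x y
    proof -
      have "key ` G = insert (key x) (key ` (G - {x}))" using that(1) by auto
      moreover have "key x \<in> key ` (G - {x})" using that by auto
      ultimately show ?thesis using True by auto
    qed
    then show "key ` (G - {a}) = J" "key ` (G - {b}) = J" using ab by (metis less_irrefl)+
  qed
  have "koszul_sign G x * label_cochain key J (G - {x}) = (0 :: 'k)" if "x \<in> G - {a, b}" for x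
  proof -
    have "key ` (G - {x}) \<noteq> J" using inj[of x] that ab by (auto simp: inj_on_def)
    then show ?thesis by (simp add: label_cochain_def)
  qed
  then have "scalar_diff (label_cochain key J) G
      = (\<Sum>x\<in>{a, b}. koszul_sign G x * label_cochain key J (G - {x}) :: 'k)"
    unfolding scalar_diff_def using ab by (intro sum.mono_neutral_right) auto
  also have "\<dots> = koszul_sign G a * reorder_sign key (G - {a}) + koszul_sign G b * reorder_sign key (G - {b})"
    using img less_imp_neq[OF ab(4)] by (subst sum.insert) (auto simp: label_cochain_def)
  also have "\<dots> = reorder_sign key G * ((- 1) ^ position key G a + (- 1) ^ position key G b)"
    using ab by (simp add: reorder_sign_remove distrib_left)
  also have "position key G b = Suc (position key G a)"
  proof -
    have "{x \<in> G. key x < key b \<or> key x = key b \<and> to_nat x < to_nat b}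
        = insert a {x \<in> G. key x < key a \<or> key x = key a \<and> to_nat x < to_nat a}"
      using ab inj[OF ab(2) img(2)] inj[OF ab(1) img(1)] by (auto simp: inj_on_def)
    then show ?thesis by (simp add: position_def)
  qed
  finally show ?thesis by simp
qed

text \<open>The coboundary of the facet \<open>J\<close> of the simplex on
  \<open>insert j J\<close>. If \<open>F\<close> carries all labels, only the deletion of its unique
  element labelled \<open>j\<close> leaves \<open>J\<close>, and the sign is the parity of the place
  of \<open>j\<close>.\<close>

lemma scalar_diff_label_cochain:
  fixes key :: "'x::finite \<Rightarrow> nat"
  assumes "finite J" "j \<notin> J" "card F = Suc (card J)" "key ` F \<subseteq> insert j J"
  shows "scalar_diff (label_cochain key J) F
    = (- 1) ^ card {i \<in> J. i < j} * (label_cochain key (insert j J) F :: 'k::field)"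
proof (cases "j \<in> key ` F")
  case False
  then have "scalar_diff (label_cochain key J) F = (0 :: 'k)"
    using assms by (intro scalar_diff_label_cochain_eq_0) auto
  moreover have "key ` F \<noteq> insert j J" using False by blast
  ultimately show ?thesis by (simp add: label_cochain_def)
next
  case True
  show ?thesis
  proof (cases "key ` F = insert j J")
    case False
    have "key ` (F - {a}) \<noteq> J" if "a \<in> F" for a
      using True False assms(4) by auto
    then show ?thesis using False by (simp add: scalar_diff_def label_cochain_def)
  next
    case img: True
    then have inj: "inj_on key F" using assms by (intro eq_card_imp_inj_on) auto
    obtain a where a: "a \<in> F" "key a = j" using True by blast
    have img_a: "key ` (F - {a}) = J"
      using inj_on_image_set_diff[OF inj, of F "{a}"] a img assms(2) by auto
    have "koszul_sign F x * label_cochain key J (F - {x}) = (0 :: 'k)" if "x \<in> F - {a}" for x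
      using that a assms(2) by (auto simp: label_cochain_def)
    then have "scalar_diff (label_cochain key J) F
        = (\<Sum>x\<in>{a}. koszul_sign F x * label_cochain key J (F - {x}) :: 'k)"
      unfolding scalar_diff_def using a by (intro sum.mono_neutral_right) auto
    also have "\<dots> = reorder_sign key F * (- 1) ^ position key F a"
      using a img_a by (simp add: label_cochain_def reorder_sign_remove)
    also have "position key F a = card {i \<in> J. i < j}"
    proof -
      have "{b \<in> F. key b < key a \<or> key b = key a \<and> to_nat b < to_nat a} = {b \<in> F. key b < j}"
        using a inj by (auto simp: inj_on_def)
      moreover have "key ` {b \<in> F. key b < j} = {i \<in> J. i < j}"
        using img by auto
      moreover have "inj_on key {b \<in> F. key b < j}" using inj by (rule inj_on_subset) auto
      ultimately show ?thesis unfolding position_def by (simp flip: card_image)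
    qed
    also have "reorder_sign key F = (label_cochain key (insert j J) F :: 'k)"
      using img by (simp add: label_cochain_def)
    finally show ?thesis by (simp only: mult.commute)
  qed
qed

section \<open>Multidegrees of cochains\<close>

text \<open>The multidegree of the numerator over \<open>F\<close>, for denominators \<open>x\<^sub>F\<^sup>k\<close>, of a cochain of
  multidegree \<open>- u\<close>.\<close>

definition cochain_deg :: "nat \<Rightarrow> ('a::{finite,distrib_lattice} extended \<Rightarrow> int) \<Rightarrow> 'a set \<Rightarrow> 'a extended \<Rightarrow> int" where
  "cochain_deg k u F z = int k * (\<Sum>a\<in>F. ind z a) - u z"

lemma cochain_deg_remove:
  "a \<in> F \<Longrightarrow> cochain_deg k u F z - int k * ind z a = cochain_deg k u (F - {a}) z"
  by (simp add: cochain_deg_def sum.remove[of F a] algebra_simps)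

lemma minus_one_power_Const: "(- 1) ^ n = Const ((- 1) ^ n)"
  by (simp add: Const_def uminus_power_if single_uminus)

lemma mcoeff_koszul_diff:
  "mcoeff (koszul_diff k f G) w
    = (\<Sum>a\<in>G. koszul_sign G a * mcoeff (f (G - {a})) (\<lambda>z. w z - int k * ind z a))"
  unfolding koszul_diff_def mcoeff_sum koszul_sign_def
  by (rule sum.cong[OF refl])
    (simp only: mult.assoc minus_one_power_Const mcoeff_Const_mult mcoeff_Var_power_mult)

text \<open>The differential preserves the multidegree of the fractions f F / x_F^k, so only
  coefficients belonging to the same \<open>u\<close> interact.\<close>

lemma mcoeff_koszul_diff_cochain_deg:
  "mcoeff (koszul_diff k f G) (cochain_deg k u G)
    = (\<Sum>a\<in>G. koszul_sign G a * mcoeff (f (G - {a})) (cochain_deg k u (G - {a})))"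
  unfolding mcoeff_koszul_diff
  by (intro sum.cong arg_cong2[where f = "(*)"] arg_cong2[where f = mcoeff] refl ext)
    (simp_all add: cochain_deg_remove)

lemma mcoeff_prod_Var_mult:
  "mcoeff ((\<Prod>a\<in>F. Var a) * p) (cochain_deg (Suc k) u F) = mcoeff p (cochain_deg k u F)"
  unfolding prod_Var[OF finite] mcoeff_single_mult
  by (auto intro!: arg_cong2[where f = mcoeff] ext simp: cochain_deg_def algebra_simps)

section \<open>Elements of the canonical module\<close>

lemma linear_extension_altdef:
  "linear_extension ps \<longleftrightarrow> distinct ps \<and> set ps = {a. join_irreducible a} \<and> sorted_wrt (\<lambda>a b. \<not> b < a) ps"
  unfolding linear_extension_def sorted_wrt_iff_nth_less
  by (intro conj_cong refl iffI allI impI)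
    (metis order.asym less_trans, metis linorder_neqE_nat order.irrefl)

lemma finite_linear_extensions [simp]: "finite {ps :: 'a::{finite,distrib_lattice} list. linear_extension ps}"
  by (rule finite_subset[OF _ finite_lists_length_eq[OF finite, of UNIV "card {a :: 'a. join_irreducible a}"]])
    (auto simp: length_linear_extension)

text \<open>The sign of the permutation that sorts the list by \<open>to_nat\<close>; it orients the
  maximal chains.\<close>

fun inversion_sign :: "'x::countable list \<Rightarrow> 'k::field" where
  "inversion_sign [] = 1"
| "inversion_sign (p # ps) = (- 1) ^ card {q \<in> set ps. to_nat q < to_nat p} * inversion_sign ps"

lemma inversion_sign_cases: "inversion_sign ps = (1 :: 'k::field) \<or> inversion_sign ps = (- 1 :: 'k)"
proof (induction ps)
  case (Cons p ps)
  then show ?case by (elim disjE) (simp_all add: uminus_power_if)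
qed simp

lemma inversion_sign_swap:
  assumes "p \<noteq> q" "p \<notin> set ys" "q \<notin> set ys"
  shows "inversion_sign (xs @ q # p # ys) = - (inversion_sign (xs @ p # q # ys) :: 'k::field)"
proof (induction xs)
  case Nil
  have card: "card {r \<in> set (q # ys). to_nat r < to_nat p}
      = of_bool (to_nat q < to_nat p) + card {r \<in> set ys. to_nat r < to_nat p}"
    if "q \<notin> set ys" for p q
  proof -
    have "{r \<in> set (q # ys). to_nat r < to_nat p}
      = (if to_nat q < to_nat p then insert q else id) {r \<in> set ys. to_nat r < to_nat p}"
      by auto
    then show ?thesis using that by simp
  qed
  have "to_nat p < to_nat q \<longleftrightarrow> \<not> to_nat q < to_nat p"
    using assms(1) by (metis linorder_neqE_nat order.asym to_nat_split)
  then show ?case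
    unfolding append_Nil inversion_sign.simps card[OF assms(2)] card[OF assms(3)]
    by (cases "to_nat q < to_nat p") (simp_all add: mult.left_commute)
next
  case (Cons x xs)
  have "set (xs @ q # p # ys) = set (xs @ p # q # ys)" by auto
  then show ?case using Cons by simp
qed

definition segments :: "'a::{finite,distrib_lattice} list \<Rightarrow> 'a set" where
  "segments ps = segment ps ` {..length ps}"

lemma segment_inject:
  assumes "linear_extension ps" "i \<le> length ps" "j \<le> length ps"
  shows "segment ps i = segment ps j \<longleftrightarrow> i = j"
  using segment_le_iff[OF assms] segment_le_iff[OF assms(1,3,2)] by auto

lemma inj_on_segment: "linear_extension ps \<Longrightarrow> inj_on (segment ps) {..length ps}"
  by (auto simp: inj_on_def segment_inject)

lemma card_segments: "linear_extension ps \<Longrightarrow> card (segments ps) = Suc (length ps)"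
  unfolding segments_def by (simp add: card_image inj_on_segment)

definition lattice_rank :: "'a::{finite,distrib_lattice} \<Rightarrow> nat" where
  "lattice_rank a = card {p. join_irreducible p \<and> p \<le> a}"

lemma lattice_rank_segment:
  assumes "linear_extension ps" "i \<le> length ps"
  shows "lattice_rank (segment ps i) = i"
proof -
  have "{p. join_irreducible p \<and> p \<le> segment ps i} = set (take i ps)"
    using assms(1) le_segment[OF assms(1), of _ i] set_take_subset[of i ps]
    unfolding linear_extension_def by blast
  then show ?thesis
    using assms distinct_card[of "take i ps"] by (simp add: lattice_rank_def linear_extension_def)
qed

lemma position_segments:
  assumes "linear_extension ps" "i \<le> length ps"
  shows "position lattice_rank (segments ps) (segment ps i) = i"
proof -
  have "{b \<in> segments ps. lattice_rank b < i \<or> lattice_rank b = i \<and> to_nat b < to_nat (segment ps i)}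
      = segment ps ` {..<i}"
    using assms lattice_rank_segment[OF assms(1)] by (auto simp: segments_def)
  moreover have "inj_on (segment ps) {..<i}"
    by (rule inj_on_subset[OF inj_on_segment[OF assms(1)]]) (use assms in auto)
  ultimately show ?thesis
    by (simp add: position_def lattice_rank_segment[OF assms] card_image)
qed

text \<open>The relative fundamental cycle of the order polytope: the signed sum of the maximal chains of
  the lattice, which are the simplices of the canonical triangulation. Every codimension one face
  that is not shared by two maximal chains lies in a facet of the cone.\<close>

definition canonical_form ::
    "('a::{finite,distrib_lattice} extended \<Rightarrow> int) \<Rightarrow> nat \<Rightarrow> ('a set \<Rightarrow> ('a, 'k::field) mpol) \<Rightarrow> 'k" where
  "canonical_form v k f = (\<Sum>ps | linear_extension ps. inversion_sign ps *
     reorder_sign lattice_rank (segments ps) * mcoeff (f (segments ps)) (cochain_deg k v (segments ps)))"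

text \<open>If no member of \<open>H\<close> separates \<open>z\<close> from \<open>z'\<close>, the
  denominator contributes equally at both, and a monomial of this multidegree would force
  \<open>v z \<le> v z'\<close>.\<close>

lemma mcoeff_cochain_deg_eq_0:
  assumes "z \<in> hat {a. join_irreducible a}" "z < z'" "v z' < v z" "\<And>a. a \<in> H \<Longrightarrow> ind z a = ind z' a"
  shows "mcoeff p (cochain_deg k v H) = 0"
proof (rule ccontr)
  assume "mcoeff p (cochain_deg k v H) \<noteq> 0"
  then obtain m where "mdeg m = cochain_deg k v H" using mcoeff_neq_0 by blast
  then have "cochain_deg k v H z' \<le> cochain_deg k v H z"
    using mdeg_antimono[of z z' m] assms by simp
  moreover have "(\<Sum>a\<in>H. ind z a) = (\<Sum>a\<in>H. ind z' a)" using assms(4) by (rule sum.cong[OF refl])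
  ultimately show False using assms(3) by (simp add: cochain_deg_def)
qed

lemma linear_extension_swap:
  assumes "linear_extension (xs @ p # q # ys)" "\<not> p < q"
  shows "linear_extension (xs @ q # p # ys)"
  using assms unfolding linear_extension_altdef by (auto simp: sorted_wrt_append)

definition swap_at :: "nat \<Rightarrow> 'x list \<Rightarrow> 'x list" where
  "swap_at i ps = take (i - 1) ps @ ps ! i # ps ! (i - 1) # drop (Suc i) ps"

lemma split_at:
  assumes "0 < i" "i < length ps"
  shows "ps = take (i - 1) ps @ ps ! (i - 1) # ps ! i # drop (Suc i) ps"
  using assms by (metis Cons_nth_drop_Suc Suc_diff_1 append_take_drop_id less_imp_diff_less)

lemma swap_at_append: "length xs = i - 1 \<Longrightarrow> 0 < i \<Longrightarrow> swap_at i (xs @ p # q # ys) = xs @ q # p # ys"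
  by (cases i) (auto simp: swap_at_def nth_append)

text \<open>The sum runs over the faces opposite the vertex of rank \<open>i\<close>. Consider the
  poset elements added on reaching and on leaving that vertex. If they are comparable, no remaining
  vertex separates them and strictness of \<open>v\<close> kills the coefficient. Otherwise
  exchanging them gives another maximal chain with the same face and the opposite sign.\<close>

lemma canonical_form_cancel:
  fixes v :: "'a::{finite,distrib_lattice} extended \<Rightarrow> int" and g :: "'a set \<Rightarrow> ('a, 'k::field) mpol"
  assumes strict: "\<And>z z'. z \<in> hat {a. join_irreducible a} \<Longrightarrow> z' \<in> hat {a. join_irreducible a} \<Longrightarrow> z < z' \<Longrightarrow> v z' < v z"
    and i: "i \<le> card {a :: 'a. join_irreducible a}"
  defines "H \<equiv> \<lambda>ps. segment ps ` ({..length ps} - {i})"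
  shows "(\<Sum>ps | linear_extension ps. inversion_sign ps * (reorder_sign lattice_rank (H ps)
    * mcoeff (g (H ps)) (cochain_deg k v (H ps)))) = 0"
proof -
  define E where "E F = reorder_sign lattice_rank F * mcoeff (g F) (cochain_deg k v F)" for F
  \<comment> \<open>At the two ends of the chain there is nothing to exchange; the conventions -oo
    and oo put these faces into the comparable case.\<close>
  define z where "z ps = (if i = 0 then -\<infinity> else Fin (ps ! (i - 1)))" for ps :: "'a list"
  define z' where "z' ps = (if i = length ps then \<infinity> else Fin (ps ! i))" for ps :: "'a list"
  have E0: "E (H ps) = 0" if ps: "linear_extension ps" and less: "z ps < z' ps" for ps
  proof -
    have i': "i \<le> length ps" using i length_linear_extension[OF ps] by simp
    have "mcoeff (g (H ps)) (cochain_deg k v (H ps)) = 0"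
    proof (rule mcoeff_cochain_deg_eq_0[OF _ less])
      show "z ps \<in> hat {a. join_irreducible a}"
        using nth_linear_extension[OF ps, of "i - 1"] i' by (auto simp: z_def hat_def)
      moreover have "z' ps \<in> hat {a. join_irreducible a}"
        using nth_linear_extension[OF ps, of i] i' by (auto simp: z'_def hat_def)
      ultimately show "v (z' ps) < v (z ps)" using less strict by blast
      show "ind (z ps) a = ind (z' ps) a" if a: "a \<in> H ps" for a
      proof -
        obtain j where j: "j \<le> length ps" "j \<noteq> i" "a = segment ps j" using a by (auto simp: H_def)
        then show ?thesis
          using i' nth_linear_extension[OF ps] by (auto simp: z_def z'_def nth_le_segment[OF ps])
      qed
    qed
    then show ?thesis by (simp add: E_def)
  qed
  show ?thesis
  proof (cases "0 < i \<and> i < card {a :: 'a. join_irreducible a}")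
    case False
    have "z ps < z' ps" if "linear_extension ps" for ps
      using False i length_linear_extension[OF that] by (auto simp: z_def z'_def)
    then have "inversion_sign ps * E (H ps) = 0" if "linear_extension ps" for ps
      using E0 that by simp
    then show ?thesis unfolding E_def by (intro sum.neutral) blast
  next
    case True
    have len: "0 < i" "i < length ps" if "linear_extension ps" for ps :: "'a list"
      using True length_linear_extension[OF that] by auto
    define A where "A = {ps :: 'a list. linear_extension ps \<and> \<not> ps ! (i - 1) < ps ! i}"
    \<comment> \<open>Swapping is an involution of \<open>A\<close> without fixed points;
      \<open>A1\<close> and \<open>A2\<close> are halves that it exchanges.\<close>
    define A1 where "A1 = {ps \<in> A. to_nat (ps ! (i - 1)) < to_nat (ps ! i)}"
    define A2 where "A2 = {ps \<in> A. to_nat (ps ! i) < to_nat (ps ! (i - 1))}"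
    have fin: "finite A" by (rule finite_subset[OF _ finite_linear_extensions]) (auto simp: A_def)
    have swap: "swap_at i ps \<in> A" "swap_at i ps ! i = ps ! (i - 1)" "swap_at i ps ! (i - 1) = ps ! i"
        "swap_at i (swap_at i ps) = ps" "inversion_sign (swap_at i ps) = - (inversion_sign ps :: 'k)"
        "H (swap_at i ps) = H ps" "ps ! i \<noteq> ps ! (i - 1)"
      if "ps \<in> A" for ps
    proof -
      have ps: "linear_extension ps" "\<not> ps ! (i - 1) < ps ! i" using that by (auto simp: A_def)
      define xs p q ys where "xs = take (i - 1) ps" and "p = ps ! (i - 1)" and "q = ps ! i"
        and "ys = drop (Suc i) ps"
      have split: "ps = xs @ p # q # ys"
        unfolding xs_def p_def q_def ys_def using len[OF ps(1)] by (rule split_at)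
      have xs: "length xs = i - 1" using len[OF ps(1)] by (simp add: xs_def)
      have sw: "swap_at i ps = xs @ q # p # ys"
        unfolding split using xs len[OF ps(1)] by (intro swap_at_append) auto
      have le: "linear_extension (swap_at i ps)"
        unfolding sw
        by (rule linear_extension_swap[OF ps(1)[unfolded split] ps(2)[folded p_def q_def]])
      show n: "swap_at i ps ! i = ps ! (i - 1)" "swap_at i ps ! (i - 1) = ps ! i"
        unfolding sw using xs len[OF ps(1)] by (auto simp: nth_append p_def q_def)
      have "\<not> ps ! i < ps ! (i - 1)"
        using ps(1) len[OF ps(1)] unfolding linear_extension_def by (metis diff_le_self leD less_imp_diff_less)
      then show "swap_at i ps \<in> A" using le n by (simp add: A_def)
      show "swap_at i (swap_at i ps) = ps"
        unfolding sw using xs len[OF ps(1)] split by (simp add: swap_at_append)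
      have dist: "distinct (xs @ p # q # ys)" using ps(1) split by (simp add: linear_extension_def)
      show "inversion_sign (swap_at i ps) = - (inversion_sign ps :: 'k)"
        unfolding sw by (subst split, rule inversion_sign_swap) (use dist in auto)
      show "ps ! i \<noteq> ps ! (i - 1)" using dist unfolding p_def[symmetric] q_def[symmetric] by auto
      have "set (take j (swap_at i ps)) = set (take j ps)" if "j \<noteq> i" for j
      proof (cases "j < i")
        case True
        then have "j \<le> length xs" using xs by simp
        then show ?thesis unfolding sw by (subst split) simp
      next
        case False
        then have "j = length xs + Suc (Suc (j - Suc i))"
          using that xs len[OF ps(1)] by simp
        then obtain l where "j = length xs + Suc (Suc l)" ..
        then show ?thesis unfolding sw by (subst split) auto
      qed
      moreover have "length (swap_at i ps) = length ps" unfolding sw by (subst split) simp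
      ultimately show "H (swap_at i ps) = H ps"
        unfolding H_def segment_def by (intro image_cong) auto
    qed
    have "(\<Sum>ps | linear_extension ps. inversion_sign ps * E (H ps)) = (\<Sum>ps\<in>A. inversion_sign ps * E (H ps))"
    proof (rule sum.mono_neutral_right)
      show "\<forall>ps\<in>{ps. linear_extension ps} - A. inversion_sign ps * E (H ps) = 0"
      proof
        fix ps assume ps: "ps \<in> {ps. linear_extension ps} - A"
        then have "z ps < z' ps" using len[of ps] by (auto simp: A_def z_def z'_def)
        then show "inversion_sign ps * E (H ps) = 0" using E0[of ps] ps by simp
      qed
    qed (auto simp: A_def)
    also have "A = A1 \<union> A2"
    proof -
      have "to_nat (ps ! i) \<noteq> to_nat (ps ! (i - 1))" if "ps \<in> A" for ps using swap(7)[OF that] by simp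
      then have "ps \<in> A1 \<or> ps \<in> A2" if "ps \<in> A" for ps
        using that unfolding A1_def A2_def mem_Collect_eq by (meson linorder_neqE_nat)
      then show ?thesis unfolding A1_def A2_def by blast
    qed
    also have "(\<Sum>ps\<in>A1 \<union> A2. inversion_sign ps * E (H ps))
        = (\<Sum>ps\<in>A1. inversion_sign ps * E (H ps)) + (\<Sum>ps\<in>A2. inversion_sign ps * E (H ps))"
      using fin by (intro sum.union_disjoint) (auto simp: A1_def A2_def)
    also have "(\<Sum>ps\<in>A2. inversion_sign ps * E (H ps)) = (\<Sum>ps\<in>A1. - (inversion_sign ps * E (H ps)))"
      by (rule sum.reindex_bij_witness[of _ "swap_at i" "swap_at i"])
        (auto simp: A1_def A2_def swap simp del: One_nat_def)
    also have "(\<Sum>ps\<in>A1. inversion_sign ps * E (H ps)) + \<dots> = 0"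
      by (simp add: sum_negf)
    finally show ?thesis by (simp add: E_def)
  qed
qed

text \<open>Sorting by \<open>lattice_rank\<close> puts the vertex of rank \<open>i\<close> at
  position \<open>i\<close> in every maximal chain, so the sign (-1)^i leaves the sum over the
  chains, and \<open>canonical_form_cancel\<close> applies for each \<open>i\<close>.\<close>

lemma canonical_form_koszul_diff:
  fixes v :: "'a::{finite,distrib_lattice} extended \<Rightarrow> int" and g :: "'a set \<Rightarrow> ('a, 'k::field) mpol"
  assumes strict: "\<And>z z'. z \<in> hat {a. join_irreducible a} \<Longrightarrow> z' \<in> hat {a. join_irreducible a} \<Longrightarrow> z < z' \<Longrightarrow> v z' < v z"
  shows "canonical_form v k (koszul_diff k g) = 0"
proof -
  define n where "n = card {a :: 'a. join_irreducible a}"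
  define E where "E F = reorder_sign lattice_rank F * mcoeff (g F) (cochain_deg k v F)" for F
  have pointwise: "reorder_sign lattice_rank (segments ps) * mcoeff (koszul_diff k g (segments ps)) (cochain_deg k v (segments ps))
      = (\<Sum>i\<le>n. (- 1) ^ i * E (segment ps ` ({..length ps} - {i})))"
    if ps: "linear_extension ps" for ps
  proof -
    have n: "length ps = n" using length_linear_extension[OF ps] by (simp add: n_def)
    have "reorder_sign lattice_rank (segments ps) * mcoeff (koszul_diff k g (segments ps)) (cochain_deg k v (segments ps))
      = (\<Sum>a\<in>segments ps. (- 1) ^ position lattice_rank (segments ps) a * E (segments ps - {a}))"
      unfolding mcoeff_koszul_diff_cochain_deg sum_distrib_left
    proof (rule sum.cong[OF refl])
      fix a assume a: "a \<in> segments ps"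
      show "reorder_sign lattice_rank (segments ps) * (koszul_sign (segments ps) a *
          mcoeff (g (segments ps - {a})) (cochain_deg k v (segments ps - {a})))
        = (- 1) ^ position lattice_rank (segments ps) a * E (segments ps - {a})"
        unfolding mult.assoc[symmetric] reorder_sign_remove'[OF a] E_def
        by (simp only: mult.commute mult.assoc)
    qed
    also have "\<dots> = (\<Sum>i\<le>n. (- 1) ^ i * E (segments ps - {segment ps i}))"
      unfolding segments_def[of ps, unfolded n]
      by (subst sum.reindex) (use inj_on_segment[OF ps] position_segments[OF ps] n in
          \<open>auto simp: segments_def intro!: sum.cong\<close>)
    also have "\<dots> = (\<Sum>i\<le>n. (- 1) ^ i * E (segment ps ` ({..length ps} - {i})))"
    proof (rule sum.cong[OF refl])
      fix i assume "i \<in> {..n}"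
      then have "segments ps - {segment ps i} = segment ps ` ({..length ps} - {i})"
        unfolding segments_def using segment_inject[OF ps] n by auto
      then show "(- 1) ^ i * E (segments ps - {segment ps i}) = (- 1) ^ i * E (segment ps ` ({..length ps} - {i}))"
        by simp
    qed
    finally show ?thesis .
  qed
  have "canonical_form v k (koszul_diff k g)
    = (\<Sum>ps | linear_extension ps. \<Sum>i\<le>n. (- 1) ^ i * (inversion_sign ps * E (segment ps ` ({..length ps} - {i}))))"
    unfolding canonical_form_def mult.assoc
    by (intro sum.cong refl) (simp only: pointwise mem_Collect_eq sum_distrib_left mult.left_commute)
  also have "\<dots> = (\<Sum>i\<le>n. (- 1) ^ i * (\<Sum>ps | linear_extension ps. inversion_sign ps * E (segment ps ` ({..length ps} - {i}))))"
    by (subst sum.swap) (simp add: sum_distrib_left)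
  also have "\<dots> = 0"
  proof (rule sum.neutral, rule ballI)
    fix i assume "i \<in> {..n}"
    then show "(- 1) ^ i * (\<Sum>ps | linear_extension ps. inversion_sign ps * E (segment ps ` ({..length ps} - {i}))) = 0"
      using canonical_form_cancel[where v = v and i = i and g = g and k = k, OF strict]
      unfolding E_def n_def by (simp only: atMost_iff mult_zero_right)
  qed
  finally show ?thesis .
qed

lemma canonical_form_cong:
  assumes "\<And>ps w. linear_extension ps \<Longrightarrow> mcoeff (f (segments ps)) w = mcoeff (g (segments ps)) w"
  shows "canonical_form v k f = canonical_form v k g"
  unfolding canonical_form_def using assms by (intro sum.cong) auto

text \<open>Linearity and compatibility with raising \<open>k\<close> hold for arbitrary cochains;
  strictness of \<open>v\<close> enters through the vanishing on coboundaries. As the form reads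
  only multidegree \<open>- v\<close>, the relevant degree is
  \<open>j = v (-\<infinity>)\<close>.\<close>

lemma canonical_form_in_canonical_module:
  fixes v :: "'a::{finite,distrib_lattice} extended \<Rightarrow> int"
  assumes strict: "\<And>z z'. z \<in> hat {a. join_irreducible a} \<Longrightarrow> z' \<in> hat {a. join_irreducible a} \<Longrightarrow> z < z' \<Longrightarrow> v z' < v z"
  shows "canonical_form v \<in> canonical_module (hibi_ideal :: ('a, 'k::field) mpol set) j"
  unfolding canonical_module_def local_cohomology_dual_def
proof (intro CollectI allI ballI conjI impI)
  fix k and f :: "'a set \<Rightarrow> ('a, 'k) mpol"
  show "canonical_form v k (\<lambda>F. f F + g F) = canonical_form v k f + canonical_form v k g" for g
    by (simp add: canonical_form_def distrib_left sum.distrib)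
  show "canonical_form v k (\<lambda>F. Const c * f F) = c * canonical_form v k f" for c
    unfolding canonical_form_def mcoeff_Const_mult sum_distrib_left
    by (intro sum.cong refl mult.left_commute)
  show "canonical_form v (Suc k) (\<lambda>F. (\<Prod>a\<in>F. Var a) * f F) = canonical_form v k f"
    by (simp add: canonical_form_def mcoeff_prod_Var_mult)
  assume "f \<in> coboundaries hibi_ideal (quotient_dim (hibi_ideal :: ('a, 'k) mpol set)) k"
  then obtain g where g: "\<And>F. card F = Suc (card {a :: 'a. join_irreducible a}) \<Longrightarrow> f F - koszul_diff k g F \<in> hibi_ideal"
    unfolding coboundaries_def quotient_dim_hibi_ideal by blast
  have "canonical_form v k f = canonical_form v k (koszul_diff k g)"
  proof (rule canonical_form_cong)
    fix ps :: "'a list" and w assume ps: "linear_extension ps"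
    have "f (segments ps) - koszul_diff k g (segments ps) \<in> hibi_ideal"
      using card_segments[OF ps] length_linear_extension[OF ps] by (intro g) simp
    from mcoeff_hibi_ideal[OF this, of w]
    show "mcoeff (f (segments ps)) w = mcoeff (koszul_diff k g (segments ps)) w" by simp
  qed
  then show "canonical_form v k f = 0" using canonical_form_koszul_diff[of v, OF strict] by simp
qed

section \<open>Cocycles in negative multidegrees\<close>

abbreviation hat_poset :: "'a::{finite,distrib_lattice} extended set" where
  "hat_poset \<equiv> hat {a. join_irreducible a}"

abbreviation upper_poset :: "'a::{finite,distrib_lattice} extended set" where
  "upper_poset \<equiv> insert \<infinity> (Fin ` {a. join_irreducible a})"

lemma upper_poset_eq: "upper_poset = hat_poset - {-\<infinity>}" by (auto simp: hat_def)

text \<open>A crude bound for all differences of values of \<open>u\<close>. From this exponent on,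
  a single separating element in the denominator makes up for any drop of \<open>u\<close>.\<close>

definition degree_bound :: "('a::{finite,distrib_lattice} extended \<Rightarrow> int) \<Rightarrow> nat" where
  "degree_bound u = (\<Sum>z\<in>hat_poset. nat \<bar>u z\<bar>)"

lemma finite_hat_poset [simp]: "finite (hat_poset :: 'a::{finite,distrib_lattice} extended set)"
  by (simp add: hat_def)

lemma degree_bound:
  assumes "z \<in> hat_poset" "z' \<in> hat_poset" "z \<noteq> z'"
  shows "u z - u z' \<le> int (degree_bound u)"
proof -
  have "(\<Sum>z\<in>{z, z'}. nat \<bar>u z\<bar>) \<le> degree_bound u"
    unfolding degree_bound_def using assms by (intro sum_mono2) auto
  then show ?thesis using assms(3) by simp
qed

text \<open>An element of \<open>H\<close> that contains \<open>z\<close> but not \<open>z'\<close>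
  contributes \<open>k\<close> to the difference of the values at \<open>z\<close> and
  \<open>z'\<close>, which outweighs the drop of \<open>u\<close>. Hence the required multidegree is
  order-reversing.\<close>

lemma exists_cochain_monomial:
  fixes u :: "'a::{finite,distrib_lattice} extended \<Rightarrow> int"
  assumes "u \<infinity> = 0" "\<And>p. \<not> join_irreducible p \<Longrightarrow> u (Fin p) = 0" "degree_bound u \<le> k"
    and "\<And>z z'. z \<in> hat_poset \<Longrightarrow> z' \<in> hat_poset \<Longrightarrow> z < z' \<Longrightarrow>
      u z \<le> u z' \<or> (\<exists>a\<in>H. ind z a = 1 \<and> ind z' a = 0)"
  shows "\<exists>m. mdeg m = cochain_deg k u H"
proof (rule exists_monomial_mdeg)
  fix z z' :: "'a extended" assume z: "z \<in> hat_poset" "z' \<in> hat_poset" "z < z'"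
  have mono: "ind z' a \<le> ind z a" for a
    using mdeg_antimono[of z z' "Poly_Mapping.single a 1"] z by simp
  define s where "s = (\<Sum>a\<in>H. ind z a - ind z' a)"
  have s: "(\<Sum>a\<in>H. ind z a) = s + (\<Sum>a\<in>H. ind z' a)" by (simp add: s_def sum_subtractf)
  have s0: "0 \<le> s" using mono by (simp add: s_def sum_nonneg)
  have "u z - u z' \<le> int k * s"
  proof (cases "u z \<le> u z'")
    case True
    then show ?thesis using s0 by (smt (verit) mult_nonneg_nonneg of_nat_0_le_iff)
  next
    case False
    then obtain a where a: "a \<in> H" "ind z a = 1" "ind z' a = 0" using assms(4) z by blast
    have "ind z a - ind z' a \<le> s"
      unfolding s_def using a(1) mono by (intro member_le_sum) auto
    then have "1 \<le> s" using a by simp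
    then have "int k \<le> int k * s" by (simp add: mult_le_cancel_left1)
    moreover have "u z - u z' \<le> int k"
      using degree_bound[OF z(1,2) order.strict_implies_not_eq[OF z(3)], of u] assms(3) by linarith
    ultimately show ?thesis by simp
  qed
  then show "cochain_deg k u H z' \<le> cochain_deg k u H z"
    by (simp add: cochain_deg_def s algebra_simps)
qed (simp_all add: cochain_deg_def assms)

text \<open>The test for 0 guards the choice: over sets where \<open>c\<close> vanishes there may be
  no monomial of the required multidegree.\<close>

definition lift_cochain :: "nat \<Rightarrow> ('a::{finite,distrib_lattice} extended \<Rightarrow> int) \<Rightarrow> ('a set \<Rightarrow> 'k)
    \<Rightarrow> 'a set \<Rightarrow> ('a, 'k::field) mpol" where
  "lift_cochain k u c F = (if c F = 0 then 0 else Poly_Mapping.single (SOME m. mdeg m = cochain_deg k u F) (c F))"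

lemma homogeneous_iff_mdeg: "homogeneous n p \<longleftrightarrow> (\<forall>m\<in>Poly_Mapping.keys p. mdeg m (-\<infinity>) = n)"
  by (simp add: homogeneous_def mdeg_Minf)

lemma lift_cochain:
  assumes "c F \<noteq> 0 \<Longrightarrow> \<exists>m. mdeg m = cochain_deg k u F"
  shows "mcoeff (lift_cochain k u c F) w = (if w = cochain_deg k u F then c F else 0)"
    and "homogeneous (int (card F * k) - u (-\<infinity>)) (lift_cochain k u c F)"
proof -
  define m where "m = (SOME m. mdeg m = cochain_deg k u F)"
  have m: "mdeg m = cochain_deg k u F" if "c F \<noteq> 0"
    using someI_ex[OF assms[OF that]] by (simp add: m_def)
  show "mcoeff (lift_cochain k u c F) w = (if w = cochain_deg k u F then c F else 0)"
    using m by (auto simp: lift_cochain_def mcoeff_single simp flip: m_def)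
  show "homogeneous (int (card F * k) - u (-\<infinity>)) (lift_cochain k u c F)"
    using m by (auto simp: homogeneous_iff_mdeg lift_cochain_def cochain_deg_def mult.commute
        simp flip: m_def)
qed

text \<open>A cochain with scalar values \<open>c\<close> in multidegree \<open>- u\<close> behaves like the simplicial cochain \<open>c\<close>.\<close>

lemma mcoeff_koszul_diff_scalar:
  assumes "\<And>a w. a \<in> G \<Longrightarrow> mcoeff (f (G - {a})) w = (if w = cochain_deg k u (G - {a}) then c (G - {a}) else 0)"
  shows "mcoeff (koszul_diff k f G) w = (if w = cochain_deg k u G then scalar_diff c G else 0)"
proof -
  have eq: "(\<lambda>z. w z - int k * ind z a) = cochain_deg k u (G - {a}) \<longleftrightarrow> w = cochain_deg k u G" if "a \<in> G" for a
    using cochain_deg_remove[OF that, of k u] by (auto simp: fun_eq_iff) (metis diff_add_cancel)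
  have "mcoeff (koszul_diff k f G) w = (\<Sum>a\<in>G. koszul_sign G a * (if w = cochain_deg k u G then c (G - {a}) else 0))"
    unfolding mcoeff_koszul_diff by (intro sum.cong refl) (simp add: assms eq)
  then show ?thesis by (auto simp: scalar_diff_def)
qed

section \<open>Labels and the cocycle of a numbering\<close>

definition first_missing :: "('a::{finite,distrib_lattice} extended \<Rightarrow> nat) \<Rightarrow> 'a \<Rightarrow> nat" where
  "first_missing key a = Min (key ` {z \<in> upper_poset. ind z a = 0})"

text \<open>A linear extension of \<open>hat P\<close>, given by its numbering. Every lattice element, viewed as an
  ideal of \<open>P\<close>, is labelled by the first element of \<open>P \<union> {\<infinity>}\<close> missing from it.\<close>

locale numbering =
  fixes key :: "'a::{finite,distrib_lattice} extended \<Rightarrow> nat"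
  assumes inj_key: "inj_on key hat_poset"
    and key_mono: "\<And>z z'. z \<in> hat_poset \<Longrightarrow> z' \<in> hat_poset \<Longrightarrow> z < z' \<Longrightarrow> key z < key z'"
begin

definition labels :: "nat set" where "labels = key ` upper_poset"

lemma finite_labels [simp]: "finite labels" by (simp add: labels_def)

lemma card_labels: "card labels = Suc (card {a :: 'a. join_irreducible a})"
proof -
  have "card labels = card (upper_poset :: 'a extended set)"
    unfolding labels_def using inj_key by (intro card_image) (auto simp: inj_on_def hat_def)
  also have "\<dots> = Suc (card {a :: 'a. join_irreducible a})"
    by (subst card_insert_disjoint) (auto simp: card_image inj_on_def)
  finally show ?thesis .
qed

lemma first_missing_in: "first_missing key a \<in> key ` {z \<in> upper_poset. ind z a = 0}"
  unfolding first_missing_def by (intro Min_in) auto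

lemma first_missing_in_labels: "first_missing key a \<in> labels"
  using first_missing_in unfolding labels_def by blast

lemma first_missingD:
  assumes "first_missing key a = key z" "z \<in> upper_poset"
  shows "ind z a = 0" "\<And>z'. z' \<in> hat_poset \<Longrightarrow> key z' < key z \<Longrightarrow> ind z' a = 1"
proof -
  obtain y where y: "y \<in> upper_poset" "ind y a = 0" "first_missing key a = key y"
    using first_missing_in[of a] by blast
  have "y = z" using inj_onD[OF inj_key, of y z] assms y unfolding upper_poset_eq by auto
  then show "ind z a = 0" using y by simp
  fix z' assume z': "z' \<in> hat_poset" "key z' < key z"
  show "ind z' a = 1"
  proof (rule ccontr)
    assume "ind z' a \<noteq> 1"
    then have "ind z' a = 0" using ind_nonneg[of z' a] ind_le_1[of z' a] by linarith
    moreover from this have "z' \<noteq> -\<infinity>" by auto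
    ultimately have "first_missing key a \<le> key z'"
      unfolding first_missing_def using z'(1) by (intro Min_le) (auto simp: upper_poset_eq)
    then show False using z' assms by simp
  qed
qed

text \<open>There are |P| + 1 labels, so among sets of that size the support consists of the sets
  carrying every label once.\<close>

definition class_cochain :: "'a set \<Rightarrow> 'k::field" where
  "class_cochain = label_cochain (first_missing key) labels"

lemma class_cochain_neq_0D:
  "class_cochain F \<noteq> (0 :: 'k::field) \<Longrightarrow> first_missing key ` F = labels"
  by (auto simp: class_cochain_def label_cochain_def)

text \<open>The ideal \<open>a\<close> contains everything numbered before its first missing element
  \<open>z'\<close>, in particular \<open>z\<close>.\<close>

lemma separated:
  assumes "first_missing key a = key z'" "z \<in> hat_poset" "z' \<in> hat_poset" "z < z'"
  shows "ind z a = 1 \<and> ind z' a = 0"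
proof -
  have "z' \<in> upper_poset" using assms unfolding upper_poset_eq by auto
  then show ?thesis using first_missingD[OF assms(1)] key_mono assms by blast
qed

lemma exists_class_monomial:
  fixes u :: "'a extended \<Rightarrow> int"
  assumes "u \<infinity> = 0" "\<And>p. \<not> join_irreducible p \<Longrightarrow> u (Fin p) = 0" "degree_bound u \<le> k"
    and "first_missing key ` F = labels"
  shows "\<exists>m. mdeg m = cochain_deg k u F"
proof (rule exists_cochain_monomial[OF assms(1-3)], simp_all)
  fix z z' :: "'a extended" assume z: "z \<in> hat_poset" "z' \<in> hat_poset" "z < z'"
  then have "key z' \<in> labels" unfolding labels_def upper_poset_eq by auto
  then obtain a where "a \<in> F" "first_missing key a = key z'" using assms(4) by (metis image_iff)
  then show "u z \<le> u z' \<or> (\<exists>a\<in>F. ind z a = 1 \<and> ind z' a = 0)" using separated z by blast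
qed

lemma lift_class_cochain:
  fixes u :: "'a extended \<Rightarrow> int"
  assumes "u \<infinity> = 0" "\<And>p. \<not> join_irreducible p \<Longrightarrow> u (Fin p) = 0" "degree_bound u \<le> k"
  shows "mcoeff (lift_cochain k u class_cochain F :: ('a, 'k::field) mpol) w
      = (if w = cochain_deg k u F then class_cochain F else 0)"
    and "homogeneous (int (card F * k) - u (-\<infinity>)) (lift_cochain k u class_cochain F :: ('a, 'k) mpol)"
  using lift_cochain[of "class_cochain :: _ \<Rightarrow> 'k" F k u] exists_class_monomial[OF assms] class_cochain_neq_0D[of F, where 'k = 'k]
  by metis+

text \<open>A set of |P| + 2 elements carries only |P| + 1 labels, so the scalar coboundary
  vanishes.\<close>

lemma class_cocycle:
  fixes u :: "'a extended \<Rightarrow> int"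
  assumes "u \<infinity> = 0" "\<And>p. \<not> join_irreducible p \<Longrightarrow> u (Fin p) = 0" "degree_bound u \<le> k"
  shows "lift_cochain k u class_cochain \<in> cocycles (hibi_ideal :: ('a, 'k::field) mpol set)
    (Suc (card {a :: 'a. join_irreducible a})) k (- u (-\<infinity>))"
  unfolding cocycles_def
proof (intro CollectI conjI allI impI)
  fix F :: "'a set" assume "card F = Suc (card {a :: 'a. join_irreducible a})"
  then show "homogeneous (- u (-\<infinity>) + int (Suc (card {a :: 'a. join_irreducible a}) * k))
      (lift_cochain k u class_cochain F :: ('a, 'k) mpol)"
    using lift_class_cochain(2)[OF assms, of F, where 'k = 'k] by (simp add: algebra_simps)
next
  fix G :: "'a set" assume G: "card G = Suc (Suc (card {a :: 'a. join_irreducible a}))"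
  have "scalar_diff class_cochain G = (0 :: 'k)"
    unfolding class_cochain_def using G first_missing_in_labels
    by (intro scalar_diff_label_cochain_eq_0) (auto simp: card_labels)
  then show "koszul_diff k (lift_cochain k u class_cochain) G \<in> (hibi_ideal :: ('a, 'k) mpol set)"
    unfolding hibi_ideal_iff
    using mcoeff_koszul_diff_scalar[OF lift_class_cochain(1)[OF assms, where 'k = 'k], of G] by simp
qed

lemma first_missing_segment:
  assumes ps: "linear_extension ps" "sorted (map (\<lambda>p. key (Fin p)) ps)" and i: "i \<le> length ps"
  shows "first_missing key (segment ps i) = (if i = length ps then key \<infinity> else key (Fin (ps ! i)))"
  unfolding first_missing_def
proof (rule Min_eqI)
  show "(if i = length ps then key \<infinity> else key (Fin (ps ! i))) \<in> key ` {z \<in> upper_poset. ind z (segment ps i) = 0}"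
    using i nth_linear_extension[OF ps(1)] nth_le_segment[OF ps(1)] by auto
  fix l assume "l \<in> key ` {z \<in> upper_poset. ind z (segment ps i) = 0}"
  then obtain z where z: "z \<in> upper_poset" "ind z (segment ps i) = 0" "l = key z" by blast
  show "(if i = length ps then key \<infinity> else key (Fin (ps ! i))) \<le> l"
  proof (cases z)
    case (Fin p)
    then have p: "join_irreducible p" "\<not> p \<le> segment ps i" using z by auto
    then obtain j where j: "j < length ps" "p = ps ! j"
      using ps(1) by (metis in_set_conv_nth linear_extension_def mem_Collect_eq)
    then have "i \<le> j" using p nth_le_segment[OF ps(1)] by (metis leI)
    then show ?thesis using sorted_nth_mono[OF ps(2) \<open>i \<le> j\<close>] j z Fin by auto
  next
    case Pinf
    then show ?thesis
      using key_mono[of "Fin (ps ! i)" \<infinity>] nth_linear_extension[OF ps(1), of i] i z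
      by (auto simp: hat_def)
  qed (use z in auto)
qed simp

text \<open>If an earlier entry had the larger key, the segment labelled by it would miss that entry
  and yet contain a later one, which is impossible for a prefix.\<close>

lemma sorted_if_labels:
  assumes ps: "linear_extension ps" and labels: "first_missing key ` segments ps = labels"
  shows "sorted (map (\<lambda>p. key (Fin p)) ps)"
  unfolding sorted_iff_nth_mono_less
proof (intro allI impI)
  fix i j assume ij: "i < j" "j < length (map (\<lambda>p. key (Fin p)) ps)"
  show "map (\<lambda>p. key (Fin p)) ps ! i \<le> map (\<lambda>p. key (Fin p)) ps ! j"
  proof (rule ccontr)
    assume "\<not> ?thesis"
    then have less: "key (Fin (ps ! j)) < key (Fin (ps ! i))" using ij by simp
    have in_upper: "Fin (ps ! i) \<in> upper_poset" "Fin (ps ! j) \<in> upper_poset"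
      using nth_linear_extension[OF ps] ij by auto
    then obtain m where m: "m \<le> length ps" "first_missing key (segment ps m) = key (Fin (ps ! i))"
      using labels unfolding segments_def labels_def by (smt (verit) atMost_iff image_iff)
    have "Fin (ps ! j) \<in> hat_poset" using in_upper(2) unfolding upper_poset_eq by blast
    note first_missingD(1)[OF m(2) in_upper(1)] first_missingD(2)[OF m(2) in_upper(1) this less]
    then have "\<not> i < m" "j < m"
      using nth_le_segment[OF ps, of i m] nth_le_segment[OF ps, of j m] nth_linear_extension[OF ps] ij
      by (auto split: if_splits)
    then show False using ij by simp
  qed
qed

text \<open>Only the maximal chain sorted by \<open>key\<close> carries all labels. The form reduces
  to one product of signs, which is nonzero in every characteristic.\<close>

lemma canonical_form_class:
  fixes v :: "'a extended \<Rightarrow> int"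
  assumes "v \<infinity> = 0" "\<And>p. \<not> join_irreducible p \<Longrightarrow> v (Fin p) = 0" "degree_bound v \<le> k"
  shows "canonical_form v k (lift_cochain k v class_cochain) \<noteq> (0 :: 'k::field)"
proof -
  have inj: "inj_on (\<lambda>p. key (Fin p)) {a. join_irreducible a}"
    using inj_key by (auto simp: inj_on_def hat_def)
  moreover have "key (Fin a) < key (Fin b)" if "join_irreducible a" "join_irreducible b" "a < b" for a b
    using key_mono[of "Fin a" "Fin b"] that by (simp add: hat_def)
  ultimately obtain qs where qs: "linear_extension qs" "sorted (map (\<lambda>p. key (Fin p)) qs)"
    using exists_sorted_linear_extension by blast
  have unique: "ps = qs" if "linear_extension ps" "sorted (map (\<lambda>p. key (Fin p)) ps)" for ps
  proof -
    have "inj_on (\<lambda>p. key (Fin p)) (set ps \<union> set qs)"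
      using inj that qs by (simp add: linear_extension_def)
    moreover have "map (\<lambda>p. key (Fin p)) ps = map (\<lambda>p. key (Fin p)) qs"
      using that qs inj by (intro sorted_distinct_set_unique)
        (auto simp: linear_extension_def distinct_map)
    ultimately show ?thesis by (metis map_inj_on)
  qed
  have "first_missing key ` segments qs = labels"
  proof (rule card_subset_eq)
    show "first_missing key ` segments qs \<subseteq> labels" using first_missing_in_labels by blast
    have "labels \<subseteq> first_missing key ` segments qs"
    proof
      fix l assume "l \<in> labels"
      then consider "l = key \<infinity>" | p where "join_irreducible p" "l = key (Fin p)"
        by (auto simp: labels_def)
      then show "l \<in> first_missing key ` segments qs"
      proof cases
        case 1
        then have "l = first_missing key (segment qs (length qs))"
          using first_missing_segment[OF qs, of "length qs"] by simp
        then show ?thesis by (auto simp: segments_def)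
      next
        case 2
        then obtain i where "i < length qs" "p = qs ! i"
          using qs(1) by (metis in_set_conv_nth linear_extension_def mem_Collect_eq)
        then have "l = first_missing key (segment qs i)" "i \<in> {..length qs}"
          using 2 first_missing_segment[OF qs, of i] by auto
        then show ?thesis by (auto simp: segments_def)
      qed
    qed
    then show "card (first_missing key ` segments qs) = card labels"
      using \<open>first_missing key ` segments qs \<subseteq> labels\<close> by (metis subset_antisym)
  qed simp
  then have c: "class_cochain (segments qs) = (reorder_sign (first_missing key) (segments qs) :: 'k)"
    by (simp add: class_cochain_def label_cochain_def)
  have "canonical_form v k (lift_cochain k v class_cochain)
      = (\<Sum>ps | linear_extension ps. inversion_sign ps * reorder_sign lattice_rank (segments ps)
          * (class_cochain (segments ps) :: 'k))"
    unfolding canonical_form_def using lift_class_cochain(1)[OF assms, where 'k = 'k]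
    by (intro sum.cong refl) simp
  also have "\<dots> = (\<Sum>ps\<in>{qs}. inversion_sign ps * reorder_sign lattice_rank (segments ps)
          * class_cochain (segments ps))"
  proof (rule sum.mono_neutral_right)
    show "\<forall>ps\<in>{ps. linear_extension ps} - {qs}. inversion_sign ps * reorder_sign lattice_rank (segments ps)
          * class_cochain (segments ps) = (0 :: 'k)"
    proof
      fix ps :: "'a list" assume ps: "ps \<in> {ps. linear_extension ps} - {qs}"
      then have "class_cochain (segments ps) = (0 :: 'k)"
        using class_cochain_neq_0D sorted_if_labels unique by blast
      then show "inversion_sign ps * reorder_sign lattice_rank (segments ps)
          * class_cochain (segments ps) = (0 :: 'k)" by simp
    qed
  qed (use qs in auto)
  also have "\<dots> = inversion_sign qs * reorder_sign lattice_rank (segments qs)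
      * reorder_sign (first_missing key) (segments qs)"
    by (simp add: c)
  also have "\<dots> \<noteq> 0"
    using inversion_sign_cases[of qs, where 'k = 'k]
      reorder_sign_cases[of lattice_rank "segments qs", where 'k = 'k]
      reorder_sign_cases[of "first_missing key" "segments qs", where 'k = 'k]
    by auto
  finally show ?thesis .
qed

text \<open>Dropping the label of \<open>p\<close> loses only separations from \<open>p\<close>; the label of \<open>b\<close> provides them for
  every element below \<open>p\<close> other than \<open>b\<close> itself.\<close>

lemma class_coboundary:
  fixes u :: "'a extended \<Rightarrow> int" and f :: "'a set \<Rightarrow> ('a, 'k::field) mpol"
  assumes u: "u \<infinity> = 0" "\<And>p. \<not> join_irreducible p \<Longrightarrow> u (Fin p) = 0" "degree_bound u \<le> k"
    and b: "b \<in> hat_poset" and p: "p \<in> hat_poset" and bp: "b < p" "u b \<le> u p"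
    and last: "\<And>z. z \<in> hat_poset \<Longrightarrow> z < p \<Longrightarrow> z \<noteq> b \<Longrightarrow> key z < key b"
    and f: "\<And>F w. card F = Suc (card {a :: 'a. join_irreducible a}) \<Longrightarrow>
      mcoeff (f F) w = (if w = cochain_deg k u F then class_cochain F else 0)"
  shows "f \<in> coboundaries hibi_ideal (Suc (card {a :: 'a. join_irreducible a})) k"
proof -
  define J where "J = labels - {key p}"
  have p': "p \<in> upper_poset" using p bp(1) unfolding upper_poset_eq by auto
  then have lab: "labels = insert (key p) J" "key p \<notin> J" by (auto simp: J_def labels_def)
  have cardJ: "card J = card {a :: 'a. join_irreducible a}"
  proof -
    have "finite J" by (simp add: J_def)
    then have "card (insert (key p) J) = Suc (card J)" using lab(2) by (rule card_insert_disjoint)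
    then show ?thesis using card_labels by (metis lab(1) nat.inject)
  qed
  \<comment> \<open>The sign of the facet \<open>J\<close> in the simplex on all labels; since
    \<open>s * s = 1\<close>, the coboundary of \<open>c\<close> is the class cochain
    itself.\<close>
  define s :: 'k where "s = (- 1) ^ card {i \<in> J. i < key p}"
  define c :: "'a set \<Rightarrow> 'k" where "c F = s * label_cochain (first_missing key) J F" for F
  have ex: "\<exists>m. mdeg m = cochain_deg k u F" if F: "c F \<noteq> 0" for F
  proof (rule exists_cochain_monomial[OF u], simp_all)
    fix z z' :: "'a extended" assume z: "z \<in> hat_poset" "z' \<in> hat_poset" "z < z'"
    have img: "first_missing key ` F = J" using F by (auto simp: c_def label_cochain_def)
    have key_J: "key y \<in> J" if "y \<in> hat_poset" "y \<noteq> -\<infinity>" "y \<noteq> p" for y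
      using that inj_onD[OF inj_key, of y p] p unfolding J_def labels_def upper_poset_eq by auto
    show "u z \<le> u z' \<or> (\<exists>a\<in>F. ind z a = 1 \<and> ind z' a = 0)"
    proof (cases "z' = p")
      case False
      then have "key z' \<in> J" using z by (intro key_J) auto
      then obtain a where "a \<in> F" "first_missing key a = key z'" using img by auto
      then show ?thesis using separated z by blast
    next
      case True
      show ?thesis
      proof (cases "z = b")
        case False
        then have zb: "key z < key b" using last z True by simp
        \<comment> \<open>The label of \<open>b\<close> exists only if \<open>b\<close> is not -oo.
          If it were, \<open>z\<close> would lie above \<open>b\<close> and be numbered after
          it.\<close>
        have "b \<noteq> -\<infinity>"
        proof
          assume "b = -\<infinity>"
          then have "b < z" using False by (cases z) auto
          then show False using key_mono[OF b z(1)] zb by simp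
        qed
        then have "key b \<in> J" using key_J b bp(1) by blast
        then obtain a where a: "a \<in> F" "first_missing key a = key b" using img by auto
        have "b \<in> upper_poset" using b \<open>b \<noteq> -\<infinity>\<close> unfolding upper_poset_eq by simp
        then have "ind b a = 0" "ind z a = 1" using first_missingD[OF a(2)] z(1) zb by auto
        moreover have "ind p a \<le> ind b a"
          using mdeg_antimono[of b p "Poly_Mapping.single a 1"] b bp(1) by simp
        ultimately have "ind p a = 0" using ind_nonneg[of p a] by linarith
        then show ?thesis using a \<open>ind z a = 1\<close> True by blast
      qed (use True bp in simp)
    qed
  qed
  have "f F - koszul_diff k (lift_cochain k u c) F \<in> hibi_ideal"
    if F: "card F = Suc (card {a :: 'a. join_irreducible a})" for F
    unfolding hibi_ideal_iff
  proof
    fix w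
    have "scalar_diff c F = s * scalar_diff (label_cochain (first_missing key) J) F"
      unfolding scalar_diff_def c_def sum_distrib_left by (intro sum.cong refl mult.left_commute)
    also have "\<dots> = s * (s * label_cochain (first_missing key) (insert (key p) J) F)"
    proof -
      have "first_missing key ` F \<subseteq> insert (key p) J"
        using first_missing_in_labels unfolding lab(1)[symmetric] by blast
      moreover have "finite J" by (simp add: J_def)
      ultimately show ?thesis
        unfolding s_def using F lab(2) by (simp only: scalar_diff_label_cochain cardJ)
    qed
    also have "\<dots> = class_cochain F"
    proof -
      have "s * s = 1" by (simp add: s_def uminus_power_if)
      then show ?thesis unfolding mult.assoc[symmetric] class_cochain_def lab(1) by simp
    qed
    finally have "scalar_diff c F = class_cochain F" .
    then show "mcoeff (f F - koszul_diff k (lift_cochain k u c) F) w = 0"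
      using mcoeff_koszul_diff_scalar[of F "lift_cochain k u c" k u c w] lift_cochain(1)[of c, OF ex]
      by (simp add: f[OF F])
  qed
  then show ?thesis unfolding coboundaries_def by blast
qed

end

section \<open>Consequences of levelness\<close>

lemma homogeneous_monomial_mult:
  fixes p :: "('a::{finite,distrib_lattice}, 'k::field) mpol"
  assumes "homogeneous n p"
  shows "homogeneous (mdeg m (-\<infinity>) + n) (Poly_Mapping.single m c * p)"
proof -
  have "mdeg m' (-\<infinity>) = mdeg m (-\<infinity>) + n"
    if m': "m' \<in> Poly_Mapping.keys (Poly_Mapping.single m c * p)" for m'
  proof -
    obtain m'' where "m' = m + m''" "m'' \<in> Poly_Mapping.keys p"
      using m' keys_mult[of "Poly_Mapping.single m c" p] by (auto split: if_splits)
    then show ?thesis using assms by (simp add: homogeneous_iff_mdeg)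
  qed
  then show ?thesis by (simp add: homogeneous_iff_mdeg)
qed

lemma koszul_diff_mult: "koszul_diff k (\<lambda>F. r * f F) G = r * koszul_diff k f G"
  unfolding koszul_diff_def sum_distrib_left by (intro sum.cong refl) (simp only: mult.left_commute)

lemma monomial_mult_cocycle:
  fixes f :: "'a::{finite,distrib_lattice} set \<Rightarrow> ('a, 'k::field) mpol"
  assumes "f \<in> cocycles hibi_ideal i k n"
  shows "(\<lambda>F. Poly_Mapping.single m c * f F) \<in> cocycles hibi_ideal i k (mdeg m (-\<infinity>) + n)"
  using assms unfolding cocycles_def
  by (auto simp: koszul_diff_mult hibi_ideal_mult add.assoc intro: homogeneous_monomial_mult)

text \<open>Multiplication by the product of the variables is a chain map; it is the transition map
  of the direct system of Koszul complexes.\<close>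

lemma koszul_diff_Suc:
  "koszul_diff (Suc k) (\<lambda>F. (\<Prod>a\<in>F. Var a) * f F) G = (\<Prod>a\<in>G. Var a) * koszul_diff k f G"
  unfolding koszul_diff_def sum_distrib_left
proof (rule sum.cong[OF refl])
  fix a assume "a \<in> G"
  then have eq: "(\<Prod>a\<in>G. Var a) = Var a * (\<Prod>a\<in>G - {a}. Var a)" by (simp add: prod.remove)
  show "(- 1) ^ card {b \<in> G. to_nat b < to_nat a} * Var a ^ Suc k * ((\<Prod>a\<in>G - {a}. Var a) * f (G - {a}))
    = (\<Prod>a\<in>G. Var a) * ((- 1) ^ card {b \<in> G. to_nat b < to_nat a} * Var a ^ k * f (G - {a}))"
    unfolding eq power_Suc by (simp only: ac_simps)
qed

lemma prod_Var_mult_cocycle: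
  fixes f :: "'a::{finite,distrib_lattice} set \<Rightarrow> ('a, 'k::field) mpol"
  assumes "f \<in> cocycles hibi_ideal i k n"
  shows "(\<lambda>F. (\<Prod>a\<in>F. Var a) * f F) \<in> cocycles hibi_ideal i (Suc k) n"
proof -
  have "homogeneous (n + int (i * Suc k)) ((\<Prod>a\<in>F. Var a) * f F)" if F: "card F = i" for F
  proof -
    have "homogeneous (mdeg (\<Sum>a\<in>F. Poly_Mapping.single a 1) (-\<infinity>) + (n + int (i * k)))
        (Poly_Mapping.single (\<Sum>a\<in>F. Poly_Mapping.single a 1) 1 * f F)"
      using assms F by (intro homogeneous_monomial_mult) (auto simp: cocycles_def)
    then show ?thesis unfolding prod_Var[OF finite, symmetric] using F by (simp add: algebra_simps)
  qed
  then show ?thesis using assms unfolding cocycles_def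
    by (auto simp: koszul_diff_Suc hibi_ideal_mult)
qed

lemma local_cohomology_dualD:
  assumes "\<phi> \<in> local_cohomology_dual I i j" "f \<in> cocycles I i k (- j)"
  shows "g \<in> cocycles I i k (- j) \<Longrightarrow> \<phi> k (\<lambda>F. f F + g F) = \<phi> k f + \<phi> k g"
    and "\<phi> k (\<lambda>F. Const c * f F) = c * \<phi> k f"
    and "f \<in> coboundaries I i k \<Longrightarrow> \<phi> k f = 0"
    and "\<phi> (Suc k) (\<lambda>F. (\<Prod>a\<in>F. Var a) * f F) = \<phi> k f"
  using assms(1)[unfolded local_cohomology_dual_def mem_Collect_eq, THEN spec, THEN bspec, OF assms(2)]
  by blast+

lemma local_cohomology_dual_sum:
  fixes f :: "'b \<Rightarrow> 'a::{finite,distrib_lattice} set \<Rightarrow> ('a, 'k::field) mpol"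
  assumes "\<psi> \<in> local_cohomology_dual hibi_ideal i j" "finite X"
    and "\<And>x. x \<in> X \<Longrightarrow> f x \<in> cocycles hibi_ideal i k (- j)"
  shows "(\<lambda>F. \<Sum>x\<in>X. f x F) \<in> cocycles hibi_ideal i k (- j) \<and>
    \<psi> k (\<lambda>F. \<Sum>x\<in>X. f x F) = (\<Sum>x\<in>X. \<psi> k (f x))"
  using assms(2,3)
proof (induction X rule: finite_induct)
  case empty
  have zero: "(\<lambda>F. 0) \<in> cocycles (hibi_ideal :: ('a, 'k) mpol set) i k (- j)"
    by (auto simp: cocycles_def homogeneous_def koszul_diff_def hibi_ideal_0)
  then have "\<psi> k (\<lambda>F. Const 0 * 0) = 0 * \<psi> k (\<lambda>F. 0)"
    by (rule local_cohomology_dualD(2)[OF assms(1)])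
  then show ?case using zero by simp
next
  case (insert x X)
  have add: "(\<lambda>F. g F + h F) \<in> cocycles (hibi_ideal :: ('a, 'k) mpol set) i k (- j)"
    if "g \<in> cocycles hibi_ideal i k (- j)" "h \<in> cocycles hibi_ideal i k (- j)" for g h
  proof -
    have "koszul_diff k (\<lambda>F. g F + h F) G = koszul_diff k g G + koszul_diff k h G" for G
      by (simp add: koszul_diff_def distrib_left sum.distrib)
    moreover have "homogeneous n (p + q)" if "homogeneous n p" "homogeneous n q" for n and p q :: "('a, 'k) mpol"
      using that keys_add[of p q] unfolding homogeneous_def by blast
    ultimately show ?thesis using that unfolding cocycles_def by (auto intro: hibi_ideal_add)
  qed
  have x: "f x \<in> cocycles hibi_ideal i k (- j)" and X: "(\<lambda>F. \<Sum>x\<in>X. f x F) \<in> cocycles hibi_ideal i k (- j)"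
    using insert by auto
  have "\<psi> k (\<lambda>F. f x F + (\<Sum>x\<in>X. f x F)) = \<psi> k (f x) + \<psi> k (\<lambda>F. \<Sum>x\<in>X. f x F)"
    by (rule local_cohomology_dualD(1)[OF assms(1) x X])
  then show ?case using insert add[OF x X] by simp
qed

text \<open>The form of \<open>v\<close> is nonzero on the class cocycle, so some
  \<open>\<psi> l\<close> is nonzero on its multiple by a monomial \<open>m\<close> of
  \<open>r l\<close>. This multiple is then no coboundary at any stage of the direct limit, and the
  contrapositive of \<open>class_coboundary\<close> gives the strict inequalities.\<close>

lemma (in numbering) level_reduction:
  fixes v :: "'a extended \<Rightarrow> int" and e :: int
  defines "I \<equiv> hibi_ideal :: ('a, 'k::field) mpol set"
  defines "d \<equiv> Suc (card {a :: 'a. join_irreducible a})"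
  assumes strict: "\<And>z z'. z \<in> hat_poset \<Longrightarrow> z' \<in> hat_poset \<Longrightarrow> z < z' \<Longrightarrow> v z' < v z"
    and v0: "v \<infinity> = 0" "\<And>p. \<not> join_irreducible p \<Longrightarrow> v (Fin p) = 0"
    and e: "\<forall>j. \<forall>\<phi>\<in>canonical_module I j. \<exists>(n::nat) r \<psi>.
          (\<forall>l<n. homogeneous (j - e) (r l) \<and> \<psi> l \<in> canonical_module I e) \<and>
          (\<forall>k. \<forall>f\<in>cocycles I (quotient_dim I) k (- j). \<phi> k f = (\<Sum>l<n. \<psi> l k (\<lambda>F. r l * f F)))"
  obtains m :: "'a \<Rightarrow>\<^sub>0 nat" where "mdeg m (-\<infinity>) = v (-\<infinity>) - e"
    and "\<And>b p. b \<in> hat_poset \<Longrightarrow> p \<in> hat_poset \<Longrightarrow> b < p \<Longrightarrow>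
      (\<And>z. z \<in> hat_poset \<Longrightarrow> z < p \<Longrightarrow> z \<noteq> b \<Longrightarrow> key z < key b) \<Longrightarrow>
      v p - mdeg m p < v b - mdeg m b"
proof -
  define k where "k = degree_bound v"
  define f :: "'a set \<Rightarrow> ('a, 'k) mpol" where "f = lift_cochain k v class_cochain"
  have dim: "quotient_dim I = d" by (simp add: I_def d_def quotient_dim_hibi_ideal)
  have f: "f \<in> cocycles I d k (- v (-\<infinity>))"
    unfolding f_def I_def d_def using v0 by (intro class_cocycle) (auto simp: k_def)
  have fcoeff: "mcoeff (f F) w = (if w = cochain_deg k v F then class_cochain F else 0)" for F w
    unfolding f_def using v0 by (intro lift_class_cochain) (auto simp: k_def)
  have nz: "canonical_form v k f \<noteq> 0"
    unfolding f_def using v0 by (intro canonical_form_class) (auto simp: k_def)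
  have "canonical_form v \<in> canonical_module I (v (-\<infinity>))"
    unfolding I_def using strict by (rule canonical_form_in_canonical_module)
  note e[THEN spec, THEN bspec, OF this]
  then obtain n :: nat and r \<psi> where
    *: "(\<forall>l<n. homogeneous (v (-\<infinity>) - e) (r l) \<and> \<psi> l \<in> canonical_module I e) \<and>
      (\<forall>k. \<forall>f\<in>cocycles I (quotient_dim I) k (- v (-\<infinity>)). canonical_form v k f = (\<Sum>l<n. \<psi> l k (\<lambda>F. r l * f F)))"
    by (elim exE) (rule that)
  have r: "homogeneous (v (-\<infinity>) - e) (r l)" "\<psi> l \<in> canonical_module I e" if "l < n" for l
    using * that by auto
  have sum: "canonical_form v k f = (\<Sum>l<n. \<psi> l k (\<lambda>F. r l * f F))"
    using * f dim by auto
  have "(\<Sum>l<n. \<psi> l k (\<lambda>F. r l * f F)) \<noteq> 0" using sum nz by simp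
  then obtain l where l: "l < n" "\<psi> l k (\<lambda>F. r l * f F) \<noteq> 0"
    by (metis (no_types, lifting) lessThan_iff sum.neutral)
  define \<chi> where "\<chi> = \<psi> l"
  have \<chi>: "\<chi> \<in> local_cohomology_dual I d e" using r(2)[OF l(1)] by (simp add: \<chi>_def canonical_module_def dim)
  let ?f = "\<lambda>m F. Poly_Mapping.single m (Poly_Mapping.lookup (r l) m) * f F"
  have deg: "mdeg m (-\<infinity>) = v (-\<infinity>) - e" if "m \<in> Poly_Mapping.keys (r l)" for m
    using r(1)[OF l(1)] that by (simp add: homogeneous_iff_mdeg)
  have cocyc: "?f m \<in> cocycles I d k (- e)" if "m \<in> Poly_Mapping.keys (r l)" for m
    using monomial_mult_cocycle[OF f[unfolded I_def], of m "Poly_Mapping.lookup (r l) m"] deg[OF that]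
    by (simp add: I_def)
  have "(\<lambda>F. r l * f F) = (\<lambda>F. \<Sum>m\<in>Poly_Mapping.keys (r l). ?f m F)"
    by (simp add: sum_monomials flip: sum_distrib_right)
  then have "\<chi> k (\<lambda>F. r l * f F) = (\<Sum>m\<in>Poly_Mapping.keys (r l). \<chi> k (?f m))"
    using local_cohomology_dual_sum[OF \<chi>[unfolded I_def] finite_keys, of "r l" ?f k] cocyc
    by (simp add: I_def)
  then obtain m where m: "m \<in> Poly_Mapping.keys (r l)" "\<chi> k (?f m) \<noteq> 0"
    using l(2) unfolding \<chi>_def by (metis (no_types, lifting) sum.neutral)
  define c where "c = Poly_Mapping.lookup (r l) m"
  have c: "c \<noteq> 0" using m(1) by (simp add: c_def in_keys_iff)
  define u where "u z = v z - mdeg m z" for z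
  \<comment> \<open>The image of the multiple by \<open>m\<close> under \<open>t\<close> transition
    maps. The exponent has to grow because \<open>k\<close> was chosen for \<open>v\<close>, while
    \<open>class_coboundary\<close> asks for at least \<open>degree_bound u\<close>.\<close>
  define g :: "nat \<Rightarrow> 'a set \<Rightarrow> ('a, 'k) mpol" where
    "g t F = (\<Prod>a\<in>F. Var a) ^ t * (Poly_Mapping.single m 1 * f F)" for t F
  have "g 0 = (\<lambda>F. Poly_Mapping.single m 1 * f F)" by (simp add: g_def fun_eq_iff)
  then have g0: "g 0 \<in> cocycles I d k (- e)"
    using monomial_mult_cocycle[OF f[unfolded I_def], of m 1] deg[OF m(1)] by (simp add: I_def)
  have gSuc: "g (Suc t) = (\<lambda>F. (\<Prod>a\<in>F. Var a) * g t F)" for t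
    by (rule ext) (simp only: g_def power_Suc mult.assoc)
  have g: "g t \<in> cocycles I d (k + t) (- e)" for t
  proof (induction t)
    case (Suc t)
    then show ?case unfolding gSuc I_def using prod_Var_mult_cocycle by fastforce
  qed (simp add: g0)
  have "\<chi> (k + t) (g t) \<noteq> 0" for t
  proof (induction t)
    case 0
    have "\<chi> k (\<lambda>F. Const c * g 0 F) = c * \<chi> k (g 0)"
      by (rule local_cohomology_dualD(2)[OF \<chi> g0])
    moreover have "(\<lambda>F. Const c * g 0 F) = ?f m"
      by (simp add: g_def Const_def mult.assoc[symmetric] mult_single c_def)
    ultimately show ?case using m(2) by auto
  next
    case (Suc t)
    have "\<chi> (Suc (k + t)) (\<lambda>F. (\<Prod>a\<in>F. Var a) * g t F) = \<chi> (k + t) (g t)"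
      by (rule local_cohomology_dualD(4)[OF \<chi> g])
    then show ?case using Suc by (simp add: gSuc)
  qed
  then have not_coboundary: "g t \<notin> coboundaries I d (k + t)" for t
    using local_cohomology_dualD(3)[OF \<chi> g] by blast
  have gcoeff: "mcoeff (g t F) w = (if w = cochain_deg (k + t) u F then class_cochain F else 0)" for t F w
  proof (induction t arbitrary: w)
    case 0
    have "(\<lambda>z. w z - mdeg m z) = cochain_deg k v F \<longleftrightarrow> w = cochain_deg k u F"
      by (auto simp: fun_eq_iff cochain_deg_def u_def algebra_simps)
    then show ?case by (simp add: g_def mcoeff_single_mult fcoeff)
  next
    case (Suc t)
    have "(\<lambda>z. w z - (\<Sum>a\<in>F. ind z a)) = cochain_deg (k + t) u F \<longleftrightarrow> w = cochain_deg (k + Suc t) u F"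
      by (auto simp: fun_eq_iff cochain_deg_def algebra_simps)
    then show ?case by (simp add: gSuc prod_Var[OF finite] mcoeff_single_mult Suc)
  qed
  show ?thesis
  proof (rule that)
    show "mdeg m (-\<infinity>) = v (-\<infinity>) - e" using deg m(1) by simp
    fix b p :: "'a extended" assume bp: "b \<in> hat_poset" "p \<in> hat_poset" "b < p"
      and last: "\<And>z. z \<in> hat_poset \<Longrightarrow> z < p \<Longrightarrow> z \<noteq> b \<Longrightarrow> key z < key b"
    show "v p - mdeg m p < v b - mdeg m b"
    proof (rule ccontr)
      assume "\<not> ?thesis"
      then have ub: "u b \<le> u p" by (simp add: u_def)
      have u0: "u \<infinity> = 0" "\<And>p. \<not> join_irreducible p \<Longrightarrow> u (Fin p) = 0" using v0 by (simp_all add: u_def)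
      have "g (degree_bound u) \<in> coboundaries I d (k + degree_bound u)"
        unfolding I_def d_def
        by (rule class_coboundary[OF u0 _ bp ub last gcoeff]) simp_all
      then show False using not_coboundary by blast
    qed
  qed
qed

section \<open>Heights and depths\<close>

text \<open>Instantiated with both the order and the dual order of \<open>hat P\<close>.\<close>

locale chain_length =
  fixes A :: "'b set" and R :: "'b \<Rightarrow> 'b \<Rightarrow> bool" and L :: "'b \<Rightarrow> nat"
  assumes finite_A: "finite A"
    and refl: "\<And>a. R a a" and trans: "\<And>a b c. R a b \<Longrightarrow> R b c \<Longrightarrow> R a c"
    and antisym: "\<And>a b. R a b \<Longrightarrow> R b a \<Longrightarrow> a = b"
    and L_def: "\<And>z. L z = Max {card C - 1 | C. C \<subseteq> A \<and> Complete_Partial_Order.chain R C \<and> z \<in> C \<and> (\<forall>c\<in>C. R c z)}"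
begin

lemma finite_lengths: "finite {card C - 1 | C. C \<subseteq> A \<and> Complete_Partial_Order.chain R C \<and> z \<in> C \<and> (\<forall>c\<in>C. R c z)}"
  by (rule finite_subset[of _ "(\<lambda>C. card C - 1) ` Pow A"]) (auto simp: finite_A)

lemma L_ge: "C \<subseteq> A \<Longrightarrow> Complete_Partial_Order.chain R C \<Longrightarrow> z \<in> C \<Longrightarrow> (\<And>c. c \<in> C \<Longrightarrow> R c z) \<Longrightarrow> card C - 1 \<le> L z"
  unfolding L_def by (rule Max_ge[OF finite_lengths]) blast

lemma obtain_chain:
  assumes "z \<in> A"
  obtains C where "C \<subseteq> A" "Complete_Partial_Order.chain R C" "z \<in> C" "\<And>c. c \<in> C \<Longrightarrow> R c z" "card C = Suc (L z)"
proof -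
  let ?S = "{card C - 1 | C. C \<subseteq> A \<and> Complete_Partial_Order.chain R C \<and> z \<in> C \<and> (\<forall>c\<in>C. R c z)}"
  have "card {z} - 1 \<in> ?S" using assms refl by (auto simp: chain_def intro!: exI[of _ "{z}"])
  then have "L z \<in> ?S" unfolding L_def by (intro Max_in finite_lengths) blast
  then obtain C where C: "L z = card C - 1" "C \<subseteq> A" "Complete_Partial_Order.chain R C" "z \<in> C" "\<forall>c\<in>C. R c z"
    by blast
  then have "card C > 0" using finite_subset[OF C(2) finite_A] by (auto simp: card_gt_0_iff)
  then show thesis using that C by auto
qed

lemma L_less:
  assumes "z \<in> A" "z' \<in> A" "R z z'" "z \<noteq> z'"
  shows "L z < L z'"
proof -
  obtain C where C: "C \<subseteq> A" "Complete_Partial_Order.chain R C" "z \<in> C" "\<And>c. c \<in> C \<Longrightarrow> R c z" "card C = Suc (L z)"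
    using obtain_chain[OF assms(1)] by blast
  have "z' \<notin> C" using C(4) antisym assms by blast
  then have "card (insert z' C) - 1 = Suc (L z)"
    using C(5) finite_subset[OF C(1) finite_A] by simp
  moreover have "R c z'" if "c \<in> C" for c using trans[OF C(4)[OF that] assms(3)] .
  then have "card (insert z' C) - 1 \<le> L z'"
    by (intro L_ge) (use C(1,2) assms(2) refl in \<open>auto simp: chain_def\<close>)
  ultimately show ?thesis by simp
qed

lemma L_pred:
  assumes "z \<in> A" "0 < L z"
  shows "\<exists>z'\<in>A. R z' z \<and> z' \<noteq> z \<and> L z = Suc (L z')"
proof -
  obtain C where C: "C \<subseteq> A" "Complete_Partial_Order.chain R C" "z \<in> C" "\<And>c. c \<in> C \<Longrightarrow> R c z" "card C = Suc (L z)"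
    using obtain_chain[OF assms(1)] by blast
  let ?B = "C - {z}"
  have B: "finite ?B" "card ?B = L z" using C finite_subset[OF C(1) finite_A] by auto
  then have "?B \<noteq> {}" using assms(2) by (metis card.empty less_irrefl)
  have "\<exists>y\<in>B. \<forall>b\<in>B. R b y" if "finite B" "B \<noteq> {}" "B \<subseteq> C" for B
    using that
  proof (induction B rule: finite_ne_induct)
    case (insert b B)
    then obtain y where "y \<in> B" "\<forall>b\<in>B. R b y" by blast
    moreover have "R b y \<or> R y b" using insert C(2) \<open>y \<in> B\<close> by (auto simp: chain_def)
    ultimately show ?case using trans refl by blast
  qed (auto simp: refl)
  then obtain y where y: "y \<in> ?B" "\<forall>b\<in>?B. R b y" using B \<open>?B \<noteq> {}\<close> by blast
  have "card ?B - 1 \<le> L y"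
    by (rule L_ge) (use C y in \<open>auto simp: chain_def\<close>)
  moreover have "L y < L z" using y C by (intro L_less) auto
  ultimately have "L z = Suc (L y)" using B by simp
  then show ?thesis using y C by blast
qed

lemma obtain_longest_chain:
  assumes "z \<in> A" "L z = h"
  shows "\<exists>c. c h = z \<and> (\<forall>i\<le>h. c i \<in> A \<and> L (c i) = i) \<and> (\<forall>j\<le>h. \<forall>i<j. R (c i) (c j) \<and> c i \<noteq> c j)"
  using assms
proof (induction h arbitrary: z)
  case 0
  then show ?case by (intro exI[of _ "\<lambda>_. z"]) auto
next
  case (Suc h)
  obtain z' where z': "z' \<in> A" "R z' z" "z' \<noteq> z" "L z = Suc (L z')" using L_pred[of z] Suc.prems by auto
  obtain c where c: "c h = z'" "\<forall>i\<le>h. c i \<in> A \<and> L (c i) = i" "\<forall>j\<le>h. \<forall>i<j. R (c i) (c j) \<and> c i \<noteq> c j"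
    using Suc.IH[OF z'(1)] z'(4) Suc.prems(2) by auto
  have "R (c i) z \<and> c i \<noteq> z" if "i \<le> h" for i
  proof -
    have "R (c i) z'" using c that refl by (cases "i = h") auto
    then show ?thesis using z' trans antisym by blast
  qed
  then show ?case using c Suc.prems
    by (intro exI[of _ "c(Suc h := z)"]) (auto simp: le_Suc_eq)
qed

end

lemma finite_hat: "finite (hat (P :: 'a::{finite,order} set))"
  by (simp add: hat_def)

lemma chain_ge: "Complete_Partial_Order.chain (\<le>) C = Complete_Partial_Order.chain (\<lambda>a b. b \<le> (a :: 'b::order)) C"
  by (auto simp: chain_def)

interpretation height: chain_length "hat P" "(\<le>)" "height_hat P" for P :: "'a::{finite,order} set"
  by unfold_locales (auto simp: finite_hat height_hat_def hat_chain_def conj_assoc)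

interpretation depth: chain_length "hat P" "\<lambda>a b. b \<le> a" "depth_hat P" for P :: "'a::{finite,order} set"
  by unfold_locales (auto simp: finite_hat depth_hat_def hat_chain_def conj_assoc chain_ge)

text \<open>Longest chains below and above \<open>z\<close> meet only in \<open>z\<close>, and their
  union is a chain.\<close>

lemma height_plus_depth_le_rank:
  fixes P :: "'a::{finite,order} set"
  assumes "z \<in> hat P"
  shows "height_hat P z + depth_hat P z \<le> rank_hat P"
proof -
  obtain C where C: "C \<subseteq> hat P" "Complete_Partial_Order.chain (\<le>) C" "z \<in> C" "\<And>c. c \<in> C \<Longrightarrow> c \<le> z"
    "card C = Suc (height_hat P z)" using height.obtain_chain[OF assms] by blast
  obtain D where D: "D \<subseteq> hat P" "Complete_Partial_Order.chain (\<lambda>a b. b \<le> a) D" "z \<in> D" "\<And>c. c \<in> D \<Longrightarrow> z \<le> c"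
    "card D = Suc (depth_hat P z)" using depth.obtain_chain[OF assms] by blast
  have "C \<inter> D = {z}" using C D by (auto intro: order.antisym)
  then have "card (C \<union> D) = Suc (height_hat P z + depth_hat P z)"
    using card_Un_Int[of C D] C D finite_subset[OF _ finite_hat] by fastforce
  moreover have "hat_chain P (C \<union> D)"
  proof -
    have "c \<le> d" if "c \<in> C" "d \<in> D" for c d using C(4) D(4) that order.trans by blast
    then show ?thesis using C D by (auto simp: hat_chain_def chain_def)
  qed
  moreover have "finite {card C - 1 | C. hat_chain P C}"
    by (rule finite_subset[of _ "(\<lambda>C. card C - 1) ` Pow (hat P)"]) (auto simp: finite_hat hat_chain_def)
  ultimately show ?thesis unfolding rank_hat_def by (intro Max_ge) (auto intro!: exI[of _ "C \<union> D"])
qed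

lemma height_less: "z \<in> hat P \<Longrightarrow> z' \<in> hat P \<Longrightarrow> z < z' \<Longrightarrow> height_hat P z < height_hat P z'"
  for P :: "'a::{finite,order} set"
  by (intro height.L_less) auto

lemma depth_less: "z \<in> hat P \<Longrightarrow> z' \<in> hat P \<Longrightarrow> z < z' \<Longrightarrow> depth_hat P z' < depth_hat P z"
  for P :: "'a::{finite,order} set"
  by (intro depth.L_less) auto

lemma height_eq_0: "z \<in> hat P \<Longrightarrow> height_hat P z = 0 \<Longrightarrow> z = -\<infinity>"
  for P :: "'a::{finite,order} set"
  using height_less[of "-\<infinity>" P z] by (cases z) (auto simp: hat_def)

lemma depth_eq_0: "z \<in> hat P \<Longrightarrow> depth_hat P z = 0 \<Longrightarrow> z = \<infinity>"
  for P :: "'a::{finite,order} set"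
  using depth_less[of z P \<infinity>] by (cases z) (auto simp: hat_def)

lemma depth_Pinf: "depth_hat P \<infinity> = 0"
  for P :: "'a::{finite,order} set"
  using depth.L_pred[of \<infinity> P] by (auto simp: hat_def)

text \<open>\<open>c\<close> runs along a longest chain from -oo to \<open>x\<close>, and
  \<open>d\<close> along one from \<open>y\<close> to oo. Elements not above \<open>y\<close> are
  ordered by height, elements above \<open>y\<close> essentially by depth, shifted so that
  \<open>y\<close> gets the level of the last element of \<open>c\<close> before \<open>x\<close>.
  Within a level, elements of the chains come last.\<close>

lemma exists_adapted_numbering:
  fixes x y :: "'a::{finite,distrib_lattice}"
  defines "P \<equiv> {a :: 'a. join_irreducible a}"
  assumes cover: "covers_in P x y"
    and large: "rank_hat P + 1 < height_hat P (Fin x) + depth_hat P (Fin y)"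
  obtains key c d where "numbering key"
    and "c (height_hat P (Fin x)) = Fin x" "c 0 = -\<infinity>" "d 0 = Fin y" "d (depth_hat P (Fin y)) = \<infinity>"
    and "\<And>i. i < height_hat P (Fin x) \<Longrightarrow> c i \<in> hat P \<and> c (Suc i) \<in> hat P \<and> c i < c (Suc i) \<and>
      (\<forall>z\<in>hat P. z < c (Suc i) \<longrightarrow> z \<noteq> c i \<longrightarrow> key z < key (c i))"
    and "\<And>j. j < depth_hat P (Fin y) \<Longrightarrow> d j \<in> hat P \<and> d (Suc j) \<in> hat P \<and> d j < d (Suc j) \<and>
      (\<forall>z\<in>hat P. z < d (Suc j) \<longrightarrow> z \<noteq> d j \<longrightarrow> key z < key (d j))"
proof -
  let ?H = "height_hat P" and ?D = "depth_hat P"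
  define h s where "h = ?H (Fin x)" and "s = ?D (Fin y)"
  have large: "rank_hat P + 1 < h + s" using large by (simp add: h_def s_def)
  have xy: "Fin x \<in> hat P" "Fin y \<in> hat P" "Fin y < Fin x" using cover by (auto simp: covers_in_def hat_def)
  have between: False if "z \<in> hat P" "Fin y < z" "z < Fin x" for z
    using that cover by (cases z) (auto simp: covers_in_def hat_def)
  have rank: "?H z + ?D z \<le> rank_hat P" if "z \<in> hat P" for z
    using height_plus_depth_le_rank[OF that] .
  obtain c where c: "c h = Fin x" "\<forall>i\<le>h. c i \<in> hat P \<and> ?H (c i) = i"
      "\<forall>j\<le>h. \<forall>i<j. c i \<le> c j \<and> c i \<noteq> c j"
    using height.obtain_longest_chain[OF xy(1)] h_def by metis
  obtain d' where d': "d' s = Fin y" "\<forall>i\<le>s. d' i \<in> hat P \<and> ?D (d' i) = i"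
      "\<forall>j\<le>s. \<forall>i<j. d' j \<le> d' i \<and> d' i \<noteq> d' j"
    using depth.obtain_longest_chain[OF xy(2)] s_def by metis
  define d where "d j = d' (s - j)" for j
  have d: "d 0 = Fin y" "d j \<in> hat P \<and> ?D (d j) = s - j" for j
    using d'(1,2) by (auto simp: d_def)
  have d_less: "d i < d j" if "i < j" "j \<le> s" for i j
  proof -
    have "s - j < s - i" using that by linarith
    then have "d' (s - i) \<le> d' (s - j)" "d' (s - j) \<noteq> d' (s - i)"
      using d'(3)[rule_format, of "s - i" "s - j"] by simp_all
    then show ?thesis unfolding d_def by (metis order.not_eq_order_implies_strict)
  qed
  have c_less: "c i < c j" if "i < j" "j \<le> h" for i j
    using c(3) that by (metis order.not_eq_order_implies_strict)
  have c_hat: "c i \<in> hat P" "?H (c i) = i" if "i \<le> h" for i using c(2) that by auto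
  have y_le_d: "Fin y \<le> d j" if "j \<le> s" for j
    using d(1) d_less[of 0 j] that by (cases "j = 0") (auto intro: order.strict_implies_order)
  \<comment> \<open>Here \<open>large\<close> enters: the height of \<open>d j\<close> stays below
    the level \<open>h - 1 + j\<close>, so on the chain \<open>d\<close> the depth term decides the
    maximum in \<open>\<kappa>\<close>.\<close>
  have H_d: "?H (d j) + 2 \<le> h + j" if "j \<le> s" for j
    using rank[of "d j"] d(2)[of j] large that by auto
  have y_c: "\<not> Fin y \<le> c i" if "i < h" for i
  proof
    assume le: "Fin y \<le> c i"
    have "c i < Fin x" using c_less[OF that] c(1) by simp
    then have eq: "c i = Fin y" using between[of "c i"] le c_hat that by (auto simp: order.order_iff_strict)
    then have "Suc i < h" using c_hat(2)[of i] H_d[of 0] d(1) that by simp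
    then have "Fin y < c (Suc i)" "c (Suc i) < Fin x" "c (Suc i) \<in> hat P"
      using c_less[of i "Suc i"] c_less[of "Suc i" h] c(1) eq c_hat by auto
    then show False using between by blast
  qed
  \<comment> \<open>The maximum with the height keeps \<open>\<kappa>\<close> strictly increasing on
    passing from elements not above \<open>y\<close> to elements above it. The constant
    \<open>h + s - 1\<close> gives \<open>y\<close>, of depth \<open>s\<close>, the level
    \<open>h - 1\<close>.\<close>
  define \<kappa> where "\<kappa> z = (if Fin y \<le> z then max (?H z) (h + s - 1 - ?D z) else ?H z)" for z
  \<comment> \<open>\<open>d 0 = Fin y\<close> stays unflagged: it lies below \<open>x = c h\<close>
    and has to precede \<open>c (h - 1)\<close>, whose level it shares.\<close>
  define flag :: "'a extended \<Rightarrow> nat" where "flag z = of_bool (z \<in> c ` {..<h} \<union> d ` {1..s})" for z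
  have flag_le: "flag z \<le> 1" for z by (simp add: flag_def)
  obtain key :: "'a extended \<Rightarrow> nat" where key: "inj key" "\<And>a b. 2 * \<kappa> a + flag a < 2 * \<kappa> b + flag b \<Longrightarrow> key a < key b"
    using exists_injective_refinement[of "\<lambda>a. 2 * \<kappa> a + flag a"] by blast
  have key1: "key a < key b" if "\<kappa> a < \<kappa> b" for a b
    using key(2)[of a b] flag_le[of a] that by linarith
  have key2: "key a < key b" if "\<kappa> a \<le> \<kappa> b" "flag a = 0" "flag b = 1" for a b
    using key(2)[of a b] that by linarith
  have D_le: "?D z \<le> s" "?D z = s \<Longrightarrow> z = Fin y" if "z \<in> hat P" "Fin y \<le> z" for z
    using that depth_less[OF xy(2), of z] by (auto simp: s_def order.order_iff_strict)
  have h0: "0 < h" using height_eq_0[OF xy(1)] by (auto simp: h_def)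
  have s0: "0 < s" using depth_eq_0[OF xy(2)] by (auto simp: s_def)
  have \<kappa>_mono: "\<kappa> z < \<kappa> z'" if z: "z \<in> hat P" "z' \<in> hat P" "z < z'" for z z'
  proof -
    have H: "?H z < ?H z'" and D: "?D z' < ?D z" using height_less depth_less z by auto
    show ?thesis
    proof (cases "Fin y \<le> z")
      case True
      then have y: "Fin y \<le> z'" using z by auto
      have "h + s - 1 - ?D z < h + s - 1 - ?D z'" using D D_le(1)[OF z(1) True] h0 by linarith
      then show ?thesis using True y H by (auto simp: \<kappa>_def)
    qed (use H in \<open>auto simp: \<kappa>_def\<close>)
  qed
  have \<kappa>_c: "\<kappa> (c i) = i" if "i < h" for i using y_c[OF that] c_hat[of i] that by (simp add: \<kappa>_def)
  have \<kappa>_d: "\<kappa> (d j) = h - 1 + j" if "j \<le> s" for j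
    using y_le_d[OF that] H_d[OF that] d(2)[of j] that h0 by (auto simp: \<kappa>_def)
  have flag_c: "flag (c i) = 1" if "i < h" for i using that by (simp add: flag_def)
  have flag_d: "flag (d j) = 1" if "0 < j" "j \<le> s" for j using that by (simp add: flag_def)
  have flag_c0: "z = c (?H z)" if "flag z \<noteq> 0" "\<not> Fin y \<le> z" for z
    using that y_le_d c_hat by (auto simp: flag_def split: if_splits)
  have flag_d0: "\<exists>j\<le>s. 0 < j \<and> z = d j" if "flag z \<noteq> 0" "Fin y \<le> z" for z
    using that y_c by (auto simp: flag_def split: if_splits)
  have c_last: "key z < key (c i)" if i: "i < h" and z: "z \<in> hat P" "z < c (Suc i)" "z \<noteq> c i" for i z
  proof (cases "Fin y \<le> z")
    case False
    have "?H z \<le> i" using height_less[OF z(1) _ z(2)] c_hat[of "Suc i"] i by simp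
    then have \<kappa>: "\<kappa> z \<le> \<kappa> (c i)" using False \<kappa>_c[OF i] by (simp add: \<kappa>_def)
    show ?thesis
    proof (cases "\<kappa> z = \<kappa> (c i)")
      case True
      then have "?H z = i" using False \<kappa>_c[OF i] by (simp add: \<kappa>_def)
      then have "flag z = 0" using flag_c0[of z] False z(3) by auto
      then show ?thesis using key2 \<kappa> flag_c[OF i] by blast
    qed (use key1 \<kappa> in auto)
  next
    case True
    \<comment> \<open>Among the \<open>c\<close> only \<open>x\<close> lies above \<open>y\<close>,
      and since \<open>x\<close> covers \<open>y\<close>, the element \<open>z\<close> must be
      \<open>y\<close> itself.\<close>
    then have "Fin y \<le> c (Suc i)" using z(2) by (metis order.strict_implies_order order.trans)
    then have "Suc i = h" using y_c[of "Suc i"] i by (metis Suc_lessI)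
    then have "z = Fin y" using between[of z] z True c(1) by (auto simp: order.order_iff_strict)
    moreover have "flag (Fin y) = 0"
    proof (rule ccontr)
      assume "flag (Fin y) \<noteq> 0"
      then obtain j where "j \<le> s" "0 < j" "Fin y = d j" using flag_d0 by blast
      then show False using d(1) d_less[of 0 j] by simp
    qed
    moreover have "\<kappa> (Fin y) = \<kappa> (c i)" using \<kappa>_d[of 0] d(1) \<kappa>_c[OF i] \<open>Suc i = h\<close> by auto
    ultimately show ?thesis using key2[of z "c i"] flag_c[OF i] by simp
  qed
  have d_last: "key z < key (d j)" if j: "j < s" and z: "z \<in> hat P" "z < d (Suc j)" "z \<noteq> d j" for j z
  proof -
    have Hz: "?H z < ?H (d (Suc j))" "?D (d (Suc j)) < ?D z"
      using height_less[OF z(1) _ z(2)] depth_less[OF z(1) _ z(2)] d(2)[of "Suc j"] j by auto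
    then have H: "?H z < h - 1 + j" using H_d[of "Suc j"] j h0 by linarith
    have \<kappa>j: "\<kappa> (d j) = h - 1 + j" using \<kappa>_d j by simp
    show ?thesis
    proof (cases "Fin y \<le> z")
      case False
      then show ?thesis using H \<kappa>j by (intro key1) (simp add: \<kappa>_def)
    next
      case True
      have "s - j \<le> ?D z" using Hz(2) d(2)[of "Suc j"] j by auto
      then have \<kappa>: "\<kappa> z \<le> \<kappa> (d j)" using True H \<kappa>j j by (simp add: \<kappa>_def)
      show ?thesis
      proof (cases "\<kappa> z = \<kappa> (d j)")
        case eq: True
        then have Dz: "?D z = s - j" using True H \<kappa>j j h0 \<open>s - j \<le> ?D z\<close>
          by (simp add: \<kappa>_def max_def split: if_splits)
        then have "j \<noteq> 0" using D_le(2)[OF z(1) True] z(3) d(1) by (cases j) auto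
        moreover have "flag z = 0"
        proof (rule ccontr)
          assume "flag z \<noteq> 0"
          then obtain j' where j': "j' \<le> s" "z = d j'" using flag_d0 True by blast
          then have "j' = j" using Dz d(2)[of j'] j by auto
          then show False using j' z(3) by simp
        qed
        ultimately show ?thesis using key2 \<kappa> flag_d[of j] j by simp
      qed (use key1 \<kappa> in auto)
    qed
  qed
  show thesis
  proof (rule that[of key c d])
    show "numbering key"
      using key(1) \<kappa>_mono key1 unfolding numbering_def P_def by (auto simp: inj_on_def)
    show "c (?H (Fin x)) = Fin x" using c(1) by (simp add: h_def)
    show "c 0 = -\<infinity>" using c_hat[of 0] height_eq_0 by blast
    show "d 0 = Fin y" by (rule d)
    show "d (?D (Fin y)) = \<infinity>" using d(2)[of s] depth_eq_0[of "d s" P] by (simp add: s_def)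
  next
    fix i assume "i < ?H (Fin x)"
    then have "i < h" by (simp add: h_def)
    then show "c i \<in> hat P \<and> c (Suc i) \<in> hat P \<and> c i < c (Suc i) \<and>
      (\<forall>z\<in>hat P. z < c (Suc i) \<longrightarrow> z \<noteq> c i \<longrightarrow> key z < key (c i))"
      using c_hat c_less c_last by auto
  next
    fix j assume "j < ?D (Fin y)"
    then have "j < s" by (simp add: s_def)
    then show "d j \<in> hat P \<and> d (Suc j) \<in> hat P \<and> d j < d (Suc j) \<and>
      (\<forall>z\<in>hat P. z < d (Suc j) \<longrightarrow> z \<noteq> d j \<longrightarrow> key z < key (d j))"
      using d(2) d_less[of j "Suc j"] d_last by auto
  qed
qed

text \<open>The depth is strict but may drop by more than one from \<open>y\<close> to
  \<open>x\<close>. Adding the depth of \<open>y\<close> to every element below \<open>x\<close>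
  other than \<open>y\<close> makes room for raising the value at \<open>x\<close> to one below that
  of \<open>y\<close>; no element strictly between the two obstructs this.\<close>

lemma exists_tight_strict_map:
  fixes x y :: "'a::{finite,distrib_lattice}"
  defines "P \<equiv> {a :: 'a. join_irreducible a}"
  assumes cover: "covers_in P x y"
  obtains v :: "'a extended \<Rightarrow> int" where
    "\<And>z z'. z \<in> hat P \<Longrightarrow> z' \<in> hat P \<Longrightarrow> z < z' \<Longrightarrow> v z' < v z"
    "v \<infinity> = 0" "\<And>p. p \<notin> P \<Longrightarrow> v (Fin p) = 0" "v (Fin y) = v (Fin x) + 1"
proof -
  let ?D = "\<lambda>z. int (depth_hat P z)"
  define v where "v z = (if z \<notin> hat P then 0 else if z = Fin x then ?D (Fin y) - 1
    else if z = Fin y then ?D (Fin y) else if z < Fin x then ?D z + ?D (Fin y) else ?D z)" for z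
  have xy: "Fin x \<in> hat P" "Fin y \<in> hat P" "Fin y < Fin x" "Fin x \<noteq> Fin y"
    using cover by (auto simp: covers_in_def hat_def)
  have between: False if "z \<in> hat P" "Fin y < z" "z < Fin x" for z
    using that cover by (cases z) (auto simp: covers_in_def hat_def)
  have D: "?D z' < ?D z" if "z \<in> hat P" "z' \<in> hat P" "z < z'" for z z'
    using depth_less that by auto
  show thesis
  proof (rule that[of v])
    fix z z' assume z: "z \<in> hat P" "z' \<in> hat P" "z < z'"
    note D[OF z] D[OF xy(2,1,3)]
    consider "z' = Fin x" | "z' = Fin y" "z < Fin x" "z \<noteq> Fin y" | "z' < Fin x" "z' \<noteq> Fin y" "z < Fin x" "z \<noteq> Fin y"
      | "\<not> z' < Fin x" "z' \<noteq> Fin x" "z' \<noteq> Fin y"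
      using z xy between[of z'] by (metis order.strict_trans order.strict_iff_order)
    then show "v z' < v z"
    proof cases
      case 1
      then show ?thesis using z xy D[OF z] by (auto simp: v_def)
    next
      case 2
      then show ?thesis using z xy D[OF z] by (auto simp: v_def)
    next
      case 3
      then show ?thesis using z xy D[OF z] by (auto simp: v_def)
    next
      case 4
      then show ?thesis using z xy D[OF z] D[OF xy(2,1,3)] by (auto simp: v_def)
    qed
  qed (use xy in \<open>auto simp: v_def hat_def depth_Pinf\<close>)
qed

theorem theorem4p1:
  fixes P :: "'a::{finite,distrib_lattice} set"
  defines "P \<equiv> {\<alpha>. join_irreducible \<alpha>}"
  assumes level: "level_algebra (hibi_ideal :: ('a, 'k::field) mpol set)"
    and cover: "covers_in P x y"
  shows "height_hat P (Fin x) + depth_hat P (Fin y) \<le> rank_hat P + 1"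
proof (rule ccontr)
  define h s where "h = height_hat P (Fin x)" and "s = depth_hat P (Fin y)"
  assume "\<not> ?thesis"
  then have large: "rank_hat P + 1 < h + s" by (simp add: h_def s_def)
  obtain key c d where "numbering key"
    and c0: "c h = Fin x" "c 0 = -\<infinity>" and d0: "d 0 = Fin y" "d s = \<infinity>"
    and c: "\<And>i. i < h \<Longrightarrow> c i \<in> hat P \<and> c (Suc i) \<in> hat P \<and> c i < c (Suc i) \<and>
      (\<forall>z\<in>hat P. z < c (Suc i) \<longrightarrow> z \<noteq> c i \<longrightarrow> key z < key (c i))"
    and d: "\<And>j. j < s \<Longrightarrow> d j \<in> hat P \<and> d (Suc j) \<in> hat P \<and> d j < d (Suc j) \<and>
      (\<forall>z\<in>hat P. z < d (Suc j) \<longrightarrow> z \<noteq> d j \<longrightarrow> key z < key (d j))"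
    by (rule exists_adapted_numbering[OF cover[unfolded P_def], folded P_def, folded h_def s_def, OF large])
      (rule that)
  then interpret numbering key by simp
  obtain e where e: "\<forall>j. \<forall>\<phi>\<in>canonical_module hibi_ideal j. \<exists>(n::nat) (r :: nat \<Rightarrow> ('a, 'k) mpol) \<psi>.
      (\<forall>l<n. homogeneous (j - e) (r l) \<and> \<psi> l \<in> canonical_module hibi_ideal e) \<and>
      (\<forall>k. \<forall>f\<in>cocycles hibi_ideal (quotient_dim (hibi_ideal :: ('a, 'k) mpol set)) k (- j).
        \<phi> k f = (\<Sum>l<n. \<psi> l k (\<lambda>F. r l * f F)))"
    using level unfolding level_algebra_def by (elim exE)
  \<comment> \<open>The depth has value at most the rank at -oo. As \<open>m\<close> has nonnegative
    degree \<open>v0 (-\<infinity>) - e\<close>, this bounds \<open>e\<close>.\<close>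
  define v0 where "v0 z = (if z \<in> hat P then int (depth_hat P z) else 0)" for z
  have "e \<le> int (rank_hat P)"
  proof -
    obtain m :: "'a \<Rightarrow>\<^sub>0 nat" where "mdeg m (-\<infinity>) = v0 (-\<infinity>) - e"
      by (rule level_reduction[OF _ _ _ e, of v0])
        (auto simp: v0_def P_def depth_less depth_Pinf hat_def)
    moreover have "depth_hat P (-\<infinity>) \<le> rank_hat P"
      using height_plus_depth_le_rank[of "-\<infinity>" P] by (simp add: hat_def)
    ultimately show ?thesis using mdeg_nonneg[of m "-\<infinity>"] by (auto simp: v0_def split: if_splits)
  qed
  obtain v :: "'a extended \<Rightarrow> int" where
    v: "\<And>z z'. z \<in> hat P \<Longrightarrow> z' \<in> hat P \<Longrightarrow> z < z' \<Longrightarrow> v z' < v z"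
    "v \<infinity> = 0" "\<And>p. p \<notin> P \<Longrightarrow> v (Fin p) = 0" "v (Fin y) = v (Fin x) + 1"
    using exists_tight_strict_map[OF cover[unfolded P_def]] unfolding P_def by blast
  obtain m :: "'a \<Rightarrow>\<^sub>0 nat" where m: "mdeg m (-\<infinity>) = v (-\<infinity>) - e"
    and strict: "\<And>b p. b \<in> hat P \<Longrightarrow> p \<in> hat P \<Longrightarrow> b < p \<Longrightarrow>
      (\<And>z. z \<in> hat P \<Longrightarrow> z < p \<Longrightarrow> z \<noteq> b \<Longrightarrow> key z < key b) \<Longrightarrow> v p - mdeg m p < v b - mdeg m b"
    by (rule level_reduction[OF _ _ _ e, of v]) (use v in \<open>auto simp: P_def\<close>)
  define u where "u z = v z - mdeg m z" for z
  have "u (c i) + int i \<le> u (-\<infinity>)" if "i \<le> h" for i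
    using that
  proof (induction i)
    case (Suc i)
    have "u (c (Suc i)) < u (c i)" unfolding u_def using c[of i] Suc.prems by (intro strict) auto
    then show ?case using Suc by simp
  qed (simp add: c0)
  \<comment> \<open>By the degree of \<open>m\<close>, the value of \<open>u\<close> at -oo is
    \<open>e\<close>.\<close>
  from this[of h] have "u (Fin x) + int h \<le> e" using c0 m by (simp add: u_def)
  moreover have "u (d j) + int j \<le> u (Fin y)" if "j \<le> s" for j
    using that
  proof (induction j)
    case (Suc j)
    have "u (d (Suc j)) < u (d j)" unfolding u_def using d[of j] Suc.prems by (intro strict) auto
    then show ?case using Suc by simp
  qed (simp add: d0)
  from this[of s] have "int s \<le> u (Fin y)" using d0 v(2) by (simp add: u_def)
  \<comment> \<open>\<open>mdeg m\<close> is at least as large at \<open>y\<close> as at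
    \<open>x\<close>, so the difference 1 of the values of \<open>v\<close> cannot grow.\<close>
  moreover have "u (Fin y) \<le> u (Fin x) + 1"
    using v(4) mdeg_antimono[of "Fin y" "Fin x" m] cover
    by (auto simp: u_def covers_in_def hat_def P_def)
  ultimately show False using \<open>e \<le> int (rank_hat P)\<close> large by linarith
qed

end
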